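(* Let $(M,L)$ be a Finsler manifold of dimension $n\geq3$ that is horizontally integrable (i.e. $\widehat{R}=0$). If $(M,L)$ is concircularly recurrent with recurrence form $\alpha$, then $(M,L)$ is $R^h$-recurrent with the same recurrence form $\alpha$.
   Context: Setting. $(M,L)$ is a Finsler manifold (in the usual sense: $L:TM\to[0,\infty)$ is smooth on nonzero vectors, positively homogeneous of degree 1 in the fibre variable $y$, and the vertical Hessian $g$ of $\frac12L^2$ is positive definite). $\pi:\mathcal{T}M\to M$ is the bundle of nonzero tangent vectors, $\pi^{-1}(TM)$ is the pullback bundle over $\mathcal{T}M$, and $g$ is regarded as a metric on $\pi^{-1}(TM)$. Sections of $\pi^{-1}(TM)$ are called $\pi$-vector fields, denoted $\overline{X},\overline{Y},\dots$; tensor fields on $\pi^{-1}(TM)$ are called $\pi$-tensor fields, and scalar-valued forms on it scalar $\pi$-forms. The fundamental $\pi$-vector field is $\overline{\eta}(u)=(u,u)$. In the exact sequence $0\to\pi^{-1}(TM)\xrightarrow{\gamma}T(\mathcal{T}M)\xrightarrow{\rho}\pi^{-1}(TM)\to0$, $\gamma(u,v)=\frac{d}{dt}\big|_{0}(u+tv)$ is the vertical lift and $\rho(X)=(u,d\pi(X))$ for $X\in T_u(\mathcal{T}M)$. Connections. For a linear connection $D$ on $\pi^{-1}(TM)$ let $K(X)=D_X\overline{\eta}$; the horizontal space at $u$ is $H_u=\{X\in T_u(\mathcal{T}M):K(X)=0\}$ and the vertical space is $V_u=\ker d\pi$; $D$ is regular if $T_u(\mathcal{T}M)=V_u\oplus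 H_u$ for all $u$, and then $\beta:=(\rho|_{H})^{-1}$ is the horizontal map. The classical torsion is $\mathbf{T}(X,Y)=D_X\rho Y-D_Y\rho X-\rho[X,Y]$, with $Q(\overline{X},\overline{Y})=\mathbf{T}(\beta\overline{X},\beta\overline{Y})$ and $T(\overline{X},\overline{Y})=\mathbf{T}(\gamma\overline{X},\beta\overline{Y})$. The Cartan connection $\nabla$ is the unique regular connection on $\pi^{-1}(TM)$ with $\nabla g=0$, $Q=0$ and $g(T(\overline{X},\overline{Y}),\overline{Z})=g(T(\overline{X},\overline{Z}),\overline{Y})$. The $h$-covariant derivative of a $\pi$-tensor field $A$ is $(\stackrel{h}{\nabla}A)(\overline{X},\dots)=(\nabla_{\beta\overline{X}}A)(\dots)$. Curvature. The classical curvature is taken with the sign convention $\mathbf{K}(X,Y)\overline{Z}=-\nabla_X\nabla_Y\overline{Z}+\nabla_Y\nabla_X\overline{Z}+\nabla_{[X,Y]}\overline{Z}$. The horizontal curvature tensor ($h$-curvature tensor) is $R(\overline{X},\overline{Y})\overline{Z}=\mathbf{K}(\beta\overline{X},\beta\overline{Y})\overline{Z}$, and $\widehat{R}(\overline{X},\overline{Y})=R(\overline{X},\overline{Y})\overline{\eta}$. The manifold is called horizontally integrable if its horizontal distribution (that of the Cartan connection) is completely integrable, equivalently $\widehat{R}=0$. The horizontal Ricci tensor is $Ric(\overline{X},\overline{Z})=\mathrm{Tr}\{\overline{Y}\mapsto R(\overline{X},\overline{Y})\overline{Z}\}$ and the horizontal scalar curvature $r$ is its $g$-trace. $G$ is the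 $\pi$-tensor field $G(\overline{X},\overline{Y})\overline{Z}=g(\overline{X},\overline{Z})\overline{Y}-g(\overline{Y},\overline{Z})\overline{X}$. The concircular curvature tensor is $C:=R-\frac{r}{n(n-1)}G$. Recurrence. $(M,L)$ of dimension $n\ge3$ is called $R^h$-recurrent if $\stackrel{h}{\nabla}R=\lambda\otimes R$ and $R\neq0$, where $\lambda$ is a scalar $\pi$-form (of order 1), positively homogeneous of degree zero in $y$, called the recurrence form. It is called concircularly recurrent if $\stackrel{h}{\nabla}C=\alpha\otimes C$ and $C\neq0$, where $\alpha$ is a scalar $\pi$-form (of order 1), positively homogeneous of degree zero in $y$, called the recurrence form. *)

theory Defs
  imports "HOL-Analysis.Analysis" "HOL-Library.Function_Algebras"
begin

section \<open>Smooth maps between normed spaces\<close>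

text \<open>In finite dimension, on an open set, this is the usual class of \<open>C\<^sup>k\<close> maps: all iterated
  directional derivatives up to order \<open>k\<close> exist and are continuous.\<close>

primrec Ck_on :: "nat \<Rightarrow> 'e::real_normed_vector set \<Rightarrow> ('e \<Rightarrow> 'f::real_normed_vector) \<Rightarrow> bool" where
  "Ck_on 0 S f \<longleftrightarrow> continuous_on S f"
| "Ck_on (Suc k) S f \<longleftrightarrow> (\<forall>x\<in>S. f differentiable (at x)) \<and>
     (\<forall>v. Ck_on k S (\<lambda>x. frechet_derivative f (at x) v))"

definition smooth_on :: "'e::real_normed_vector set \<Rightarrow> ('e \<Rightarrow> 'f::real_normed_vector) \<Rightarrow> bool" where
  "smooth_on S f \<longleftrightarrow> (\<forall>k. Ck_on k S f)"

section \<open>Charts, atlases, tangent vectors\<close>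

text \<open>A chart is a pair consisting of its domain and its coordinate map; the coordinate map is
  only meaningful on the domain.\<close>

type_synonym ('p, 'e) chart = "'p set \<times> ('p \<Rightarrow> 'e)"

text \<open>A tangent vector at \<open>p\<close> is represented by the family of its components in all charts around
  \<open>p\<close>, subject to the transformation law; components in other charts are 0 by convention.\<close>

type_synonym ('p, 'e) tvec = "('p, 'e) chart \<Rightarrow> 'e"

text \<open>A point \<open>(p, v)\<close> of the tangent bundle.\<close>

type_synonym ('p, 'e) tpoint = "'p \<times> ('p, 'e) tvec"

text \<open>Addition and zero of tangent vectors and of fields are the pointwise ones; the following is
  the pointwise scalar multiplication.\<close>

definition tscale :: "real \<Rightarrow> ('c \<Rightarrow> 'e::real_vector) \<Rightarrow> ('c \<Rightarrow> 'e)"  (infixr "\<odot>" 75) where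
  "s \<odot> v = (\<lambda>c. s *\<^sub>R v c)"

definition fscale :: "('p \<Rightarrow> real) \<Rightarrow> ('p \<Rightarrow> 'c \<Rightarrow> 'e::real_vector) \<Rightarrow> ('p \<Rightarrow> 'c \<Rightarrow> 'e)" where
  "fscale f X = (\<lambda>p. f p \<odot> X p)"

definition carrier :: "('p, 'e) chart set \<Rightarrow> 'p set" where
  "carrier A = \<Union> (fst ` A)"

definition charts_at :: "('p, 'e) chart set \<Rightarrow> 'p \<Rightarrow> ('p, 'e) chart set" where
  "charts_at A p = {c \<in> A. p \<in> fst c}"

definition some_chart :: "('p, 'e) chart set \<Rightarrow> 'p \<Rightarrow> ('p, 'e) chart" where
  "some_chart A p = (SOME c. c \<in> charts_at A p)"

definition chart_image :: "('p, 'e) chart \<Rightarrow> 'e set" where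
  "chart_image c = snd c ` fst c"

definition chart_inv :: "('p, 'e) chart \<Rightarrow> 'e \<Rightarrow> 'p" where
  "chart_inv c = inv_into (fst c) (snd c)"

definition smooth_manifold :: "'p topology \<Rightarrow> ('p, 'e::euclidean_space) chart set \<Rightarrow> bool" where
  "smooth_manifold X A \<longleftrightarrow>
     Hausdorff_space X \<and> second_countable X \<and> carrier A = topspace X \<and>
     (\<forall>c\<in>A. openin X (fst c) \<and> open (chart_image c) \<and>
        homeomorphic_map (subtopology X (fst c)) (top_of_set (chart_image c)) (snd c)) \<and>
     (\<forall>c\<in>A. \<forall>d\<in>A. smooth_on (snd c ` (fst c \<inter> fst d)) (snd d \<circ> chart_inv c))"

definition tangent_space ::
    "('p, 'e::euclidean_space) chart set \<Rightarrow> 'p \<Rightarrow> ('p, 'e) tvec set" where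
  "tangent_space A p =
     {v. (\<forall>c. c \<notin> charts_at A p \<longrightarrow> v c = 0) \<and>
         (\<forall>c\<in>charts_at A p. \<forall>d\<in>charts_at A p.
            v d = frechet_derivative (snd d \<circ> chart_inv c) (at (snd c p)) (v c))}"

text \<open>The tangent vector at \<open>p\<close> whose component in the chart \<open>c\<close> is \<open>e\<close>; for \<open>e\<close> a standard basis
  vector this is the coordinate vector \<open>\<partial>/\<partial>x\<^sup>i\<close>.\<close>

definition coord_vec ::
    "('p, 'e::euclidean_space) chart set \<Rightarrow> ('p, 'e) chart \<Rightarrow> 'p \<Rightarrow> 'e \<Rightarrow> ('p, 'e) tvec" where
  "coord_vec A c p e = (\<lambda>d. if d \<in> charts_at A p
     then frechet_derivative (snd d \<circ> chart_inv c) (at (snd c p)) e else 0)"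

definition smooth_fun ::
    "('p, 'e::euclidean_space) chart set \<Rightarrow> ('p \<Rightarrow> real) \<Rightarrow> bool" where
  "smooth_fun A f \<longleftrightarrow> (\<forall>c\<in>A. smooth_on (chart_image c) (f \<circ> chart_inv c))"

text \<open>The derivative \<open>X f\<close> of a scalar function along a tangent vector \<open>X\<close> at \<open>p\<close>.\<close>

definition dir_deriv ::
    "('p, 'e::euclidean_space) chart set \<Rightarrow> 'p \<Rightarrow> ('p, 'e) tvec \<Rightarrow> ('p \<Rightarrow> real) \<Rightarrow> real" where
  "dir_deriv A p X f = (let c = some_chart A p in
     frechet_derivative (f \<circ> chart_inv c) (at (snd c p)) (X c))"

definition tangent_map ::
    "('p, 'e::euclidean_space) chart set \<Rightarrow> ('q, 'f::euclidean_space) chart set \<Rightarrow> ('p \<Rightarrow> 'q) \<Rightarrow>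
     'p \<Rightarrow> ('p, 'e) tvec \<Rightarrow> ('q, 'f) tvec" where
  "tangent_map A B h p X = (\<lambda>d. if d \<in> charts_at B (h p)
     then (let c = some_chart A p in
             frechet_derivative (snd d \<circ> h \<circ> chart_inv c) (at (snd c p)) (X c))
     else 0)"

text \<open>Fields are extended by 0 outside the manifold, so that they can be compared by equality.\<close>

definition vector_field ::
    "('p, 'e::euclidean_space) chart set \<Rightarrow> ('p \<Rightarrow> ('p, 'e) tvec) \<Rightarrow> bool" where
  "vector_field A X \<longleftrightarrow>
     (\<forall>p\<in>carrier A. X p \<in> tangent_space A p) \<and> (\<forall>p. p \<notin> carrier A \<longrightarrow> X p = 0) \<and>
     (\<forall>c\<in>A. smooth_on (chart_image c) ((\<lambda>p. X p c) \<circ> chart_inv c))"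

definition lie_bracket ::
    "('p, 'e::euclidean_space) chart set \<Rightarrow> ('p \<Rightarrow> ('p, 'e) tvec) \<Rightarrow> ('p \<Rightarrow> ('p, 'e) tvec) \<Rightarrow>
     'p \<Rightarrow> ('p, 'e) tvec" where
  "lie_bracket A X Y = (\<lambda>p c. if c \<in> charts_at A p
     then frechet_derivative ((\<lambda>q. Y q c) \<circ> chart_inv c) (at (snd c p)) (X p c)
        - frechet_derivative ((\<lambda>q. X q c) \<circ> chart_inv c) (at (snd c p)) (Y p c)
     else 0)"

section \<open>The bundle of nonzero tangent vectors and its pullback bundle\<close>

definition tangent_bundle :: "('p, 'e::euclidean_space) chart set \<Rightarrow> ('p, 'e) tpoint set" where
  "tangent_bundle A = {u. fst u \<in> carrier A \<and> snd u \<in> tangent_space A (fst u)}"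

definition slit_bundle :: "('p, 'e::euclidean_space) chart set \<Rightarrow> ('p, 'e) tpoint set" where
  "slit_bundle A = {u \<in> tangent_bundle A. snd u \<noteq> 0}"

text \<open>The chart \<open>(x, y)\<close> of the slit tangent bundle induced by a chart \<open>x\<close> of the base.\<close>

definition slit_chart ::
    "('p, 'e::euclidean_space) chart set \<Rightarrow> ('p, 'e) chart \<Rightarrow> (('p, 'e) tpoint, 'e \<times> 'e) chart" where
  "slit_chart A c = ({u \<in> slit_bundle A. fst u \<in> fst c}, \<lambda>u. (snd c (fst u), snd u c))"

definition slit_atlas ::
    "('p, 'e::euclidean_space) chart set \<Rightarrow> (('p, 'e) tpoint, 'e \<times> 'e) chart set" where
  "slit_atlas A = slit_chart A ` A"

text \<open>Tangent vectors of the slit tangent bundle, and fields along the projection. The fibre of the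
  pullback bundle over \<open>u\<close> is the tangent space of the base at \<open>fst u\<close> (the first component \<open>u\<close> of
  an element \<open>(u, v)\<close> of the pullback bundle is always left implicit).\<close>

type_synonym ('p, 'e) ttvec = "(('p, 'e) tpoint, 'e \<times> 'e) tvec"
type_synonym ('p, 'e) pifield = "('p, 'e) tpoint \<Rightarrow> ('p, 'e) tvec"
type_synonym ('p, 'e) ttfield = "('p, 'e) tpoint \<Rightarrow> ('p, 'e) ttvec"

definition pi_field :: "('p, 'e::euclidean_space) chart set \<Rightarrow> ('p, 'e) pifield \<Rightarrow> bool" where
  "pi_field A Z \<longleftrightarrow>
     (\<forall>u\<in>slit_bundle A. Z u \<in> tangent_space A (fst u)) \<and> (\<forall>u. u \<notin> slit_bundle A \<longrightarrow> Z u = 0) \<and>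
     (\<forall>c\<in>A. smooth_on (chart_image (slit_chart A c)) ((\<lambda>u. Z u c) \<circ> chart_inv (slit_chart A c)))"

definition fundamental_field :: "('p, 'e::euclidean_space) chart set \<Rightarrow> ('p, 'e) pifield" where
  "fundamental_field A = (\<lambda>u. if u \<in> slit_bundle A then snd u else 0)"

definition rho_at ::
    "('p, 'e::euclidean_space) chart set \<Rightarrow> ('p, 'e) tpoint \<Rightarrow> ('p, 'e) ttvec \<Rightarrow> ('p, 'e) tvec" where
  "rho_at A u X = tangent_map (slit_atlas A) A fst u X"

definition gamma_at ::
    "('p, 'e::euclidean_space) chart set \<Rightarrow> ('p, 'e) tpoint \<Rightarrow> ('p, 'e) tvec \<Rightarrow> ('p, 'e) ttvec" where
  "gamma_at A u v = (\<lambda>c. if c \<in> charts_at (slit_atlas A) u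
     then vector_derivative (\<lambda>t. snd c (fst u, snd u + t \<odot> v)) (at 0) else 0)"

definition rho :: "('p, 'e::euclidean_space) chart set \<Rightarrow> ('p, 'e) ttfield \<Rightarrow> ('p, 'e) pifield" where
  "rho A X = (\<lambda>u. if u \<in> slit_bundle A then rho_at A u (X u) else 0)"

definition gamma :: "('p, 'e::euclidean_space) chart set \<Rightarrow> ('p, 'e) pifield \<Rightarrow> ('p, 'e) ttfield" where
  "gamma A Z = (\<lambda>u. if u \<in> slit_bundle A then gamma_at A u (Z u) else 0)"

section \<open>Finsler manifolds\<close>

text \<open>The vertical Hessian of \<open>L\<^sup>2/2\<close> at \<open>u = (p, y)\<close>, evaluated on tangent vectors \<open>a\<close>, \<open>b\<close> at \<open>p\<close>.\<close>

definition finsler_metric ::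
    "(('p, 'e::euclidean_space) tpoint \<Rightarrow> real) \<Rightarrow> ('p, 'e) tpoint \<Rightarrow>
     ('p, 'e) tvec \<Rightarrow> ('p, 'e) tvec \<Rightarrow> real" where
  "finsler_metric L u a b =
     deriv (\<lambda>s. deriv (\<lambda>t. (L (fst u, snd u + s \<odot> a + t \<odot> b))\<^sup>2 / 2) 0) 0"

definition finsler_manifold ::
    "'p topology \<Rightarrow> ('p, 'e::euclidean_space) chart set \<Rightarrow> (('p, 'e) tpoint \<Rightarrow> real) \<Rightarrow> bool" where
  "finsler_manifold X A L \<longleftrightarrow>
     smooth_manifold X A \<and>
     (\<forall>u\<in>tangent_bundle A. L u \<ge> 0) \<and>
     (\<forall>u\<in>tangent_bundle A. \<forall>t>0. L (fst u, t \<odot> snd u) = t * L u) \<and>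
     smooth_fun (slit_atlas A) L \<and>
     (\<forall>u\<in>slit_bundle A. \<forall>a\<in>tangent_space A (fst u). a \<noteq> 0 \<longrightarrow> finsler_metric L u a a > 0)"

section \<open>Connections on the pullback bundle\<close>

text \<open>A connection is given as \<open>D u X Z\<close>, the covariant derivative at the point \<open>u\<close> of the section
  \<open>Z\<close> in the direction of the tangent vector \<open>X\<close> of the slit bundle at \<open>u\<close>.\<close>

type_synonym ('p, 'e) picon =
  "('p, 'e) tpoint \<Rightarrow> ('p, 'e) ttvec \<Rightarrow> ('p, 'e) pifield \<Rightarrow> ('p, 'e) tvec"

definition cov ::
    "('p, 'e::euclidean_space) chart set \<Rightarrow> ('p, 'e) picon \<Rightarrow> ('p, 'e) ttfield \<Rightarrow> ('p, 'e) pifield \<Rightarrow>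
     ('p, 'e) pifield" where
  "cov A D X Z = (\<lambda>u. if u \<in> slit_bundle A then D u (X u) Z else 0)"

definition linear_connection ::
    "('p, 'e::euclidean_space) chart set \<Rightarrow> ('p, 'e) picon \<Rightarrow> bool" where
  "linear_connection A D \<longleftrightarrow>
     (\<forall>u\<in>slit_bundle A. \<forall>X\<in>tangent_space (slit_atlas A) u. \<forall>Z. pi_field A Z \<longrightarrow>
        D u X Z \<in> tangent_space A (fst u)) \<and>
     (\<forall>u\<in>slit_bundle A. \<forall>X\<in>tangent_space (slit_atlas A) u. \<forall>Y\<in>tangent_space (slit_atlas A) u.
        \<forall>Z. pi_field A Z \<longrightarrow> D u (X + Y) Z = D u X Z + D u Y Z) \<and>
     (\<forall>u\<in>slit_bundle A. \<forall>X\<in>tangent_space (slit_atlas A) u. \<forall>s. \<forall>Z. pi_field A Z \<longrightarrow>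
        D u (s \<odot> X) Z = s \<odot> D u X Z) \<and>
     (\<forall>u\<in>slit_bundle A. \<forall>X\<in>tangent_space (slit_atlas A) u. \<forall>Z W. pi_field A Z \<longrightarrow> pi_field A W \<longrightarrow>
        D u X (Z + W) = D u X Z + D u X W) \<and>
     (\<forall>u\<in>slit_bundle A. \<forall>X\<in>tangent_space (slit_atlas A) u. \<forall>f Z.
        smooth_fun (slit_atlas A) f \<longrightarrow> pi_field A Z \<longrightarrow>
        D u X (fscale f Z) = dir_deriv (slit_atlas A) u X f \<odot> Z u + f u \<odot> D u X Z) \<and>
     (\<forall>X Z. vector_field (slit_atlas A) X \<longrightarrow> pi_field A Z \<longrightarrow> pi_field A (cov A D X Z))"

definition vertical_space ::
    "('p, 'e::euclidean_space) chart set \<Rightarrow> ('p, 'e) tpoint \<Rightarrow> ('p, 'e) ttvec set" where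
  "vertical_space A u = {X \<in> tangent_space (slit_atlas A) u. rho_at A u X = 0}"

definition horizontal_space ::
    "('p, 'e::euclidean_space) chart set \<Rightarrow> ('p, 'e) picon \<Rightarrow> ('p, 'e) tpoint \<Rightarrow>
     ('p, 'e) ttvec set" where
  "horizontal_space A D u =
     {X \<in> tangent_space (slit_atlas A) u. D u X (fundamental_field A) = 0}"

definition regular_connection ::
    "('p, 'e::euclidean_space) chart set \<Rightarrow> ('p, 'e) picon \<Rightarrow> bool" where
  "regular_connection A D \<longleftrightarrow> linear_connection A D \<and>
     (\<forall>u\<in>slit_bundle A.
        vertical_space A u \<inter> horizontal_space A D u = {0} \<and>
        (\<forall>X\<in>tangent_space (slit_atlas A) u.
           \<exists>V\<in>vertical_space A u. \<exists>H\<in>horizontal_space A D u. X = V + H))"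

definition beta ::
    "('p, 'e::euclidean_space) chart set \<Rightarrow> ('p, 'e) picon \<Rightarrow> ('p, 'e) pifield \<Rightarrow> ('p, 'e) ttfield" where
  "beta A D Z = (\<lambda>u. if u \<in> slit_bundle A
     then inv_into (horizontal_space A D u) (rho_at A u) (Z u) else 0)"

definition classical_torsion ::
    "('p, 'e::euclidean_space) chart set \<Rightarrow> ('p, 'e) picon \<Rightarrow> ('p, 'e) ttfield \<Rightarrow> ('p, 'e) ttfield \<Rightarrow>
     ('p, 'e) pifield" where
  "classical_torsion A D X Y =
     cov A D X (rho A Y) - cov A D Y (rho A X) - rho A (lie_bracket (slit_atlas A) X Y)"

definition h_torsion ::
    "('p, 'e::euclidean_space) chart set \<Rightarrow> ('p, 'e) picon \<Rightarrow> ('p, 'e) pifield \<Rightarrow> ('p, 'e) pifield \<Rightarrow>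
     ('p, 'e) pifield" where
  "h_torsion A D X Y = classical_torsion A D (beta A D X) (beta A D Y)"

definition hv_torsion ::
    "('p, 'e::euclidean_space) chart set \<Rightarrow> ('p, 'e) picon \<Rightarrow> ('p, 'e) pifield \<Rightarrow> ('p, 'e) pifield \<Rightarrow>
     ('p, 'e) pifield" where
  "hv_torsion A D X Y = classical_torsion A D (gamma A X) (beta A D Y)"

definition metric_connection ::
    "('p, 'e::euclidean_space) chart set \<Rightarrow> (('p, 'e) tpoint \<Rightarrow> real) \<Rightarrow> ('p, 'e) picon \<Rightarrow> bool" where
  "metric_connection A L D \<longleftrightarrow>
     (\<forall>u\<in>slit_bundle A. \<forall>X\<in>tangent_space (slit_atlas A) u. \<forall>Y Z. pi_field A Y \<longrightarrow> pi_field A Z \<longrightarrow>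
        dir_deriv (slit_atlas A) u X (\<lambda>w. finsler_metric L w (Y w) (Z w)) =
          finsler_metric L u (D u X Y) (Z u) + finsler_metric L u (Y u) (D u X Z))"

definition cartan_connection ::
    "('p, 'e::euclidean_space) chart set \<Rightarrow> (('p, 'e) tpoint \<Rightarrow> real) \<Rightarrow> ('p, 'e) picon \<Rightarrow> bool" where
  "cartan_connection A L D \<longleftrightarrow>
     regular_connection A D \<and> metric_connection A L D \<and>
     (\<forall>X Y. pi_field A X \<longrightarrow> pi_field A Y \<longrightarrow> h_torsion A D X Y = 0) \<and>
     (\<forall>X Y Z. pi_field A X \<longrightarrow> pi_field A Y \<longrightarrow> pi_field A Z \<longrightarrow>
        (\<forall>u\<in>slit_bundle A. finsler_metric L u (hv_torsion A D X Y u) (Z u) =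
                           finsler_metric L u (hv_torsion A D X Z u) (Y u)))"

section \<open>Curvature\<close>

definition classical_curvature ::
    "('p, 'e::euclidean_space) chart set \<Rightarrow> ('p, 'e) picon \<Rightarrow> ('p, 'e) ttfield \<Rightarrow> ('p, 'e) ttfield \<Rightarrow>
     ('p, 'e) pifield \<Rightarrow> ('p, 'e) pifield" where
  "classical_curvature A D X Y Z =
     - cov A D X (cov A D Y Z) + cov A D Y (cov A D X Z) + cov A D (lie_bracket (slit_atlas A) X Y) Z"

text \<open>Tensor fields of type (1,3) on the pullback bundle, as maps on sections.\<close>

type_synonym ('p, 'e) pitensor =
  "('p, 'e) pifield \<Rightarrow> ('p, 'e) pifield \<Rightarrow> ('p, 'e) pifield \<Rightarrow> ('p, 'e) pifield"

definition h_curvature ::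
    "('p, 'e::euclidean_space) chart set \<Rightarrow> ('p, 'e) picon \<Rightarrow> ('p, 'e) pitensor" where
  "h_curvature A D X Y Z = classical_curvature A D (beta A D X) (beta A D Y) Z"

definition horizontally_integrable ::
    "('p, 'e::euclidean_space) chart set \<Rightarrow> ('p, 'e) picon \<Rightarrow> bool" where
  "horizontally_integrable A D \<longleftrightarrow>
     (\<forall>X Y. pi_field A X \<longrightarrow> pi_field A Y \<longrightarrow> h_curvature A D X Y (fundamental_field A) = 0)"

text \<open>Some section through a given vector \<open>a\<close> of the fibre over \<open>u\<close>; it is used to evaluate tensor
  fields on vectors, where the choice is immaterial by tensoriality.\<close>

definition pi_extension ::
    "('p, 'e::euclidean_space) chart set \<Rightarrow> ('p, 'e) tpoint \<Rightarrow> ('p, 'e) tvec \<Rightarrow> ('p, 'e) pifield" where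
  "pi_extension A u a = (SOME Z. pi_field A Z \<and> Z u = a)"

text \<open>The coordinate basis, with respect to an arbitrarily chosen chart, of the fibre over \<open>u\<close>.
  Traces do not depend on the chart.\<close>

definition coord_basis ::
    "('p, real^'n) chart set \<Rightarrow> ('p, real^'n) tpoint \<Rightarrow> 'n \<Rightarrow> ('p, real^'n) tvec" where
  "coord_basis A u i = coord_vec A (some_chart A (fst u)) (fst u) (axis i 1)"

definition h_ricci ::
    "('p, real^'n) chart set \<Rightarrow> ('p, real^'n) picon \<Rightarrow> ('p, real^'n) pifield \<Rightarrow>
     ('p, real^'n) pifield \<Rightarrow> ('p, real^'n) tpoint \<Rightarrow> real" where
  "h_ricci A D X Z u =
     (\<Sum>i\<in>UNIV. h_curvature A D X (pi_extension A u (coord_basis A u i)) Z u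
                  (some_chart A (fst u)) $ i)"

text \<open>\<open>r = g\<^sup>i\<^sup>j Ric\<^sub>i\<^sub>j\<close>\<close>

definition h_scalar_curvature ::
    "('p, real^'n) chart set \<Rightarrow> (('p, real^'n) tpoint \<Rightarrow> real) \<Rightarrow> ('p, real^'n) picon \<Rightarrow>
     ('p, real^'n) tpoint \<Rightarrow> real" where
  "h_scalar_curvature A L D u =
     (let g = (\<chi> i j. finsler_metric L u (coord_basis A u i) (coord_basis A u j)) in
      \<Sum>i\<in>UNIV. \<Sum>j\<in>UNIV. matrix_inv g $ i $ j *
        h_ricci A D (pi_extension A u (coord_basis A u i)) (pi_extension A u (coord_basis A u j)) u)"

definition G_tensor ::
    "(('p, 'e::euclidean_space) tpoint \<Rightarrow> real) \<Rightarrow> ('p, 'e) pitensor" where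
  "G_tensor L X Y Z = (\<lambda>u. finsler_metric L u (X u) (Z u) \<odot> Y u - finsler_metric L u (Y u) (Z u) \<odot> X u)"

definition concircular_curvature ::
    "('p, real^'n) chart set \<Rightarrow> (('p, real^'n) tpoint \<Rightarrow> real) \<Rightarrow> ('p, real^'n) picon \<Rightarrow>
     ('p, real^'n) pitensor" where
  "concircular_curvature A L D X Y Z =
     h_curvature A D X Y Z -
     fscale (\<lambda>u. h_scalar_curvature A L D u / (real CARD('n) * (real CARD('n) - 1))) (G_tensor L X Y Z)"

section \<open>Recurrence\<close>

text \<open>\<open>h_cov A D S W X Y Z\<close> is the \<open>h\<close>-covariant derivative of \<open>S\<close> in the direction \<open>W\<close>, evaluated on
  \<open>X, Y, Z\<close>.\<close>

definition h_cov ::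
    "('p, 'e::euclidean_space) chart set \<Rightarrow> ('p, 'e) picon \<Rightarrow> ('p, 'e) pitensor \<Rightarrow>
     ('p, 'e) pifield \<Rightarrow> ('p, 'e) pitensor" where
  "h_cov A D S W X Y Z =
     (let d = cov A D (beta A D W) in d (S X Y Z) - S (d X) Y Z - S X (d Y) Z - S X Y (d Z))"

type_synonym ('p, 'e) piform = "('p, 'e) tpoint \<Rightarrow> ('p, 'e) tvec \<Rightarrow> real"

definition pi_form :: "('p, 'e::euclidean_space) chart set \<Rightarrow> ('p, 'e) piform \<Rightarrow> bool" where
  "pi_form A \<alpha> \<longleftrightarrow>
     (\<forall>u\<in>slit_bundle A. \<forall>a\<in>tangent_space A (fst u). \<forall>b\<in>tangent_space A (fst u).
        \<alpha> u (a + b) = \<alpha> u a + \<alpha> u b) \<and>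
     (\<forall>u\<in>slit_bundle A. \<forall>a\<in>tangent_space A (fst u). \<forall>s. \<alpha> u (s \<odot> a) = s * \<alpha> u a) \<and>
     (\<forall>X. pi_field A X \<longrightarrow> smooth_fun (slit_atlas A) (\<lambda>u. \<alpha> u (X u)))"

definition homogeneous_degree_0 ::
    "('p, 'e::euclidean_space) chart set \<Rightarrow> ('p, 'e) piform \<Rightarrow> bool" where
  "homogeneous_degree_0 A \<alpha> \<longleftrightarrow>
     (\<forall>u\<in>slit_bundle A. \<forall>a\<in>tangent_space A (fst u). \<forall>t>0. \<alpha> (fst u, t \<odot> snd u) a = \<alpha> u a)"

definition recurrent_tensor ::
    "('p, 'e::euclidean_space) chart set \<Rightarrow> ('p, 'e) picon \<Rightarrow> ('p, 'e) pitensor \<Rightarrow>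
     ('p, 'e) piform \<Rightarrow> bool" where
  "recurrent_tensor A D S \<alpha> \<longleftrightarrow>
     pi_form A \<alpha> \<and> homogeneous_degree_0 A \<alpha> \<and>
     (\<forall>W X Y Z. pi_field A W \<longrightarrow> pi_field A X \<longrightarrow> pi_field A Y \<longrightarrow> pi_field A Z \<longrightarrow>
        h_cov A D S W X Y Z = fscale (\<lambda>u. \<alpha> u (W u)) (S X Y Z)) \<and>
     (\<exists>X Y Z. pi_field A X \<and> pi_field A Y \<and> pi_field A Z \<and> S X Y Z \<noteq> 0)"

definition Rh_recurrent ::
    "('p, real^'n) chart set \<Rightarrow> ('p, real^'n) picon \<Rightarrow> ('p, real^'n) piform \<Rightarrow> bool" where
  "Rh_recurrent A D \<alpha> \<longleftrightarrow> recurrent_tensor A D (h_curvature A D) \<alpha>"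

definition concircularly_recurrent ::
    "('p, real^'n) chart set \<Rightarrow> (('p, real^'n) tpoint \<Rightarrow> real) \<Rightarrow> ('p, real^'n) picon \<Rightarrow>
     ('p, real^'n) piform \<Rightarrow> bool" where
  "concircularly_recurrent A L D \<alpha> \<longleftrightarrow> recurrent_tensor A D (concircular_curvature A L D) \<alpha>"

end

theory Submission
  imports Defs
begin

text \<open>Put \<open>f = r / (n (n - 1))\<close>, so that \<open>C = R - f G\<close>. The connection is metric, hence \<open>G\<close> is
  parallel and the recurrence of \<open>C\<close> reads \<open>\<nabla>\<^sub>W R - (W f) G = \<alpha>(W) (R - f G)\<close>, with \<open>W f\<close> the derivative
  of \<open>f\<close> along \<open>\<beta> W\<close>. On \<open>\<eta>\<close>, which is horizontally parallel and is annihilated by \<open>R\<close>, this becomes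
  \<open>(W f - \<alpha>(W) f) G(X, Y)\<eta> = 0\<close>; taking \<open>X = \<eta>\<close> and \<open>Y\<close> independent of \<open>\<eta>\<close> gives \<open>W f = \<alpha>(W) f\<close>,
  and the recurrence of \<open>R\<close> follows. Moreover \<open>R = 0\<close> would force \<open>r = 0\<close> and \<open>C = 0\<close>.

  The Leibniz rule for \<open>\<nabla>(f G)\<close> needs the smoothness of \<open>f\<close>, and that is where the work lies: \<open>\<beta>\<close> must
  map sections to smooth vector fields, \<open>R\<close> must be tensorial, and the traces defining \<open>r\<close> must be
  computable in a smooth local frame, obtained from coordinate fields by multiplication with bump functions.\<close>

section \<open>Calculus of smooth maps\<close>

text \<open>\<open>D\<close> acts on globally defined sections, and \<open>linear_connection\<close>
  grants its Leibniz rule only for functions smooth on the whole slit bundle. Coordinate fields and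
  chart components cannot be inserted directly, so they carry a factor \<open>\<phi>\<close>, whose
  powers are divided out at points where it does not vanish. A second obstacle is that
  \<open>h_ricci\<close> and \<open>h_scalar_curvature\<close> pick a chart and extensions by
  \<open>SOME\<close> separately at each point, so their definitions show no smooth dependence on
  the point. The remedy is pointwise: tensoriality of \<open>R\<close> makes the extensions
  irrelevant, invariance of traces makes the chart irrelevant, and in one fixed frame the value is a
  rational expression in smooth functions. Smoothness of \<open>R\<close> on a frame rests on the
  Lie bracket of two horizontal lifts being a smooth field, hence on the symmetry of second
  derivatives of transition maps; the lifts themselves solve linear systems, hence Cramer's
  rule.\<close>

abbreviation fderiv :: "('e::real_normed_vector \<Rightarrow> 'f::real_normed_vector) \<Rightarrow> 'e \<Rightarrow> 'e \<Rightarrow> 'f" where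
  "fderiv f x \<equiv> frechet_derivative f (at x)"

lemma fderiv_eq: "(f has_derivative f') (at x) \<Longrightarrow> fderiv f x = f'"
  using frechet_derivative_at by metis

lemma has_fderiv: "f differentiable (at x) \<Longrightarrow> (f has_derivative fderiv f x) (at x)"
  using frechet_derivative_works by blast

section \<open>Closure properties of maps of class \<open>C\<^sup>k\<close>\<close>

lemma Ck_on_cong:
  assumes "open S" "\<And>x. x \<in> S \<Longrightarrow> f x = g x" "Ck_on k S f"
  shows "Ck_on k S g"
  using assms(2,3)
proof (induction k arbitrary: f g)
  case 0
  then show ?case using continuous_on_cong by (metis Ck_on.simps(1))
next
  case (Suc k)
  have d: "f differentiable (at x)" if "x \<in> S" for x using Suc.prems that by simp
  \<comment> \<open>\<open>frechet_derivative\<close> looks at a full neighbourhood of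
    \<open>x\<close>, which agreement on \<open>S\<close> controls because \<open>S\<close> is
    open.\<close>
  have e: "fderiv f x = fderiv g x" if "x \<in> S" for x
    by (rule frechet_derivative_transform_within_open[OF d[OF that] assms(1) that]) (use Suc.prems in auto)
  have "g differentiable (at x)" if "x \<in> S" for x
    using has_derivative_transform_within_open[OF has_fderiv[OF d[OF that]] assms(1) that] Suc.prems(1)
      differentiable_def by blast
  moreover have "Ck_on k S (\<lambda>x. fderiv g x v)" for v
    by (rule Suc.IH[of "\<lambda>x. fderiv f x v"]) (use Suc.prems e in auto)
  ultimately show ?case by simp
qed

lemma Ck_on_subset: "Ck_on k S f \<Longrightarrow> T \<subseteq> S \<Longrightarrow> Ck_on k T f"
  by (induction k arbitrary: f) (auto intro: continuous_on_subset)

lemma Ck_on_SucD: "Ck_on (Suc k) S f \<Longrightarrow> Ck_on k S f"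
proof (induction k arbitrary: f)
  case 0
  then show ?case
    by (auto intro!: differentiable_imp_continuous_on simp: differentiable_on_def differentiable_at_withinI)
next
  case (Suc k)
  then show ?case by (metis Ck_on.simps(2))
qed

text \<open>Differentiability is taken at points and not within \<open>S\<close>, so it passes to
  unions at once; openness of the pieces serves the continuity at order 0.\<close>

lemma Ck_on_UN:
  assumes "\<And>i. i \<in> I \<Longrightarrow> open (T i)" "\<And>i. i \<in> I \<Longrightarrow> Ck_on k (T i) f"
  shows "Ck_on k (\<Union>i\<in>I. T i) f"
  using assms(2)
proof (induction k arbitrary: f)
  case 0
  then show ?case using assms(1) by (simp add: continuous_on_open_UN)
next
  case (Suc k)
  then show ?case by auto
qed

lemma Ck_on_const: "Ck_on k S (\<lambda>x. c)"
  by (induction k arbitrary: c) auto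

lemma Ck_on_bounded_linear: "bounded_linear f \<Longrightarrow> Ck_on k S f"
proof (cases k)
  case 0
  assume "bounded_linear f"
  then show ?thesis using 0 linear_continuous_on by simp
next
  case (Suc m)
  assume bl: "bounded_linear f"
  have "fderiv f x = f" for x using fderiv_eq bounded_linear_imp_has_derivative[OF bl] by metis
  then show ?thesis using Suc bl by (auto intro: bounded_linear_imp_differentiable Ck_on_const)
qed

lemma Ck_on_add:
  assumes "open S" "Ck_on k S f" "Ck_on k S g"
  shows "Ck_on k S (\<lambda>x. f x + g x)"
  using assms(2,3)
proof (induction k arbitrary: f g)
  case 0
  then show ?case by (auto intro: continuous_intros)
next
  case (Suc k)
  have d: "((\<lambda>x. f x + g x) has_derivative (\<lambda>v. fderiv f x v + fderiv g x v)) (at x)"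
    if "x \<in> S" for x using Suc.prems that
    by (auto intro!: has_derivative_add has_fderiv)
  have "Ck_on k S (\<lambda>x. fderiv (\<lambda>x. f x + g x) x v)" for v
    by (rule Ck_on_cong[OF assms(1), of "\<lambda>x. fderiv f x v + fderiv g x v"])
      (use Suc in \<open>auto simp: fderiv_eq[OF d]\<close>)
  then show ?case using d differentiable_def by (simp, blast)
qed

text \<open>Covers multiplication, scaling and the inner product at once. The product rule also
  contains the undifferentiated factors, which is why the induction needs
  \<open>Ck_on_SucD\<close>.\<close>

lemma Ck_on_bilinear:
  assumes "bounded_bilinear B" "open S" "Ck_on k S f" "Ck_on k S g"
  shows "Ck_on k S (\<lambda>x. B (f x) (g x))"
  using assms(3,4)
proof (induction k arbitrary: f g)
  case 0
  then show ?case by (auto intro: bounded_bilinear.continuous_on[OF assms(1)])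
next
  case (Suc k)
  have d: "((\<lambda>x. B (f x) (g x)) has_derivative (\<lambda>v. B (f x) (fderiv g x v) + B (fderiv f x v) (g x))) (at x)"
    if "x \<in> S" for x using Suc.prems that
    by (auto intro!: bounded_bilinear.FDERIV[OF assms(1)] has_fderiv)
  have fg: "Ck_on k S f" "Ck_on k S g" using Suc.prems Ck_on_SucD by blast+
  have "Ck_on k S (\<lambda>x. fderiv (\<lambda>x. B (f x) (g x)) x v)" for v
    by (rule Ck_on_cong[OF assms(2), of "\<lambda>x. B (f x) (fderiv g x v) + B (fderiv f x v) (g x)"])
      (use Suc fg in \<open>auto simp: fderiv_eq[OF d] intro!: Ck_on_add[OF assms(2)]\<close>)
  then show ?case using d differentiable_def by (simp, blast)
qed

lemma Ck_on_sum:
  assumes "open S" "\<And>i. i \<in> I \<Longrightarrow> Ck_on k S (f i)"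
  shows "Ck_on k S (\<lambda>x. \<Sum>i\<in>I. f i x)"
  using assms(2) by (induction I rule: infinite_finite_induct) (auto intro: Ck_on_const Ck_on_add assms(1))

text \<open>In the chain rule the direction \<open>Df(x) v\<close> moves with \<open>x\<close>,
  while \<open>Ck_on\<close> speaks of derivatives in fixed directions. Expanding in the basis of
  the intermediate space leaves derivatives of \<open>g\<close> in basis directions, to which the
  induction hypothesis applies.\<close>

lemma Ck_on_compose:
  fixes f :: "'a::real_normed_vector \<Rightarrow> 'b::euclidean_space" and g :: "'b \<Rightarrow> 'c::real_normed_vector"
  assumes "open S" "Ck_on k S f" "Ck_on k T g" "f ` S \<subseteq> T"
  shows "Ck_on k S (\<lambda>x. g (f x))"
  using assms(2-)
proof (induction k arbitrary: g)
  case 0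
  then show ?case using continuous_on_compose2 by (metis Ck_on.simps(1))
next
  case (Suc k)
  have d: "((\<lambda>x. g (f x)) has_derivative (\<lambda>v. fderiv g (f x) (fderiv f x v))) (at x)"
    if "x \<in> S" for x using Suc.prems that
    by (intro diff_chain_at[of f _ x g, unfolded o_def] has_fderiv) auto
  have fk: "Ck_on k S f" using Suc.prems Ck_on_SucD by blast
  have e: "fderiv (\<lambda>x. g (f x)) x v = (\<Sum>b\<in>Basis. (fderiv f x v \<bullet> b) *\<^sub>R fderiv g (f x) b)"
    if "x \<in> S" for x v
  proof -
    have l: "linear (fderiv g (f x))" using Suc.prems that by (intro linear_frechet_derivative) auto
    have "fderiv g (f x) (fderiv f x v) = fderiv g (f x) (\<Sum>b\<in>Basis. (fderiv f x v \<bullet> b) *\<^sub>R b)"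
      by (simp add: euclidean_representation)
    also have "\<dots> = (\<Sum>b\<in>Basis. (fderiv f x v \<bullet> b) *\<^sub>R fderiv g (f x) b)"
      by (simp add: linear_sum[OF l] linear_scale[OF l])
    finally show ?thesis using fderiv_eq[OF d[OF that]] by simp
  qed
  have "Ck_on k S (\<lambda>x. (fderiv f x v \<bullet> b) *\<^sub>R fderiv g (f x) b)" for v b
    by (intro Ck_on_bilinear[OF bounded_bilinear_scaleR assms(1)] Ck_on_bilinear[OF bounded_bilinear_inner assms(1)]
        Ck_on_const Suc.IH fk) (use Suc.prems in auto)
  then have "Ck_on k S (\<lambda>x. \<Sum>b\<in>Basis. (fderiv f x v \<bullet> b) *\<^sub>R fderiv g (f x) b)" for v
    by (intro Ck_on_sum assms(1)) auto
  then have "Ck_on k S (\<lambda>x. fderiv (\<lambda>x. g (f x)) x v)" for v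
    by (rule Ck_on_cong[OF assms(1), rotated]) (use e in auto)
  then show ?case using d differentiable_def by (simp, blast)
qed

text \<open>The derivative of a reciprocal is a product of reciprocals and the derivative of
  \<open>f\<close>, so the induction feeds on itself.\<close>

lemma Ck_on_inverse:
  fixes f :: "'a::real_normed_vector \<Rightarrow> real"
  assumes "open S" "Ck_on k S f" "\<And>x. x \<in> S \<Longrightarrow> f x \<noteq> 0"
  shows "Ck_on k S (\<lambda>x. inverse (f x))"
  using assms(2)
proof (induction k)
  case 0
  then show ?case using assms(3) by (auto intro: continuous_on_inverse)
next
  case (Suc k)
  have d: "((\<lambda>x. inverse (f x)) has_derivative (\<lambda>v. - (inverse (f x) * fderiv f x v * inverse (f x)))) (at x)"
    if "x \<in> S" for x
    by (rule Deriv.has_derivative_inverse[of f, OF assms(3)[OF that] has_fderiv]) (use Suc.prems that in simp)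
  have ik: "Ck_on k S (\<lambda>x. inverse (f x))" using Suc Ck_on_SucD by blast
  have m: "Ck_on k S (\<lambda>x. (-1) * (inverse (f x) * fderiv f x v * inverse (f x)))" for v
    by (intro Ck_on_bilinear[OF bounded_bilinear_mult assms(1)] ik Ck_on_const) (use Suc.prems in simp)
  have "Ck_on k S (\<lambda>x. fderiv (\<lambda>x. inverse (f x)) x v)" for v
    by (rule Ck_on_cong[OF assms(1) _ m]) (auto simp: fderiv_eq[OF d])
  then show ?case using d differentiable_def by (simp, blast)
qed

section \<open>Closure properties of smooth maps\<close>

lemma smooth_on_cong:
  "open S \<Longrightarrow> (\<And>x. x \<in> S \<Longrightarrow> f x = g x) \<Longrightarrow> smooth_on S f \<Longrightarrow> smooth_on S g"
  unfolding smooth_on_def using Ck_on_cong by blast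

lemma smooth_on_subset: "smooth_on S f \<Longrightarrow> T \<subseteq> S \<Longrightarrow> smooth_on T f"
  unfolding smooth_on_def using Ck_on_subset by blast

lemma smooth_on_local:
  assumes "\<And>x. x \<in> S \<Longrightarrow> \<exists>T. open T \<and> x \<in> T \<and> smooth_on T f"
  shows "smooth_on S f"
proof -
  obtain T where T: "\<And>x. x \<in> S \<Longrightarrow> open (T x) \<and> x \<in> T x \<and> smooth_on (T x) f" using assms by metis
  have "smooth_on (\<Union>x\<in>S. T x) f"
    unfolding smooth_on_def using T by (auto intro!: Ck_on_UN simp: smooth_on_def)
  then show ?thesis by (rule smooth_on_subset) (use T in auto)
qed

lemma smooth_on_union:
  "open S \<Longrightarrow> open T \<Longrightarrow> smooth_on S f \<Longrightarrow> smooth_on T f \<Longrightarrow> smooth_on (S \<union> T) f"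
  by (rule smooth_on_local) blast

lemma smooth_on_differentiable: "smooth_on S f \<Longrightarrow> x \<in> S \<Longrightarrow> f differentiable (at x)"
  unfolding smooth_on_def by (metis Ck_on.simps(2))

lemma smooth_on_fderiv: "smooth_on S f \<Longrightarrow> smooth_on S (\<lambda>x. fderiv f x v)"
  unfolding smooth_on_def by (metis Ck_on.simps(2))

lemma smooth_on_continuous: "smooth_on S f \<Longrightarrow> continuous_on S f"
  unfolding smooth_on_def by (metis Ck_on.simps(1))

lemma smooth_on_const: "smooth_on S (\<lambda>x. c)"
  unfolding smooth_on_def by (simp add: Ck_on_const)

lemma smooth_on_bounded_linear: "bounded_linear f \<Longrightarrow> smooth_on S f"
  unfolding smooth_on_def by (simp add: Ck_on_bounded_linear)

lemma smooth_on_ident: "smooth_on S (\<lambda>x. x)"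
  by (simp add: smooth_on_bounded_linear)

lemma smooth_on_add: "open S \<Longrightarrow> smooth_on S f \<Longrightarrow> smooth_on S g \<Longrightarrow> smooth_on S (\<lambda>x. f x + g x)"
  unfolding smooth_on_def by (simp add: Ck_on_add)

lemma smooth_on_bilinear:
  "bounded_bilinear B \<Longrightarrow> open S \<Longrightarrow> smooth_on S f \<Longrightarrow> smooth_on S g \<Longrightarrow> smooth_on S (\<lambda>x. B (f x) (g x))"
  unfolding smooth_on_def by (simp add: Ck_on_bilinear)

lemmas smooth_on_scaleR = smooth_on_bilinear[OF bounded_bilinear_scaleR]
lemmas smooth_on_inner = smooth_on_bilinear[OF bounded_bilinear_inner]
lemmas smooth_on_mult = smooth_on_bilinear[OF bounded_bilinear_mult]

lemma smooth_on_minus: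
  assumes "open S" "smooth_on S f" shows "smooth_on S (\<lambda>x. - f x)"
  using smooth_on_scaleR[OF assms(1) smooth_on_const[of S "-1"] assms(2)] by simp

lemma smooth_on_diff:
  assumes "open S" "smooth_on S f" "smooth_on S g" shows "smooth_on S (\<lambda>x. f x - g x)"
  using smooth_on_add[OF assms(1,2) smooth_on_minus[OF assms(1,3)]] by simp

lemma smooth_on_sum:
  "open S \<Longrightarrow> (\<And>i. i \<in> I \<Longrightarrow> smooth_on S (f i)) \<Longrightarrow> smooth_on S (\<lambda>x. \<Sum>i\<in>I. f i x)"
  unfolding smooth_on_def by (simp add: Ck_on_sum)

lemma smooth_on_prod:
  fixes f :: "'i \<Rightarrow> 'a::real_normed_vector \<Rightarrow> real"
  shows "open S \<Longrightarrow> (\<And>i. i \<in> I \<Longrightarrow> smooth_on S (f i)) \<Longrightarrow> smooth_on S (\<lambda>x. \<Prod>i\<in>I. f i x)"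
  by (induction I rule: infinite_finite_induct) (auto intro: smooth_on_const smooth_on_mult)

lemma smooth_on_power:
  fixes f :: "'a::real_normed_vector \<Rightarrow> real"
  shows "open S \<Longrightarrow> smooth_on S f \<Longrightarrow> smooth_on S (\<lambda>x. f x ^ n)"
  by (induction n) (auto intro: smooth_on_const smooth_on_mult)

lemma smooth_on_inverse:
  fixes f :: "'a::real_normed_vector \<Rightarrow> real"
  shows "open S \<Longrightarrow> smooth_on S f \<Longrightarrow> (\<And>x. x \<in> S \<Longrightarrow> f x \<noteq> 0) \<Longrightarrow> smooth_on S (\<lambda>x. inverse (f x))"
  unfolding smooth_on_def by (simp add: Ck_on_inverse)

lemma smooth_on_divide:
  fixes f :: "'a::real_normed_vector \<Rightarrow> real"
  shows "open S \<Longrightarrow> smooth_on S f \<Longrightarrow> smooth_on S g \<Longrightarrow> (\<And>x. x \<in> S \<Longrightarrow> g x \<noteq> 0) \<Longrightarrow>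
    smooth_on S (\<lambda>x. f x / g x)"
  unfolding divide_inverse by (intro smooth_on_mult smooth_on_inverse) auto

lemma smooth_on_compose:
  fixes f :: "'a::real_normed_vector \<Rightarrow> 'b::euclidean_space"
  shows "open S \<Longrightarrow> smooth_on S f \<Longrightarrow> smooth_on T g \<Longrightarrow> f ` S \<subseteq> T \<Longrightarrow> smooth_on S (\<lambda>x. g (f x))"
  unfolding smooth_on_def by (blast intro: Ck_on_compose)

lemma smooth_on_linear:
  fixes f :: "'a::real_normed_vector \<Rightarrow> 'b::euclidean_space"
  assumes "open S" "smooth_on S f" "bounded_linear g"
  shows "smooth_on S (\<lambda>x. g (f x))"
  by (rule smooth_on_compose[OF assms(1,2) smooth_on_bounded_linear[OF assms(3), of UNIV]]) auto

lemma smooth_on_Pair: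
  fixes f :: "'a::real_normed_vector \<Rightarrow> 'b::euclidean_space" and g :: "'a \<Rightarrow> 'c::euclidean_space"
  assumes "open S" "smooth_on S f" "smooth_on S g"
  shows "smooth_on S (\<lambda>x. (f x, g x))"
proof -
  have "bounded_linear (\<lambda>x::'b. (x, 0::'c))" "bounded_linear (\<lambda>x::'c. (0::'b, x))"
    by (auto intro: bounded_linear_Pair bounded_linear_ident bounded_linear_zero)
  from smooth_on_add[OF assms(1) smooth_on_linear[OF assms(1,2) this(1)] smooth_on_linear[OF assms(1,3) this(2)]]
  show ?thesis by simp
qed

lemma linear_in_basis:
  fixes h :: "'a::euclidean_space \<Rightarrow> 'b::real_vector"
  assumes "linear h"
  shows "h v = (\<Sum>b\<in>Basis. (v \<bullet> b) *\<^sub>R h b)"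
  using linear_sum[OF assms, of "\<lambda>b. (v \<bullet> b) *\<^sub>R b" Basis]
  by (simp add: linear_scale[OF assms] euclidean_representation)

text \<open>Linearity of the derivative reduces a moving direction to finitely many fixed ones with
  smooth coefficients.\<close>

lemma smooth_on_fderiv_along:
  fixes f :: "'a::euclidean_space \<Rightarrow> 'b::real_normed_vector"
  assumes "open S" "smooth_on S f" "smooth_on S X"
  shows "smooth_on S (\<lambda>x. fderiv f x (X x))"
proof -
  have "smooth_on S (\<lambda>x. \<Sum>b\<in>Basis. (X x \<bullet> b) *\<^sub>R fderiv f x b)"
    by (intro smooth_on_sum smooth_on_scaleR smooth_on_inner smooth_on_const smooth_on_fderiv assms)
  then show ?thesis
    by (rule smooth_on_cong[OF assms(1), rotated])
      (use linear_in_basis[OF linear_frechet_derivative[OF smooth_on_differentiable[OF assms(2)]]] in auto)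
qed

section \<open>Determinants and inverse matrices\<close>

lemma smooth_on_det:
  fixes f :: "'a::real_normed_vector \<Rightarrow> real^'n^'n"
  assumes "open S" "\<And>i j. smooth_on S (\<lambda>x. f x $ i $ j)"
  shows "smooth_on S (\<lambda>x. det (f x))"
  unfolding det_def by (intro smooth_on_sum smooth_on_mult smooth_on_prod smooth_on_const assms)

lemma cramer_rule:
  fixes A :: "real^'n^'n"
  assumes "det A \<noteq> 0" "A *v x = b"
  shows "x $ k = det (\<chi> i j. if j = k then b $ i else A $ i $ j) / det A"
  using cramer[OF assms(1), of x b] assms(2) by simp

lemma matrix_inv:
  fixes A :: "real^'n^'n"
  assumes "det A \<noteq> 0"
  shows matrix_mul_matrix_inv: "A ** matrix_inv A = mat 1" and matrix_inv_mul_matrix: "matrix_inv A ** A = mat 1"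
proof -
  have "\<exists>B. A ** B = mat 1 \<and> B ** A = mat 1" using assms invertible_det_nz invertible_def by blast
  from someI_ex[OF this] show "A ** matrix_inv A = mat 1" "matrix_inv A ** A = mat 1"
    unfolding matrix_inv_def by blast+
qed

text \<open>Column \<open>j\<close> of the inverse solves a linear system with right-hand side
  \<open>axis j 1\<close>, so by Cramer's rule each entry is a quotient of determinants.\<close>

lemma smooth_on_matrix_inv:
  fixes f :: "'a::real_normed_vector \<Rightarrow> real^'n^'n"
  assumes "open S" "\<And>i j. smooth_on S (\<lambda>x. f x $ i $ j)" "\<And>x. x \<in> S \<Longrightarrow> det (f x) \<noteq> 0"
  shows "smooth_on S (\<lambda>x. matrix_inv (f x) $ i $ j)"
proof -
  let ?h = "\<lambda>x. \<chi> p q. if q = i then axis j (1::real) $ p else f x $ p $ q"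
  have s: "smooth_on S (\<lambda>x. ?h x $ p $ q)" for p q
    by (cases "q = i") (auto intro: smooth_on_const assms)
  have eq: "matrix_inv (f x) $ i $ j = det (?h x) / det (f x)" if "x \<in> S" for x
  proof -
    have "f x ** matrix_inv (f x) = mat 1"
      by (rule matrix_mul_matrix_inv[OF assms(3)[OF that]])
    then have "f x *v (matrix_inv (f x) *v axis j 1) = axis j 1"
      by (simp add: matrix_vector_mul_assoc)
    from cramer_rule[OF assms(3)[OF that] this, of i] show ?thesis
      by (simp add: matrix_vector_mul_component column_def matrix_vector_mult_basis)
  qed
  have "smooth_on S (\<lambda>x. det (?h x) / det (f x))"
    by (intro smooth_on_divide smooth_on_det assms s)
  then show ?thesis by (rule smooth_on_cong[OF assms(1), rotated]) (use eq in auto)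
qed

section \<open>Symmetry of second derivatives\<close>

lemma fderiv_component:
  fixes f :: "'a::real_normed_vector \<Rightarrow> 'b::euclidean_space"
  assumes "f differentiable (at x)"
  shows "fderiv (\<lambda>x. f x \<bullet> b) x v = fderiv f x v \<bullet> b"
  using fderiv_eq[OF has_derivative_inner_left[OF has_fderiv[OF assms]]] by simp

lemma has_real_derivative_along_line:
  fixes g :: "'a::real_normed_vector \<Rightarrow> real"
  assumes "g differentiable (at (x + s *\<^sub>R u))"
  shows "((\<lambda>s. g (x + s *\<^sub>R u)) has_real_derivative fderiv g (x + s *\<^sub>R u) u) (at s)"
proof -
  have "((\<lambda>s. x + s *\<^sub>R u) has_derivative (\<lambda>t. t *\<^sub>R u)) (at s)"
    by (auto intro!: derivative_eq_intros)
  from has_derivative_compose[OF this, of g "fderiv g (x + s *\<^sub>R u)"] has_fderiv[OF assms]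
  have "((\<lambda>s. g (x + s *\<^sub>R u)) has_derivative (\<lambda>t. fderiv g (x + s *\<^sub>R u) (t *\<^sub>R u))) (at s)"
    by blast
  moreover have "(\<lambda>t. fderiv g (x + s *\<^sub>R u) (t *\<^sub>R u)) = (*) (fderiv g (x + s *\<^sub>R u) u)"
    using linear_scale[OF linear_frechet_derivative[OF assms]] by (auto simp: fun_eq_iff)
  ultimately show ?thesis unfolding has_field_derivative_def by simp
qed

text \<open>The second difference is the increment over \<open>[0, h]\<close> of the difference of
  \<open>g\<close> along two parallel segments in direction \<open>u\<close>. The mean value theorem
  in \<open>s\<close>, then in \<open>t\<close>, turns it into a mixed derivative at an intermediate
  point.\<close>

lemma mixed_difference_quotient:
  fixes g :: "'a::real_normed_vector \<Rightarrow> real"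
  assumes "h > 0" and nb: "\<And>s t. 0 \<le> s \<Longrightarrow> s \<le> h \<Longrightarrow> 0 \<le> t \<Longrightarrow> t \<le> h \<Longrightarrow> x + s *\<^sub>R u + t *\<^sub>R v \<in> S"
    and sm: "smooth_on S g"
  obtains s t where "0 \<le> s" "s \<le> h" "0 \<le> t" "t \<le> h"
    "g (x + h *\<^sub>R u + h *\<^sub>R v) - g (x + h *\<^sub>R u) - g (x + h *\<^sub>R v) + g x
      = h * h * fderiv (\<lambda>z. fderiv g z u) (x + s *\<^sub>R u + t *\<^sub>R v) v"
proof -
  let ?p = "\<lambda>s. g (x + h *\<^sub>R v + s *\<^sub>R u) - g (x + s *\<^sub>R u)"
  have d: "(?p has_real_derivative (fderiv g (x + h *\<^sub>R v + s *\<^sub>R u) u - fderiv g (x + s *\<^sub>R u) u)) (at s)"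
    if "0 \<le> s" "s \<le> h" for s
    using nb[OF that, of h] nb[OF that, of 0] \<open>h > 0\<close>
    by (intro derivative_intros has_real_derivative_along_line smooth_on_differentiable[OF sm]) (simp_all add: algebra_simps)
  obtain s where s: "0 < s" "s < h" "?p h - ?p 0 = (h - 0) * (fderiv g (x + h *\<^sub>R v + s *\<^sub>R u) u - fderiv g (x + s *\<^sub>R u) u)"
    using MVT2[OF \<open>h > 0\<close> d] by blast
  let ?q = "\<lambda>t. fderiv g ((x + s *\<^sub>R u) + t *\<^sub>R v) u"
  have d2: "(?q has_real_derivative fderiv (\<lambda>z. fderiv g z u) ((x + s *\<^sub>R u) + t *\<^sub>R v) v) (at t)"
    if "0 \<le> t" "t \<le> h" for t
    using nb[of s t] s that
    by (intro has_real_derivative_along_line smooth_on_differentiable[OF smooth_on_fderiv[OF sm]]) auto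
  obtain t where t: "0 < t" "t < h" "?q h - ?q 0 = (h - 0) * fderiv (\<lambda>z. fderiv g z u) ((x + s *\<^sub>R u) + t *\<^sub>R v) v"
    using MVT2[OF \<open>h > 0\<close> d2] by blast
  show thesis
    by (rule that[of s t]) (use s t in \<open>auto simp: algebra_simps\<close>)
qed

text \<open>The second difference of \<open>g\<close> over a small parallelogram is symmetric in
  \<open>u\<close> and \<open>v\<close>, and it is \<open>h * h\<close> times either mixed
  derivative at some nearby point. Continuity of both mixed derivatives excludes different values at
  \<open>x\<close>.\<close>

lemma fderiv_symmetric_real:
  fixes g :: "'a::real_normed_vector \<Rightarrow> real"
  assumes "open S" "smooth_on S g" "x \<in> S"
  shows "fderiv (\<lambda>z. fderiv g z u) x v = fderiv (\<lambda>z. fderiv g z v) x u"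
proof (rule ccontr)
  let ?P = "\<lambda>z. fderiv (\<lambda>z. fderiv g z u) z v" and ?Q = "\<lambda>z. fderiv (\<lambda>z. fderiv g z v) z u"
  assume ne: "?P x \<noteq> ?Q x"
  \<comment> \<open>Half the gap: two numbers that are closer than \<open>e\<close> to
    \<open>?P x\<close> and to \<open>?Q x\<close> respectively cannot be equal.\<close>
  define e where "e = \<bar>?P x - ?Q x\<bar> / 2"
  have e: "e > 0" using ne by (simp add: e_def)
  have c: "isCont ?P x" "isCont ?Q x"
    using smooth_on_continuous[OF smooth_on_fderiv[OF smooth_on_fderiv[OF assms(2)]]] assms
    by (auto simp: continuous_on_eq_continuous_at)
  obtain d1 where d1: "d1 > 0" "\<And>z. dist z x < d1 \<Longrightarrow> \<bar>?P z - ?P x\<bar> < e"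
    using c(1) e unfolding continuous_at_eps_delta dist_real_def by blast
  obtain d2 where d2: "d2 > 0" "\<And>z. dist z x < d2 \<Longrightarrow> \<bar>?Q z - ?Q x\<bar> < e"
    using c(2) e unfolding continuous_at_eps_delta dist_real_def by blast
  obtain d3 where d3: "d3 > 0" "ball x d3 \<subseteq> S" using assms openE by blast
  define d where "d = min d1 (min d2 d3)"
  have d: "d > 0" using d1 d2 d3 by (simp add: d_def)
  \<comment> \<open>Small enough for the parallelogram with sides \<open>h *\<^sub>R u\<close> and
    \<open>h *\<^sub>R v\<close> to stay within distance \<open>d\<close> of \<open>x\<close>; the
    summand 1 keeps the denominator positive when both vectors vanish.\<close>
  define h where "h = d / (2 * (norm u + norm v + 1))"
  have n: "norm u + norm v + 1 > 0" by (smt (verit) norm_ge_zero)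
  have h: "h > 0" using d n by (simp add: h_def)
  have nb: "dist (x + s *\<^sub>R u + t *\<^sub>R v) x < d" if "0 \<le> s" "s \<le> h" "0 \<le> t" "t \<le> h" for s t
  proof -
    have "dist (x + s *\<^sub>R u + t *\<^sub>R v) x \<le> s * norm u + t * norm v"
      using norm_triangle_ineq[of "s *\<^sub>R u" "t *\<^sub>R v"] that by (simp add: dist_norm)
    also have "\<dots> \<le> h * norm u + h * norm v" using that by (intro add_mono mult_right_mono) auto
    also have "\<dots> < h * (2 * (norm u + norm v + 1))" using h n by (simp add: algebra_simps add_strict_increasing2)
    also have "\<dots> = d" using n by (simp add: h_def)
    finally show ?thesis .
  qed
  have nb': "dist (x + s *\<^sub>R v + t *\<^sub>R u) x < d" if "0 \<le> s" "s \<le> h" "0 \<le> t" "t \<le> h" for s t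
    using nb[of t s] that by (simp add: algebra_simps)
  obtain s t where st: "0 \<le> s" "s \<le> h" "0 \<le> t" "t \<le> h"
    "g (x + h *\<^sub>R u + h *\<^sub>R v) - g (x + h *\<^sub>R u) - g (x + h *\<^sub>R v) + g x = h * h * ?P (x + s *\<^sub>R u + t *\<^sub>R v)"
    by (rule mixed_difference_quotient[OF h _ assms(2), of x u v]) (use nb d3 in \<open>auto simp: d_def dist_commute subset_iff\<close>)
  obtain s' t' where st': "0 \<le> s'" "s' \<le> h" "0 \<le> t'" "t' \<le> h"
    "g (x + h *\<^sub>R v + h *\<^sub>R u) - g (x + h *\<^sub>R v) - g (x + h *\<^sub>R u) + g x = h * h * ?Q (x + s' *\<^sub>R v + t' *\<^sub>R u)"
    by (rule mixed_difference_quotient[OF h _ assms(2), of x v u]) (use nb' d3 in \<open>auto simp: d_def dist_commute subset_iff\<close>)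
  have "x + h *\<^sub>R v + h *\<^sub>R u = x + h *\<^sub>R u + h *\<^sub>R v" by (simp add: algebra_simps)
  with st(5) st'(5) have "h * h * ?P (x + s *\<^sub>R u + t *\<^sub>R v) = h * h * ?Q (x + s' *\<^sub>R v + t' *\<^sub>R u)"
    by (simp add: algebra_simps)
  then have "?P (x + s *\<^sub>R u + t *\<^sub>R v) = ?Q (x + s' *\<^sub>R v + t' *\<^sub>R u)" using h by simp
  moreover have "\<bar>?P (x + s *\<^sub>R u + t *\<^sub>R v) - ?P x\<bar> < e" using d1(2) nb[OF st(1-4)] by (simp add: d_def)
  moreover have "\<bar>?Q (x + s' *\<^sub>R v + t' *\<^sub>R u) - ?Q x\<bar> < e" using d2(2) nb'[OF st'(1-4)] by (simp add: d_def)
  ultimately show False unfolding e_def by argo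
qed

lemma fderiv_symmetric:
  fixes g :: "'a::real_normed_vector \<Rightarrow> 'b::euclidean_space"
  assumes "open S" "smooth_on S g" "x \<in> S"
  shows "fderiv (\<lambda>z. fderiv g z u) x v = fderiv (\<lambda>z. fderiv g z v) x u"
proof (rule euclidean_eqI)
  fix b :: 'b
  have g: "smooth_on S (\<lambda>z. g z \<bullet> b)" by (intro smooth_on_inner smooth_on_const assms)
  have "fderiv (\<lambda>z. fderiv g z w) x v \<bullet> b = fderiv (\<lambda>z. fderiv (\<lambda>z. g z \<bullet> b) z w) x v" for w v
  proof -
    have e: "fderiv (\<lambda>z. g z \<bullet> b) z w = fderiv g z w \<bullet> b" if "z \<in> S" for z
      by (rule fderiv_component[OF smooth_on_differentiable[OF assms(2) that]])
    have "fderiv (\<lambda>z. fderiv g z w) x v \<bullet> b = fderiv (\<lambda>z. fderiv g z w \<bullet> b) x v"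
      by (rule fderiv_component[symmetric, OF smooth_on_differentiable[OF smooth_on_fderiv[OF assms(2)] assms(3)]])
    also have "\<dots> = fderiv (\<lambda>z. fderiv (\<lambda>z. g z \<bullet> b) z w) x v"
      by (rule fun_cong[OF frechet_derivative_transform_within_open[OF _ assms(1,3)]])
        (use e smooth_on_differentiable[OF smooth_on_inner[OF assms(1) smooth_on_fderiv[OF assms(2)] smooth_on_const] assms(3)] in auto)
    finally show ?thesis .
  qed
  then show "fderiv (\<lambda>z. fderiv g z u) x v \<bullet> b = fderiv (\<lambda>z. fderiv g z v) x u \<bullet> b"
    using fderiv_symmetric_real[OF assms(1) g assms(3)] by simp
qed

text \<open>The function \<open>t \<mapsto> t\<^sup>-\<^sup>n exp (-1/t)\<close>, extended by 0; this family is closed under differentiation up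
  to linear combinations.\<close>

definition flat :: "nat \<Rightarrow> real \<Rightarrow> real" where
  "flat n t = (if t > 0 then exp (- inverse t) * inverse t ^ n else 0)"

text \<open>With \<open>s = 1/t\<close> the limit from the right becomes that of
  \<open>s\<^sup>n / exp s\<close> at infinity.\<close>

lemma flat_tendsto_0: "(flat n \<longlongrightarrow> 0) (at 0)"
proof -
  have "((\<lambda>t. inverse t ^ n / exp (inverse t)) \<longlongrightarrow> 0) (at_right (0::real))"
    by (rule filterlim_compose[OF tendsto_power_div_exp_0 filterlim_inverse_at_top_right])
  then have "(flat n \<longlongrightarrow> 0) (at_right 0)"
    by (rule Lim_transform_eventually)
      (auto simp: eventually_at_right_field flat_def exp_minus field_simps intro: exI[of _ 1])
  moreover have "(flat n \<longlongrightarrow> 0) (at_left 0)"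
    by (rule tendsto_eventually) (auto simp: eventually_at_left_field flat_def intro: exI[of _ "-1"])
  ultimately show ?thesis by (simp add: filterlim_split_at)
qed

lemma flat_has_derivative:
  "(flat n has_real_derivative (flat (n + 2) t - real n * flat (n + 1) t)) (at t)"
proof (cases t "0::real" rule: linorder_cases)
  case less
  have "((\<lambda>t. 0::real) has_real_derivative 0) (at t)" by simp
  then have "(flat n has_real_derivative 0) (at t)"
    by (rule DERIV_cong_ev[THEN iffD1, rotated 3])
      (use less in \<open>auto simp: flat_def eventually_nhds intro!: exI[of _ "{..<0}"]\<close>)
  then show ?thesis using less by (simp add: flat_def)
next
  case greater
  have "((\<lambda>t. exp (- inverse t) * inverse t ^ n) has_real_derivative
      (flat (n + 2) t - real n * flat (n + 1) t)) (at t)"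
    using greater
    apply (auto intro!: derivative_eq_intros simp: flat_def power2_eq_square)
    apply (cases n) apply (auto simp: field_simps)
    done
  then show ?thesis
    by (rule DERIV_cong_ev[THEN iffD1, rotated 3])
      (use greater in \<open>auto simp: flat_def eventually_nhds intro!: exI[of _ "{0<..}"]\<close>)
next
  case equal
  \<comment> \<open>The difference quotient of \<open>flat n\<close> at 0 is
    \<open>flat (Suc n)\<close>.\<close>
  have "((\<lambda>h. (flat n (0 + h) - flat n 0) / h) \<longlongrightarrow> 0) (at 0)"
    by (rule Lim_transform_eventually[OF flat_tendsto_0[of "Suc n"]])
      (auto simp: eventually_at_filter flat_def field_simps)
  then show ?thesis using equal by (simp add: DERIV_def flat_def)
qed

lemma Ck_on_flat: "Ck_on k UNIV (flat n)"
proof (induction k arbitrary: n)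
  case 0
  then show ?case by (auto intro!: continuous_at_imp_continuous_on DERIV_isCont[OF flat_has_derivative])
next
  case (Suc k)
  have d: "(flat n has_derivative (*) (flat (n + 2) t - real n * flat (n + 1) t)) (at t)" for t
    using flat_has_derivative has_field_derivative_def by blast
  have "Ck_on k UNIV (\<lambda>t. (flat (n + 2) t + (- real n) * flat (n + 1) t) * v)" for v
    by (intro Ck_on_bilinear[OF bounded_bilinear_mult] Ck_on_add Ck_on_const Suc) auto
  moreover have "flat n differentiable (at t)" for t using d differentiable_def by blast
  ultimately show ?case by (simp add: fderiv_eq[OF d])
qed

lemma smooth_step:
  obtains \<phi> :: "real \<Rightarrow> real" where "smooth_on UNIV \<phi>" "\<And>t. t > 0 \<Longrightarrow> \<phi> t > 0" "\<And>t. t \<le> 0 \<Longrightarrow> \<phi> t = 0"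
  by (rule that[of "flat 0"]) (auto simp: smooth_on_def Ck_on_flat, auto simp: flat_def)

text \<open>Product rule for a derivative applied to a moving vector: one term from the second
  derivative of \<open>f\<close>, one from the derivative of \<open>X\<close>. The basis expansion
  turns the application into a finite sum of products.\<close>

lemma has_derivative_fderiv_apply:
  fixes f :: "'a::euclidean_space \<Rightarrow> 'b::real_normed_vector"
  assumes "open S" "smooth_on S f" "x \<in> S" "X differentiable (at x)"
  shows "((\<lambda>z. fderiv f z (X z)) has_derivative
    (\<lambda>w. fderiv (\<lambda>z. fderiv f z (X x)) x w + fderiv f x (fderiv X x w))) (at x)"
proof -
  have lin: "fderiv f z v = (\<Sum>b\<in>Basis. (v \<bullet> b) *\<^sub>R fderiv f z b)" if "z \<in> S" for z v
    by (rule linear_in_basis[OF linear_frechet_derivative[OF smooth_on_differentiable[OF assms(2) that]]])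
  have df: "((\<lambda>z. fderiv f z b) has_derivative fderiv (\<lambda>z. fderiv f z b) x) (at x)" for b
    by (rule has_fderiv[OF smooth_on_differentiable[OF smooth_on_fderiv[OF assms(2)] assms(3)]])
  have d: "((\<lambda>z. fderiv f z (Y z)) has_derivative
      (\<lambda>w. \<Sum>b\<in>Basis. (Y x \<bullet> b) *\<^sub>R fderiv (\<lambda>z. fderiv f z b) x w + (Y' w \<bullet> b) *\<^sub>R fderiv f x b)) (at x)"
    if "(Y has_derivative Y') (at x)" for Y Y'
  proof -
    have "((\<lambda>z. \<Sum>b\<in>Basis. (Y z \<bullet> b) *\<^sub>R fderiv f z b) has_derivative
      (\<lambda>w. \<Sum>b\<in>Basis. (Y x \<bullet> b) *\<^sub>R fderiv (\<lambda>z. fderiv f z b) x w + (Y' w \<bullet> b) *\<^sub>R fderiv f x b)) (at x)"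
      by (intro has_derivative_sum has_derivative_scaleR has_derivative_inner_left that df)
    then show ?thesis
      by (rule has_derivative_transform_within_open[OF _ assms(1,3)]) (use lin in auto)
  qed
  \<comment> \<open>The formula \<open>d\<close> again, for the constant field with value
    \<open>X x\<close>.\<close>
  have e: "fderiv (\<lambda>z. fderiv f z (X x)) x w = (\<Sum>b\<in>Basis. (X x \<bullet> b) *\<^sub>R fderiv (\<lambda>z. fderiv f z b) x w)" for w
    using fun_cong[OF fderiv_eq[OF d[OF has_derivative_const]], of "X x" w] by simp
  have "(\<lambda>w. fderiv (\<lambda>z. fderiv f z (X x)) x w + fderiv f x (fderiv X x w)) =
      (\<lambda>w. \<Sum>b\<in>Basis. (X x \<bullet> b) *\<^sub>R fderiv (\<lambda>z. fderiv f z b) x w + (fderiv X x w \<bullet> b) *\<^sub>R fderiv f x b)"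
    by (rule ext, subst lin[OF assms(3), of "fderiv X x _"], subst e, rule sum.distrib[symmetric])
  with d[OF has_fderiv[OF assms(4)]] show ?thesis by (simp only:)
qed

lemma fderiv_fderiv_apply:
  fixes f :: "'a::euclidean_space \<Rightarrow> 'b::real_normed_vector"
  assumes "open S" "smooth_on S f" "x \<in> S" "X differentiable (at x)"
  shows "fderiv (\<lambda>z. fderiv f z (X z)) x w = fderiv (\<lambda>z. fderiv f z (X x)) x w + fderiv f x (fderiv X x w)"
  using fderiv_eq[OF has_derivative_fderiv_apply[OF assms]] by simp

lemma fderiv_add:
  assumes "f differentiable (at x)" "g differentiable (at x)"
  shows "fderiv (\<lambda>x. f x + g x) x v = fderiv f x v + fderiv g x v"
  using fderiv_eq[OF has_derivative_add[OF assms[THEN has_fderiv]]] by simp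

lemma fderiv_scaleR:
  assumes "f differentiable (at x)" "g differentiable (at x)"
  shows "fderiv (\<lambda>x. f x *\<^sub>R g x) x v = f x *\<^sub>R fderiv g x v + fderiv f x v *\<^sub>R g x"
  using fderiv_eq[OF has_derivative_scaleR[OF assms[THEN has_fderiv]]] by simp

lemma fderiv_cong_open:
  assumes "f differentiable (at x)" "open S" "x \<in> S" "\<And>z. z \<in> S \<Longrightarrow> f z = g z"
  shows "fderiv f x = fderiv g x"
  by (rule frechet_derivative_transform_within_open[OF assms])

section \<open>Smooth atlases\<close>

lemma tscale_apply [simp]: "(s \<odot> v) c = s *\<^sub>R v c"
  by (simp add: tscale_def)

lemma fscale_apply [simp]: "fscale f X p = f p \<odot> X p"
  by (simp add: fscale_def)

lemma tscale_simps [simp]: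
  "0 \<odot> v = 0" "s \<odot> 0 = 0" "1 \<odot> v = v" "a \<odot> b \<odot> v = (a * b) \<odot> v"
  by (auto simp: fun_eq_iff)

lemma tscale_distribs:
  "s \<odot> (v + w) = s \<odot> v + s \<odot> w" "(s + t) \<odot> v = s \<odot> v + t \<odot> v"
  "s \<odot> (v - w) = s \<odot> v - s \<odot> w" "(s - t) \<odot> v = s \<odot> v - t \<odot> v"
  by (auto simp: fun_eq_iff algebra_simps)

lemma sum_fun_apply: "(\<Sum>i\<in>I. f i) x = (\<Sum>i\<in>I. f i x)"
  by (induction I rule: infinite_finite_induct) auto

lemma tscale_sum: "s \<odot> (\<Sum>i\<in>I. f i) = (\<Sum>i\<in>I. s \<odot> f i)"
  by (auto simp: fun_eq_iff sum_fun_apply scaleR_sum_right)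

lemma chart_inv_image:
  assumes "x \<in> chart_image c"
  shows "chart_inv c x \<in> fst c" "snd c (chart_inv c x) = x"
  using assms unfolding chart_image_def chart_inv_def by (auto intro: inv_into_into f_inv_into_f)

text \<open>Atlases without reference to a topology on the points, so that the slit bundle, for
  which none is given, becomes an instance just as the base does.\<close>

locale smooth_atlas =
  fixes A :: "('p, 'e::euclidean_space) chart set"
  assumes inj_chart: "c \<in> A \<Longrightarrow> inj_on (snd c) (fst c)"
    and open_overlap: "c \<in> A \<Longrightarrow> d \<in> A \<Longrightarrow> open (snd c ` (fst c \<inter> fst d))"
    and smooth_transition: "c \<in> A \<Longrightarrow> d \<in> A \<Longrightarrow> smooth_on (snd c ` (fst c \<inter> fst d)) (snd d \<circ> chart_inv c)"
begin

lemma open_chart_image: "c \<in> A \<Longrightarrow> open (chart_image c)"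
  using open_overlap[of c c] by (simp add: chart_image_def)

lemma chart_inv_chart [simp]: "c \<in> A \<Longrightarrow> p \<in> fst c \<Longrightarrow> chart_inv c (snd c p) = p"
  unfolding chart_inv_def using inj_chart by simp

lemma overlap_subset: "snd c ` (fst c \<inter> fst d) \<subseteq> chart_image c"
  by (auto simp: chart_image_def)

lemma overlap_iff:
  "c \<in> A \<Longrightarrow> x \<in> snd c ` (fst c \<inter> fst d) \<longleftrightarrow> x \<in> chart_image c \<and> chart_inv c x \<in> fst d"
  by (auto simp: chart_image_def image_iff)

lemma charts_atD: "c \<in> charts_at A p \<Longrightarrow> c \<in> A" "c \<in> charts_at A p \<Longrightarrow> p \<in> fst c"
  by (auto simp: charts_at_def)

lemma charts_at_overlap:
  "c \<in> charts_at A p \<Longrightarrow> d \<in> charts_at A p \<Longrightarrow> snd c p \<in> snd c ` (fst c \<inter> fst d)"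
  by (auto simp: charts_at_def)

lemma charts_at_image: "c \<in> charts_at A p \<Longrightarrow> snd c p \<in> chart_image c"
  by (auto simp: charts_at_def chart_image_def)

lemma chart_inv_charts_at: "c \<in> A \<Longrightarrow> x \<in> chart_image c \<Longrightarrow> c \<in> charts_at A (chart_inv c x)"
  using chart_inv_image[of x c] by (simp add: charts_at_def)

lemma carrier_charts_at: "p \<in> carrier A \<longleftrightarrow> (\<exists>c. c \<in> charts_at A p)"
  unfolding carrier_def charts_at_def by blast

lemma some_chart_in: "p \<in> carrier A \<Longrightarrow> some_chart A p \<in> charts_at A p"
  unfolding some_chart_def carrier_charts_at by (rule someI_ex)

section \<open>Transition Jacobians and tangent vectors\<close>

abbreviation jac :: "'p \<Rightarrow> ('p, 'e) chart \<Rightarrow> ('p, 'e) chart \<Rightarrow> 'e \<Rightarrow> 'e" where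
  "jac p c d \<equiv> fderiv (snd d \<circ> chart_inv c) (snd c p)"

lemma transition_differentiable:
  "c \<in> charts_at A p \<Longrightarrow> d \<in> charts_at A p \<Longrightarrow> (snd d \<circ> chart_inv c) differentiable (at (snd c p))"
  using smooth_on_differentiable[OF smooth_transition] charts_at_overlap charts_atD by metis

lemma linear_jac: "c \<in> charts_at A p \<Longrightarrow> d \<in> charts_at A p \<Longrightarrow> linear (jac p c d)"
  by (intro linear_frechet_derivative transition_differentiable)

text \<open>On the overlap, \<open>f\<close> in the chart \<open>c\<close> is \<open>f\<close> in
  the chart \<open>d\<close> after the transition map. The overlap is open, so this local identity
  determines the derivative.\<close>

lemma fderiv_change_chart:
  assumes "c \<in> charts_at A p" "d \<in> charts_at A p" "(f \<circ> chart_inv d) differentiable (at (snd d p))"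
  shows "((f \<circ> chart_inv c) has_derivative (\<lambda>v. fderiv (f \<circ> chart_inv d) (snd d p) (jac p c d v))) (at (snd c p))"
proof -
  have [simp]: "c \<in> A" "d \<in> A" "p \<in> fst c" "p \<in> fst d" using assms charts_atD by auto
  have "((\<lambda>x. (f \<circ> chart_inv d) ((snd d \<circ> chart_inv c) x)) has_derivative
      (\<lambda>v. fderiv (f \<circ> chart_inv d) (snd d p) (jac p c d v))) (at (snd c p))"
    by (rule has_derivative_compose[OF has_fderiv[OF transition_differentiable]])
      (use assms(1,2) has_fderiv[OF assms(3)] in \<open>simp_all add: o_def\<close>)
  then show ?thesis
    by (rule has_derivative_transform_within_open[OF _ open_overlap[of c d] charts_at_overlap])
      (use assms in \<open>auto simp: overlap_iff\<close>)
qed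

lemma jac_refl: assumes "c \<in> charts_at A p" shows "jac p c c v = v"
proof -
  have c: "c \<in> A" using assms charts_atD by blast
  have "((\<lambda>x. x) has_derivative (\<lambda>v. v)) (at (snd c p))" by simp
  then have "((snd c \<circ> chart_inv c) has_derivative (\<lambda>v. v)) (at (snd c p))"
    by (rule has_derivative_transform_within_open[OF _ open_chart_image[OF c] charts_at_image[OF assms]])
      (simp add: chart_inv_image)
  then show ?thesis by (simp add: fderiv_eq)
qed

text \<open>The cocycle rule is the change of charts for the function \<open>snd e\<close>.\<close>

lemma jac_trans:
  assumes "c \<in> charts_at A p" "d \<in> charts_at A p" "e \<in> charts_at A p"
  shows "jac p d e (jac p c d v) = jac p c e v"
  using fderiv_eq[OF fderiv_change_chart[OF assms(1,2) transition_differentiable[OF assms(2,3)]]] by simp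

lemma tangent_jac:
  "X \<in> tangent_space A p \<Longrightarrow> c \<in> charts_at A p \<Longrightarrow> d \<in> charts_at A p \<Longrightarrow> X d = jac p c d (X c)"
  unfolding tangent_space_def by blast

lemma tangent_outside: "X \<in> tangent_space A p \<Longrightarrow> c \<notin> charts_at A p \<Longrightarrow> X c = 0"
  unfolding tangent_space_def by blast

lemma tangent_eqI:
  assumes "X \<in> tangent_space A p" "Y \<in> tangent_space A p" "c \<in> charts_at A p" "X c = Y c"
  shows "X = Y"
proof
  fix d show "X d = Y d"
    using assms tangent_jac[OF assms(1,3), of d] tangent_jac[OF assms(2,3), of d] tangent_outside[OF assms(1), of d] tangent_outside[OF assms(2), of d]
    by (cases "d \<in> charts_at A p") simp_all
qed

lemma tangent_spaceI:
  assumes "\<And>c. c \<notin> charts_at A p \<Longrightarrow> X c = 0"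
    "\<And>c d. c \<in> charts_at A p \<Longrightarrow> d \<in> charts_at A p \<Longrightarrow> X d = jac p c d (X c)"
  shows "X \<in> tangent_space A p"
  using assms unfolding tangent_space_def by blast

lemma tangent_zero: "0 \<in> tangent_space A p"
  by (rule tangent_spaceI) (simp_all add: linear_0[OF linear_jac])

lemma tangent_add:
  assumes "X \<in> tangent_space A p" "Y \<in> tangent_space A p"
  shows "X + Y \<in> tangent_space A p"
proof (rule tangent_spaceI)
  fix c d assume c: "c \<in> charts_at A p" and d: "d \<in> charts_at A p"
  show "(X + Y) d = jac p c d ((X + Y) c)"
    using tangent_jac[OF assms(1) c d] tangent_jac[OF assms(2) c d] by (simp add: linear_add[OF linear_jac[OF c d]])
qed (simp add: tangent_outside[OF assms(1)] tangent_outside[OF assms(2)])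

lemma tangent_scale:
  assumes "X \<in> tangent_space A p"
  shows "s \<odot> X \<in> tangent_space A p"
proof (rule tangent_spaceI)
  fix c d assume c: "c \<in> charts_at A p" and d: "d \<in> charts_at A p"
  show "(s \<odot> X) d = jac p c d ((s \<odot> X) c)"
    using tangent_jac[OF assms c d] by (simp add: linear_scale[OF linear_jac[OF c d]])
qed (simp add: tangent_outside[OF assms])

lemma tangent_sum: "(\<And>i. i \<in> I \<Longrightarrow> X i \<in> tangent_space A p) \<Longrightarrow> (\<Sum>i\<in>I. X i) \<in> tangent_space A p"
  by (induction I rule: infinite_finite_induct) (auto intro: tangent_zero tangent_add)

lemma coord_vec_tangent: "c \<in> charts_at A p \<Longrightarrow> coord_vec A c p e \<in> tangent_space A p"
  unfolding tangent_space_def coord_vec_def by (auto simp: jac_trans)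

lemma coord_vec_chart: "c \<in> charts_at A p \<Longrightarrow> coord_vec A c p e c = e"
  unfolding coord_vec_def by (simp add: jac_refl)

lemma coord_vec_component:
  "X \<in> tangent_space A p \<Longrightarrow> c \<in> charts_at A p \<Longrightarrow> coord_vec A c p (X c) = X"
  by (rule tangent_eqI[OF coord_vec_tangent]) (auto simp: coord_vec_chart)

section \<open>Smooth functions, directional derivatives and vector fields\<close>

lemma smooth_funI:
  "(\<And>c. c \<in> A \<Longrightarrow> smooth_on (chart_image c) (f \<circ> chart_inv c)) \<Longrightarrow> smooth_fun A f"
  unfolding smooth_fun_def by blast

lemma smooth_funD: "smooth_fun A f \<Longrightarrow> c \<in> A \<Longrightarrow> smooth_on (chart_image c) (f \<circ> chart_inv c)"
  unfolding smooth_fun_def by blast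

lemma smooth_fun_differentiable:
  "smooth_fun A f \<Longrightarrow> c \<in> charts_at A p \<Longrightarrow> (f \<circ> chart_inv c) differentiable (at (snd c p))"
  using smooth_on_differentiable smooth_funD charts_atD charts_at_image by metis

lemma smooth_fun_const: "smooth_fun A (\<lambda>p. s)"
  unfolding smooth_fun_def o_def by (simp add: smooth_on_const)

lemma smooth_fun_mult: "smooth_fun A f \<Longrightarrow> smooth_fun A g \<Longrightarrow> smooth_fun A (\<lambda>p. f p * g p)"
  unfolding smooth_fun_def o_def by (auto intro: smooth_on_mult open_chart_image)

text \<open>Frees \<open>dir_deriv\<close> from the arbitrary chart in its definition: the Jacobian
  arising from the derivative of \<open>f\<close> is the one that transforms the components of
  \<open>X\<close>.\<close>

lemma dir_deriv_chart:
  assumes "smooth_fun A f" "X \<in> tangent_space A p" "c \<in> charts_at A p"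
  shows "dir_deriv A p X f = fderiv (f \<circ> chart_inv c) (snd c p) (X c)"
proof -
  let ?d = "some_chart A p"
  have d: "?d \<in> charts_at A p" using some_chart_in assms(3) carrier_charts_at by blast
  have "fderiv (f \<circ> chart_inv ?d) (snd ?d p) (X ?d) = fderiv (f \<circ> chart_inv c) (snd c p) (jac p ?d c (X ?d))"
    using fderiv_eq[OF fderiv_change_chart[OF d assms(3) smooth_fun_differentiable[OF assms(1,3)]]] by simp
  also have "jac p ?d c (X ?d) = X c" using tangent_jac[OF assms(2) d assms(3)] by simp
  finally show ?thesis unfolding dir_deriv_def Let_def .
qed

lemma vector_fieldD:
  assumes "vector_field A X"
  shows "p \<in> carrier A \<Longrightarrow> X p \<in> tangent_space A p" "p \<notin> carrier A \<Longrightarrow> X p = 0"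
    "c \<in> A \<Longrightarrow> smooth_on (chart_image c) ((\<lambda>p. X p c) \<circ> chart_inv c)"
  using assms unfolding vector_field_def by blast+

lemma vector_field_tangent: "vector_field A X \<Longrightarrow> c \<in> charts_at A p \<Longrightarrow> X p \<in> tangent_space A p"
  using vector_fieldD carrier_charts_at by blast

lemma vector_field_differentiable:
  "vector_field A X \<Longrightarrow> c \<in> charts_at A p \<Longrightarrow> ((\<lambda>p. X p c) \<circ> chart_inv c) differentiable (at (snd c p))"
  using smooth_on_differentiable vector_fieldD(3) charts_atD charts_at_image by metis

lemma vector_fieldI:
  assumes "\<And>p. p \<in> carrier A \<Longrightarrow> X p \<in> tangent_space A p" "\<And>p. p \<notin> carrier A \<Longrightarrow> X p = 0"
    "\<And>c. c \<in> A \<Longrightarrow> smooth_on (chart_image c) (\<lambda>z. X (chart_inv c z) c)"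
  shows "vector_field A X"
  using assms unfolding vector_field_def o_def by blast

lemma vector_field_fscale:
  assumes "smooth_fun A f" "vector_field A X" shows "vector_field A (fscale f X)"
proof (rule vector_fieldI)
  fix c assume c: "c \<in> A"
  show "smooth_on (chart_image c) (\<lambda>z. fscale f X (chart_inv c z) c)"
    using smooth_on_scaleR[OF open_chart_image smooth_funD vector_fieldD(3), OF c assms(1) c assms(2) c] by simp
qed (simp_all add: vector_fieldD[OF assms(2)] tangent_scale)

lemma vector_field_minus: "vector_field A X \<Longrightarrow> vector_field A (- X)"
proof -
  assume "vector_field A X"
  then have "vector_field A (fscale (\<lambda>p. -1) X)" by (intro vector_field_fscale smooth_fun_const)
  moreover have "fscale (\<lambda>p. -1) X = - X" by (auto simp: fun_eq_iff)
  ultimately show ?thesis by simp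
qed

lemma dir_deriv_field_chart:
  assumes "smooth_fun A f" "vector_field A X" "c \<in> A" "z \<in> chart_image c"
  shows "((\<lambda>p. dir_deriv A p (X p) f) \<circ> chart_inv c) z = fderiv (f \<circ> chart_inv c) z (((\<lambda>p. X p c) \<circ> chart_inv c) z)"
proof -
  have c: "c \<in> charts_at A (chart_inv c z)" by (rule chart_inv_charts_at[OF assms(3,4)])
  show ?thesis
    using dir_deriv_chart[OF assms(1) vector_field_tangent[OF assms(2) c] c] assms(4) by (simp add: chart_inv_image)
qed

lemma smooth_dir_deriv:
  assumes "smooth_fun A f" "vector_field A X"
  shows "smooth_fun A (\<lambda>p. dir_deriv A p (X p) f)"
proof (rule smooth_funI)
  fix c assume c: "c \<in> A"
  have "smooth_on (chart_image c) (\<lambda>z. fderiv (f \<circ> chart_inv c) z (((\<lambda>p. X p c) \<circ> chart_inv c) z))"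
    by (rule smooth_on_fderiv_along[OF open_chart_image[OF c] smooth_funD[OF assms(1) c] vector_fieldD(3)[OF assms(2) c]])
  then show "smooth_on (chart_image c) ((\<lambda>p. dir_deriv A p (X p) f) \<circ> chart_inv c)"
    by (rule smooth_on_cong[OF open_chart_image[OF c], rotated]) (use dir_deriv_field_chart[OF assms c] in simp)
qed

section \<open>The Lie bracket\<close>

lemma lie_bracket_antisym: "lie_bracket A X Y = - lie_bracket A Y X"
  by (auto simp: lie_bracket_def fun_eq_iff)

lemma lie_bracket_chart:
  "c \<in> charts_at A p \<Longrightarrow> lie_bracket A X Y p c = fderiv ((\<lambda>q. Y q c) \<circ> chart_inv c) (snd c p) (X p c)
        - fderiv ((\<lambda>q. X q c) \<circ> chart_inv c) (snd c p) (Y p c)"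
  by (simp add: lie_bracket_def)

text \<open>The components of a field transform by a Jacobian that depends on the point, so
  differentiating them brings in a second derivative of the transition map. It is symmetric in the
  two vectors and will cancel in the Lie bracket.\<close>

lemma field_derivative_change_chart:
  assumes X: "vector_field A X" and c: "c \<in> charts_at A p" and d: "d \<in> charts_at A p"
  shows "fderiv ((\<lambda>q. X q d) \<circ> chart_inv d) (snd d p) (jac p c d v) =
    fderiv (\<lambda>z. fderiv (snd d \<circ> chart_inv c) z (X p c)) (snd c p) v
      + jac p c d (fderiv ((\<lambda>q. X q c) \<circ> chart_inv c) (snd c p) v)"
proof -
  have cd: "c \<in> A" "d \<in> A" "p \<in> fst c" using c d charts_atD by auto
  note o = open_overlap[OF cd(1,2)] and s = smooth_transition[OF cd(1,2)]
  note m = charts_at_overlap[OF c d]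
  let ?t = "snd d \<circ> chart_inv c" and ?X = "(\<lambda>q. X q c) \<circ> chart_inv c"
  have "fderiv ((\<lambda>q. X q d) \<circ> chart_inv d) (snd d p) (jac p c d v) = fderiv ((\<lambda>q. X q d) \<circ> chart_inv c) (snd c p) v"
    using fderiv_eq[OF fderiv_change_chart[OF c d vector_field_differentiable[OF X d]]] by simp
  also have "fderiv ((\<lambda>q. X q d) \<circ> chart_inv c) (snd c p) = fderiv (\<lambda>z. fderiv ?t z (?X z)) (snd c p)"
  proof (rule fderiv_cong_open[OF _ o m])
    show "((\<lambda>q. X q d) \<circ> chart_inv c) differentiable at (snd c p)"
      using fderiv_change_chart[OF c d vector_field_differentiable[OF X d]] differentiable_def by blast
    fix z assume z: "z \<in> snd c ` (fst c \<inter> fst d)"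
    then have zz: "z \<in> chart_image c" "chart_inv c z \<in> fst d" using cd by (auto simp: chart_image_def)
    then have cc: "c \<in> charts_at A (chart_inv c z)" "d \<in> charts_at A (chart_inv c z)"
      using chart_inv_charts_at[OF cd(1)] cd by (auto simp: charts_at_def)
    show "((\<lambda>q. X q d) \<circ> chart_inv c) z = fderiv ?t z (?X z)"
      using tangent_jac[OF vector_field_tangent[OF X cc(1)] cc] zz by (simp add: chart_inv_image)
  qed
  also have "fderiv (\<lambda>z. fderiv ?t z (?X z)) (snd c p) v =
      fderiv (\<lambda>z. fderiv ?t z (?X (snd c p))) (snd c p) v + fderiv ?t (snd c p) (fderiv ?X (snd c p) v)"
    by (rule fderiv_fderiv_apply[OF o s m vector_field_differentiable[OF X c]])
  finally show ?thesis using cd by (simp add: o_def)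
qed

lemma vector_field_lie_bracket:
  assumes X: "vector_field A X" and Y: "vector_field A Y"
  shows "vector_field A (lie_bracket A X Y)"
proof (rule vector_fieldI)
  fix p assume "p \<in> carrier A"
  have "lie_bracket A X Y p d = jac p c d (lie_bracket A X Y p c)"
    if c: "c \<in> charts_at A p" and d: "d \<in> charts_at A p" for c d
  proof -
    have cd: "c \<in> A" "d \<in> A" using c d charts_atD by auto
    have "fderiv (\<lambda>z. fderiv (snd d \<circ> chart_inv c) z (Y p c)) (snd c p) (X p c)
        = fderiv (\<lambda>z. fderiv (snd d \<circ> chart_inv c) z (X p c)) (snd c p) (Y p c)"
      by (rule fderiv_symmetric[OF open_overlap[OF cd] smooth_transition[OF cd] charts_at_overlap[OF c d]])
    then show ?thesis
      using field_derivative_change_chart[OF Y c d, of "X p c"] field_derivative_change_chart[OF X c d, of "Y p c"]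
        tangent_jac[OF vector_field_tangent[OF X c] c d] tangent_jac[OF vector_field_tangent[OF Y c] c d]
      by (simp add: lie_bracket_chart c d linear_diff[OF linear_jac[OF c d]])
  qed
  then show "lie_bracket A X Y p \<in> tangent_space A p"
    by (intro tangent_spaceI) (simp add: lie_bracket_def)
next
  fix p assume "p \<notin> carrier A"
  then show "lie_bracket A X Y p = 0" by (auto simp: lie_bracket_def carrier_charts_at fun_eq_iff)
next
  fix c assume c: "c \<in> A"
  let ?X = "(\<lambda>q. X q c) \<circ> chart_inv c" and ?Y = "(\<lambda>q. Y q c) \<circ> chart_inv c"
  have "smooth_on (chart_image c) (\<lambda>z. fderiv ?Y z (?X z) - fderiv ?X z (?Y z))"
    by (intro smooth_on_diff smooth_on_fderiv_along open_chart_image vector_fieldD(3) assms c)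
  then show "smooth_on (chart_image c) (\<lambda>z. lie_bracket A X Y (chart_inv c z) c)"
    by (rule smooth_on_cong[OF open_chart_image[OF c], rotated])
      (simp add: lie_bracket_chart[OF chart_inv_charts_at[OF c]] chart_inv_image)
qed

lemma lie_bracket_add_left:
  assumes X: "vector_field A X" "vector_field A X'" and Y: "vector_field A Y"
  shows "lie_bracket A (X + X') Y = lie_bracket A X Y + lie_bracket A X' Y"
proof (intro ext)
  fix p c
  show "lie_bracket A (X + X') Y p c = (lie_bracket A X Y + lie_bracket A X' Y) p c"
  proof (cases "c \<in> charts_at A p")
    case True
    show ?thesis
      using linear_add[OF linear_frechet_derivative[OF vector_field_differentiable[OF Y True]], of "X p c" "X' p c"]
        fderiv_add[OF vector_field_differentiable[OF X(1) True] vector_field_differentiable[OF X(2) True], of "Y p c"]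
      by (simp add: lie_bracket_chart[OF True] o_def)
  qed (simp add: lie_bracket_def)
qed

lemma lie_bracket_fscale_left:
  assumes f: "smooth_fun A f" and X: "vector_field A X" and Y: "vector_field A Y"
  shows "lie_bracket A (fscale f X) Y = fscale f (lie_bracket A X Y) - fscale (\<lambda>p. dir_deriv A p (Y p) f) X"
proof (intro ext)
  fix p c
  show "lie_bracket A (fscale f X) Y p c =
      (fscale f (lie_bracket A X Y) - fscale (\<lambda>p. dir_deriv A p (Y p) f) X) p c"
  proof (cases "c \<in> charts_at A p")
    case True
    show ?thesis
      using linear_scale[OF linear_frechet_derivative[OF vector_field_differentiable[OF Y True]], of "f p" "X p c"]
        fderiv_scaleR[OF smooth_fun_differentiable[OF f True] vector_field_differentiable[OF X True], of "Y p c"]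
        charts_atD[OF True]
      by (simp add: lie_bracket_chart[OF True] dir_deriv_chart[OF f vector_field_tangent[OF Y True] True]
          o_def scaleR_diff_right)
  next
    case False
    \<comment> \<open>For a chart not around \<open>p\<close> the brackets are 0 by definition, and
      the correction term is 0 because \<open>X\<close> is.\<close>
    have "X p c = 0"
      using False vector_fieldD[OF X] tangent_outside[of "X p" p c] by (cases "p \<in> carrier A") auto
    with False show ?thesis by (simp add: lie_bracket_def)
  qed
qed

text \<open>In a chart the second derivatives of \<open>f\<close> cancel by symmetry and the
  first-order terms form the bracket. This identity later makes the curvature linear over functions
  in its last argument.\<close>

lemma dir_deriv_lie_bracket:
  assumes f: "smooth_fun A f" and X: "vector_field A X" and Y: "vector_field A Y" and p: "p \<in> carrier A"
  shows "dir_deriv A p (lie_bracket A X Y p) f =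
    dir_deriv A p (X p) (\<lambda>q. dir_deriv A q (Y q) f) - dir_deriv A p (Y p) (\<lambda>q. dir_deriv A q (X q) f)"
proof -
  obtain c where c: "c \<in> charts_at A p" using p carrier_charts_at by blast
  have cA: "c \<in> A" and pc: "p \<in> fst c" using c charts_atD by auto
  note o = open_chart_image[OF cA] and s = smooth_funD[OF f cA] and m = charts_at_image[OF c]
  let ?f = "f \<circ> chart_inv c"
  have *: "dir_deriv A p V (\<lambda>q. dir_deriv A q (Z q) f) =
      fderiv (\<lambda>z. fderiv ?f z (Z p c)) (snd c p) (V c) + fderiv ?f (snd c p) (fderiv ((\<lambda>q. Z q c) \<circ> chart_inv c) (snd c p) (V c))"
    if V: "V \<in> tangent_space A p" and Z: "vector_field A Z" for V Z
  proof -
    have "dir_deriv A p V (\<lambda>q. dir_deriv A q (Z q) f)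
        = fderiv ((\<lambda>q. dir_deriv A q (Z q) f) \<circ> chart_inv c) (snd c p) (V c)"
      by (rule dir_deriv_chart[OF smooth_dir_deriv[OF f Z] V c])
    also have "fderiv ((\<lambda>q. dir_deriv A q (Z q) f) \<circ> chart_inv c) (snd c p)
        = fderiv (\<lambda>z. fderiv ?f z (((\<lambda>q. Z q c) \<circ> chart_inv c) z)) (snd c p)"
      by (rule fderiv_cong_open[OF smooth_fun_differentiable[OF smooth_dir_deriv[OF f Z] c] o m dir_deriv_field_chart[OF f Z cA]])
    also have "\<dots> (V c) = fderiv (\<lambda>z. fderiv ?f z (((\<lambda>q. Z q c) \<circ> chart_inv c) (snd c p))) (snd c p) (V c)
        + fderiv ?f (snd c p) (fderiv ((\<lambda>q. Z q c) \<circ> chart_inv c) (snd c p) (V c))"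
      by (rule fderiv_fderiv_apply[OF o s m vector_field_differentiable[OF Z c]])
    finally show ?thesis using cA pc by simp
  qed
  have "dir_deriv A p (lie_bracket A X Y p) f = fderiv ?f (snd c p) (lie_bracket A X Y p c)"
    by (rule dir_deriv_chart[OF f vector_field_tangent[OF vector_field_lie_bracket[OF X Y] c] c])
  also have "\<dots> = fderiv ?f (snd c p) (fderiv ((\<lambda>q. Y q c) \<circ> chart_inv c) (snd c p) (X p c))
        - fderiv ?f (snd c p) (fderiv ((\<lambda>q. X q c) \<circ> chart_inv c) (snd c p) (Y p c))"
    by (simp add: lie_bracket_chart[OF c] linear_diff[OF linear_frechet_derivative[OF smooth_fun_differentiable[OF f c]]])
  finally show ?thesis
    using fderiv_symmetric[OF o s m, of "X p c" "Y p c"]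
    by (simp add: *[OF vector_field_tangent[OF X c] Y] *[OF vector_field_tangent[OF Y c] X])
qed

text \<open>The images of \<open>fst d - K\<close> being open says that \<open>K\<close> is closed, without mentioning the topology,
  which the slit bundle does not carry.\<close>

definition cutoff :: "('p, 'e) chart \<Rightarrow> ('p \<Rightarrow> real) \<Rightarrow> bool" where
  "cutoff c \<phi> \<longleftrightarrow> c \<in> A \<and> smooth_fun A \<phi> \<and>
     (\<exists>K\<subseteq>fst c. (\<forall>p. p \<notin> K \<longrightarrow> \<phi> p = 0) \<and> (\<forall>d\<in>A. open (snd d ` (fst d - K))))"

lemma cutoff_outside: "cutoff c \<phi> \<Longrightarrow> p \<notin> fst c \<Longrightarrow> \<phi> p = 0"
  unfolding cutoff_def by blast

lemma cutoff_smooth: "cutoff c \<phi> \<Longrightarrow> smooth_fun A \<phi>"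
  unfolding cutoff_def by blast

lemma cutoff_chart: "cutoff c \<phi> \<Longrightarrow> c \<in> A"
  unfolding cutoff_def by blast

text \<open>The product is smooth on the overlap with the domain of \<open>c\<close> and constantly
  0 off \<open>K\<close>. Both sets have open images, and together they cover the domain of
  \<open>d\<close>.\<close>

lemma smooth_on_cutoff:
  fixes F :: "'p \<Rightarrow> 'f::real_normed_vector"
  assumes \<phi>: "cutoff c \<phi>" and d: "d \<in> A"
    and F: "smooth_on (snd d ` (fst d \<inter> fst c)) (F \<circ> chart_inv d)"
  shows "smooth_on (chart_image d) (\<lambda>z. \<phi> (chart_inv d z) *\<^sub>R F (chart_inv d z))"
proof -
  from \<phi> obtain K where K: "K \<subseteq> fst c" "\<And>p. p \<notin> K \<Longrightarrow> \<phi> p = 0" "open (snd d ` (fst d - K))"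
    using d unfolding cutoff_def by blast
  have c: "c \<in> A" and s: "smooth_fun A \<phi>" using \<phi> by (auto simp: cutoff_def)
  have "smooth_on (snd d ` (fst d \<inter> fst c)) (\<lambda>z. \<phi> (chart_inv d z) *\<^sub>R F (chart_inv d z))"
    using smooth_on_scaleR[OF open_overlap[OF d c] smooth_on_subset[OF smooth_funD[OF s d] overlap_subset] F] by simp
  moreover have "smooth_on (snd d ` (fst d - K)) (\<lambda>z. \<phi> (chart_inv d z) *\<^sub>R F (chart_inv d z))"
    by (rule smooth_on_cong[OF K(3) _ smooth_on_const[of _ 0]]) (use K(2) d in auto)
  ultimately have "smooth_on (snd d ` (fst d \<inter> fst c) \<union> snd d ` (fst d - K)) (\<lambda>z. \<phi> (chart_inv d z) *\<^sub>R F (chart_inv d z))"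
    by (rule smooth_on_union[OF open_overlap[OF d c] K(3)])
  then show ?thesis by (rule smooth_on_subset) (use K(1) in \<open>auto simp: chart_image_def\<close>)
qed

lemma smooth_on_transition_derivative:
  assumes c: "c \<in> A" and d: "d \<in> A"
  shows "smooth_on (snd d ` (fst d \<inter> fst c)) (\<lambda>z. fderiv (snd d \<circ> chart_inv c) ((snd c \<circ> chart_inv d) z) e)"
proof (rule smooth_on_compose[OF open_overlap[OF d c] smooth_transition[OF d c] smooth_on_fderiv[OF smooth_transition[OF c d]]])
  show "(snd c \<circ> chart_inv d) ` snd d ` (fst d \<inter> fst c) \<subseteq> snd c ` (fst c \<inter> fst d)"
    using d by auto
qed

lemma smooth_on_coord_vec:
  assumes c: "c \<in> A" and d: "d \<in> A"
  shows "smooth_on (snd d ` (fst d \<inter> fst c)) ((\<lambda>p. coord_vec A c p e d) \<circ> chart_inv d)"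
proof (rule smooth_on_cong[OF open_overlap[OF d c] _ smooth_on_transition_derivative[OF c d]])
  fix z assume "z \<in> snd d ` (fst d \<inter> fst c)"
  then have "d \<in> charts_at A (chart_inv d z)" using d by (auto simp: charts_at_def)
  then show "fderiv (snd d \<circ> chart_inv c) ((snd c \<circ> chart_inv d) z) e = ((\<lambda>p. coord_vec A c p e d) \<circ> chart_inv d) z"
    by (simp add: coord_vec_def)
qed

text \<open>The supply of globally defined vector fields to which a connection can be applied:
  coordinate fields, cut off and extended by 0.\<close>

lemma vector_field_cutoff:
  assumes \<phi>: "cutoff c \<phi>"
  shows "vector_field A (\<lambda>p. \<phi> p \<odot> coord_vec A c p e)"
proof (rule vector_fieldI)
  note c = cutoff_chart[OF \<phi>]
  show "\<phi> p \<odot> coord_vec A c p e \<in> tangent_space A p" for p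
    using cutoff_outside[OF \<phi>, of p] c tangent_scale[OF coord_vec_tangent[of c p]] tangent_zero
    by (cases "p \<in> fst c") (auto simp: charts_at_def)
  show "\<phi> p \<odot> coord_vec A c p e = 0" if "p \<notin> carrier A" for p
  proof -
    have "p \<notin> fst c" using that c by (auto simp: carrier_def)
    then show ?thesis using cutoff_outside[OF \<phi>] by simp
  qed
  show "smooth_on (chart_image d) (\<lambda>z. (\<phi> (chart_inv d z) \<odot> coord_vec A c (chart_inv d z) e) d)" if "d \<in> A" for d
    using smooth_on_cutoff[OF \<phi> that smooth_on_coord_vec[OF c that]] by simp
qed

end

subsection \<open>Bump functions\<close>

lemma smooth_manifold_atlas:
  assumes "smooth_manifold X A"
  shows "smooth_atlas A"
proof
  have h: "homeomorphic_map (subtopology X (fst c)) (top_of_set (chart_image c)) (snd c)"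
    and ox: "openin X (fst c)" and oi: "open (chart_image c)" if "c \<in> A" for c
    using assms that unfolding smooth_manifold_def by blast+
  fix c assume c: "c \<in> A"
  have t: "topspace (subtopology X (fst c)) = fst c" using openin_subset[OF ox[OF c]] by auto
  show "inj_on (snd c) (fst c)"
    using homeomorphic_imp_injective_map[OF h[OF c]] t by simp
  fix d assume d: "d \<in> A"
  have "openin (subtopology X (fst c)) (fst c \<inter> fst d)"
    using ox[OF d] by (metis Int_commute openin_subtopology)
  then have "openin (top_of_set (chart_image c)) (snd c ` (fst c \<inter> fst d))"
    using homeomorphic_map_openness_eq[OF h[OF c]] by blast
  then show "open (snd c ` (fst c \<inter> fst d))" using oi[OF c] openin_open_eq by blast
  show "smooth_on (snd c ` (fst c \<inter> fst d)) (snd d \<circ> chart_inv c)"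
    using assms c d unfolding smooth_manifold_def by blast
qed

text \<open>A radial bump in the chart, supported in the preimage \<open>K\<close> of a closed ball.
  \<open>K\<close> is compact, hence closed in the Hausdorff space \<open>X\<close>, so that
  extending by 0 creates no singularity in other charts.\<close>

lemma cutoff_exists:
  assumes M: "smooth_manifold X A" and c: "c \<in> A" and p: "p \<in> fst c"
  obtains \<phi> where "smooth_atlas.cutoff A c \<phi>" "\<phi> p \<noteq> 0"
proof -
  interpret smooth_atlas A by (rule smooth_manifold_atlas[OF M])
  have h: "homeomorphic_map (subtopology X (fst d)) (top_of_set (chart_image d)) (snd d)"
    and ox: "openin X (fst d)" and oi: "open (chart_image d)" if "d \<in> A" for d
    using M that unfolding smooth_manifold_def by blast+
  define x where "x = snd c p"
  have "x \<in> chart_image c" using p by (auto simp: x_def chart_image_def)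
  then obtain r where r: "r > 0" "cball x r \<subseteq> chart_image c"
    using oi[OF c] open_contains_cball by blast
  obtain s :: "real \<Rightarrow> real" where s: "smooth_on UNIV s" "\<And>t. t > 0 \<Longrightarrow> s t > 0" "\<And>t. t \<le> 0 \<Longrightarrow> s t = 0"
    using smooth_step by blast
  \<comment> \<open>The squared distance is smooth also at the centre; \<open>\<psi>\<close> is
    positive inside the ball and 0 from its boundary on.\<close>
  define \<psi> where "\<psi> z = s (r\<^sup>2 - (z - x) \<bullet> (z - x))" for z
  define K where "K = {q \<in> fst c. snd c q \<in> cball x r}"
  define \<phi> where "\<phi> q = (if q \<in> K then \<psi> (snd c q) else 0)" for q
  have \<psi>: "smooth_on UNIV \<psi>"
    unfolding \<psi>_def
    by (rule smooth_on_compose[OF open_UNIV _ s(1)])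
      (auto intro!: smooth_on_diff smooth_on_inner smooth_on_const smooth_on_ident)
  have \<psi>0: "\<psi> z = 0" if "z \<notin> cball x r" for z
  proof -
    have "r\<^sup>2 \<le> (norm (z - x))\<^sup>2" using that r(1) by (intro power_mono) (auto simp: dist_norm norm_minus_commute)
    then show ?thesis unfolding \<psi>_def by (intro s(3)) (simp add: power2_norm_eq_inner)
  qed
  have t: "topspace (subtopology X (fst c)) = fst c" using openin_subset[OF ox[OF c]] by auto
  obtain g where g: "homeomorphic_maps (subtopology X (fst c)) (top_of_set (chart_image c)) (snd c) g"
    using h[OF c] homeomorphic_map_maps by blast
  have "compactin (top_of_set (chart_image c)) (cball x r)"
    using r(2) by (simp add: compactin_subtopology)
  then have "compactin (subtopology X (fst c)) (g ` cball x r)"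
    using g image_compactin unfolding homeomorphic_maps_def by blast
  moreover have "g ` cball x r = K"
  proof -
    have 1: "g (snd c q) = q" if "q \<in> fst c" for q using g t that unfolding homeomorphic_maps_def by simp
    have 2: "g z \<in> fst c" "snd c (g z) = z" if "z \<in> chart_image c" for z
      using that 1 by (auto simp: chart_image_def)
    show ?thesis using 1 2 r(2) unfolding K_def by (force simp: image_iff)
  qed
  ultimately have "compactin X K" by (simp add: compactin_subtopology)
  \<comment> \<open>What counts is closedness in all of \<open>X\<close>; within the domain of
    \<open>c\<close> alone it would say nothing about points of other charts.\<close>
  then have clK: "closedin X K"
    using M compactin_imp_closedin unfolding smooth_manifold_def by blast
  have oK: "open (snd d ` (fst d - K))" if d: "d \<in> A" for d
  proof -
    have "openin X (fst d - K)" using ox[OF d] clK openin_diff by blast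
    then have "openin (subtopology X (fst d)) (fst d - K)"
      by (simp add: openin_subset_topspace_eq openin_open_subtopology[OF ox[OF d]])
    then have "openin (top_of_set (chart_image d)) (snd d ` (fst d - K))"
      using homeomorphic_map_openness_eq[OF h[OF d]] by blast
    then show ?thesis using oi[OF d] openin_open_eq by blast
  qed
  have sm: "smooth_fun A \<phi>"
  proof (rule smooth_funI)
    fix d assume d: "d \<in> A"
    have "smooth_on (snd d ` (fst d \<inter> fst c)) (\<lambda>z. \<psi> ((snd c \<circ> chart_inv d) z))"
      by (rule smooth_on_compose[OF open_overlap[OF d c] smooth_transition[OF d c] \<psi>]) auto
    then have "smooth_on (snd d ` (fst d \<inter> fst c)) (\<phi> \<circ> chart_inv d)"
      by (rule smooth_on_cong[OF open_overlap[OF d c], rotated]) (use d \<psi>0 in \<open>auto simp: \<phi>_def K_def\<close>)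
    moreover have "smooth_on (snd d ` (fst d - K)) (\<phi> \<circ> chart_inv d)"
      by (rule smooth_on_cong[OF oK[OF d] _ smooth_on_const[of _ 0]]) (use d in \<open>auto simp: \<phi>_def\<close>)
    ultimately have "smooth_on (snd d ` (fst d \<inter> fst c) \<union> snd d ` (fst d - K)) (\<phi> \<circ> chart_inv d)"
      by (rule smooth_on_union[OF open_overlap[OF d c] oK[OF d]])
    then show "smooth_on (chart_image d) (\<phi> \<circ> chart_inv d)"
      by (rule smooth_on_subset) (auto simp: chart_image_def K_def)
  qed
  have "cutoff c \<phi>"
    unfolding cutoff_def using c sm oK by (intro conjI exI[of _ K]) (auto simp: K_def \<phi>_def)
  moreover have "\<phi> p \<noteq> 0"
    using p r(1) s(2)[of "r\<^sup>2"] by (simp add: \<phi>_def K_def x_def \<psi>_def)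
  ultimately show ?thesis using that by blast
qed

context smooth_atlas
begin

section \<open>Expansion in coordinate vectors and local criteria for smoothness\<close>

lemma coord_vec_add: "c \<in> charts_at A p \<Longrightarrow> coord_vec A c p (v + w) = coord_vec A c p v + coord_vec A c p w"
  by (rule tangent_eqI[of _ p _ c]) (simp_all add: coord_vec_tangent coord_vec_chart tangent_add)

lemma coord_vec_scale: "c \<in> charts_at A p \<Longrightarrow> coord_vec A c p (s *\<^sub>R v) = s \<odot> coord_vec A c p v"
  by (rule tangent_eqI[of _ p _ c]) (simp_all add: coord_vec_tangent coord_vec_chart tangent_scale)

lemma coord_vec_sum:
  "c \<in> charts_at A p \<Longrightarrow> coord_vec A c p (\<Sum>i\<in>I. f i) = (\<Sum>i\<in>I. coord_vec A c p (f i))"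
  by (rule tangent_eqI[of _ p _ c]) (simp_all add: coord_vec_tangent coord_vec_chart tangent_sum sum_fun_apply)

lemma tangent_expansion:
  assumes "X \<in> tangent_space A p" "c \<in> charts_at A p"
  shows "X = (\<Sum>b\<in>Basis. (X c \<bullet> b) \<odot> coord_vec A c p b)"
proof -
  have "X = coord_vec A c p (\<Sum>b\<in>Basis. (X c \<bullet> b) *\<^sub>R b)"
    by (simp add: euclidean_representation coord_vec_component[OF assms])
  then show ?thesis by (simp only: coord_vec_sum[OF assms(2)] coord_vec_scale[OF assms(2)])
qed

lemma smooth_on_change_chart:
  fixes f :: "'p \<Rightarrow> 'f::real_normed_vector"
  assumes c: "c \<in> A" and d: "d \<in> A" and f: "smooth_on (chart_image c) (f \<circ> chart_inv c)"
  shows "smooth_on (snd d ` (fst d \<inter> fst c)) (f \<circ> chart_inv d)"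
proof -
  have "smooth_on (snd d ` (fst d \<inter> fst c)) (\<lambda>z. (f \<circ> chart_inv c) ((snd c \<circ> chart_inv d) z))"
    by (rule smooth_on_compose[OF open_overlap[OF d c] smooth_transition[OF d c] f])
      (use d in \<open>auto simp: chart_image_def\<close>)
  then show ?thesis
    by (rule smooth_on_cong[OF open_overlap[OF d c], rotated]) (use c d in auto)
qed

lemma smooth_fun_local:
  assumes "\<And>c p. c \<in> A \<Longrightarrow> p \<in> fst c \<Longrightarrow>
    \<exists>U\<subseteq>chart_image c. open U \<and> snd c p \<in> U \<and> smooth_on U (f \<circ> chart_inv c)"
  shows "smooth_fun A f"
proof (rule smooth_funI, rule smooth_on_local)
  fix c x assume c: "c \<in> A" and "x \<in> chart_image c"
  then obtain p where "p \<in> fst c" "x = snd c p" by (auto simp: chart_image_def)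
  with assms[OF c this(1)] show "\<exists>U. open U \<and> x \<in> U \<and> smooth_on U (f \<circ> chart_inv c)" by blast
qed

text \<open>Provides the neighbourhoods on which division by a bump function is legitimate.\<close>

lemma open_cutoff_support:
  assumes "smooth_fun A \<phi>" "c \<in> A"
  shows "open {z \<in> chart_image c. \<phi> (chart_inv c z) \<noteq> 0}"
proof -
  have "continuous_on (chart_image c) (\<phi> \<circ> chart_inv c)"
    by (rule smooth_on_continuous[OF smooth_funD[OF assms]])
  then have "open ((\<phi> \<circ> chart_inv c) -` (- {0}) \<inter> chart_image c)"
    using continuous_on_open_vimage[OF open_chart_image[OF assms(2)]] by blast
  moreover have "(\<phi> \<circ> chart_inv c) -` (- {0}) \<inter> chart_image c = {z \<in> chart_image c. \<phi> (chart_inv c z) \<noteq> 0}"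
    by auto
  ultimately show ?thesis by simp
qed

end

section \<open>The slit tangent bundle and the pullback bundle\<close>

lemma slit_chart_simps [simp]:
  "fst (slit_chart A c) = {u \<in> slit_bundle A. fst u \<in> fst c}"
  "snd (slit_chart A c) u = (snd c (fst u), snd u c)"
  by (simp_all add: slit_chart_def)

text \<open>The existence of bump functions is all that is kept of the topology of the base.\<close>

locale pullback = smooth_atlas A for A :: "('p, 'e::euclidean_space) chart set" +
  assumes cutoffs: "c \<in> A \<Longrightarrow> p \<in> fst c \<Longrightarrow> \<exists>\<phi>. smooth_atlas.cutoff A c \<phi> \<and> \<phi> p \<noteq> 0"
begin

abbreviation "SA \<equiv> slit_atlas A"
abbreviation "SB \<equiv> slit_bundle A"
abbreviation "sc \<equiv> slit_chart A"

section \<open>Charts of the slit bundle\<close>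

lemma slit_bundle_tangent: "u \<in> SB \<Longrightarrow> snd u \<in> tangent_space A (fst u)" "u \<in> SB \<Longrightarrow> fst u \<in> carrier A"
  "u \<in> SB \<Longrightarrow> snd u \<noteq> 0"
  by (auto simp: slit_bundle_def tangent_bundle_def)

lemma slit_bundleI: "p \<in> carrier A \<Longrightarrow> v \<in> tangent_space A p \<Longrightarrow> v \<noteq> 0 \<Longrightarrow> (p, v) \<in> SB"
  by (auto simp: slit_bundle_def tangent_bundle_def)

lemma slit_component_nonzero: "u \<in> SB \<Longrightarrow> c \<in> charts_at A (fst u) \<Longrightarrow> snd u c \<noteq> 0"
  using tangent_eqI[OF slit_bundle_tangent(1) tangent_zero, of u c] slit_bundle_tangent(3) by auto

text \<open>An explicit inverse of \<open>slit_chart A c\<close>, to replace the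
  \<open>inv_into\<close> in \<open>chart_inv\<close> by a formula.\<close>

definition slit_point :: "('p, 'e) chart \<Rightarrow> 'e \<times> 'e \<Rightarrow> ('p, 'e) tpoint" where
  "slit_point c z = (chart_inv c (fst z), coord_vec A c (chart_inv c (fst z)) (snd z))"

lemma slit_point_in:
  assumes "c \<in> A" "x \<in> chart_image c" "y \<noteq> 0"
  shows "slit_point c (x, y) \<in> fst (sc c)" "snd (sc c) (slit_point c (x, y)) = (x, y)"
proof -
  have c: "c \<in> charts_at A (chart_inv c x)" by (rule chart_inv_charts_at[OF assms(1,2)])
  have "coord_vec A c (chart_inv c x) y \<noteq> 0"
    using coord_vec_chart[OF c, of y] assms(3) by auto
  then show "slit_point c (x, y) \<in> fst (sc c)"
    using slit_bundleI[OF _ coord_vec_tangent[OF c], of y] chart_inv_image[OF assms(2)] c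
      carrier_charts_at[of "chart_inv c x"] unfolding slit_point_def by (auto simp del: split_paired_Ex)
  show "snd (sc c) (slit_point c (x, y)) = (x, y)"
    using coord_vec_chart[OF c] chart_inv_image[OF assms(2)] by (simp add: slit_point_def)
qed

lemma slit_chart_inj: "c \<in> A \<Longrightarrow> inj_on (snd (sc c)) (fst (sc c))"
proof (rule inj_onI)
  fix u v assume c: "c \<in> A" and u: "u \<in> fst (sc c)" and v: "v \<in> fst (sc c)" and e: "snd (sc c) u = snd (sc c) v"
  then have f: "fst u = fst v" using inj_onD[OF inj_chart[OF c]] by simp
  have "c \<in> charts_at A (fst u)" using c u by (simp add: charts_at_def)
  then have "snd u = snd v"
    using tangent_eqI[OF slit_bundle_tangent(1), of u "snd v" c] slit_bundle_tangent(1)[of v] u v e f by simp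
  with f show "u = v" by (simp add: prod_eq_iff)
qed

text \<open>A tangent vector vanishes as soon as its component in one chart does, so the fibre
  components fill exactly \<open>- {0}\<close>.\<close>

lemma slit_overlap:
  assumes "c \<in> A"
  shows "snd (sc c) ` (fst (sc c) \<inter> fst (sc d)) = snd c ` (fst c \<inter> fst d) \<times> (- {0})"
proof (intro equalityI subsetI)
  fix z assume "z \<in> snd (sc c) ` (fst (sc c) \<inter> fst (sc d))"
  then obtain u where u: "u \<in> SB" "fst u \<in> fst c" "fst u \<in> fst d" "z = snd (sc c) u" by auto
  then have "snd u c \<noteq> 0" using slit_component_nonzero[OF u(1)] assms by (simp add: charts_at_def)
  then show "z \<in> snd c ` (fst c \<inter> fst d) \<times> (- {0})" using u by simp
next
  fix z assume z: "z \<in> snd c ` (fst c \<inter> fst d) \<times> (- {0 :: 'e})"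
  obtain x y where xy: "z = (x, y)" by (cases z)
  then have x: "x \<in> chart_image c" "chart_inv c x \<in> fst d" "y \<noteq> 0" using z overlap_iff[OF assms] by blast+
  have "slit_point c (x, y) \<in> fst (sc c) \<inter> fst (sc d)"
    using slit_point_in[OF assms x(1,3)] x(2) by (simp add: slit_point_def)
  then show "z \<in> snd (sc c) ` (fst (sc c) \<inter> fst (sc d))"
    using slit_point_in(2)[OF assms x(1,3)] xy by (metis imageI)
qed

lemma slit_chart_image: "c \<in> A \<Longrightarrow> chart_image (sc c) = chart_image c \<times> (- {0})"
  using slit_overlap[of c c] by (simp add: chart_image_def)

lemma slit_chart_inv:
  assumes "c \<in> A" "z \<in> chart_image (sc c)"
  shows "chart_inv (sc c) z = slit_point c z"
proof -
  obtain x y where xy: "z = (x, y)" by (cases z)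
  then have x: "x \<in> chart_image c" "y \<noteq> 0" using assms slit_chart_image by auto
  show ?thesis
    unfolding xy chart_inv_def
    by (rule inv_into_f_eq[OF slit_chart_inj[OF assms(1)] slit_point_in[OF assms(1) x]])
qed

lemma slit_transition:
  assumes c: "c \<in> A" and d: "d \<in> A" and x: "x \<in> snd c ` (fst c \<inter> fst d)" and y: "y \<noteq> 0"
  shows "(snd (sc d) \<circ> chart_inv (sc c)) (x, y) = ((snd d \<circ> chart_inv c) x, fderiv (snd d \<circ> chart_inv c) x y)"
proof -
  have x': "x \<in> chart_image c" "chart_inv c x \<in> fst d" using x overlap_iff[OF c] by blast+
  then have z: "(x, y) \<in> chart_image (sc c)" using slit_chart_image[OF c] y by simp
  have "d \<in> charts_at A (chart_inv c x)" using x'(2) d by (simp add: charts_at_def)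
  then show ?thesis
    by (simp add: slit_chart_inv[OF c z] slit_point_def coord_vec_def chart_inv_image[OF x'(1)])
qed

text \<open>The fibre part is linear in \<open>y\<close> with coefficients depending smoothly on
  \<open>x\<close>; expanded in the basis it is a sum of products of smooth functions.\<close>

lemma smooth_slit_transition:
  assumes c: "c \<in> A" and d: "d \<in> A"
  shows "smooth_on (snd c ` (fst c \<inter> fst d) \<times> (- {0})) (snd (sc d) \<circ> chart_inv (sc c))"
proof -
  let ?S = "snd c ` (fst c \<inter> fst d) \<times> (- {0::'e})" and ?t = "snd d \<circ> chart_inv c"
  have o: "open ?S" by (intro open_Times open_overlap c d) auto
  have f: "smooth_on ?S fst" and s: "smooth_on ?S snd"
    by (auto intro: smooth_on_bounded_linear bounded_linear_fst bounded_linear_snd)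
  have 1: "smooth_on ?S (\<lambda>z. ?t (fst z))"
    by (rule smooth_on_compose[OF o f smooth_transition[OF c d]]) auto
  have 2: "smooth_on ?S (\<lambda>z. fderiv ?t (fst z) b)" for b
    by (rule smooth_on_compose[OF o f smooth_on_fderiv[OF smooth_transition[OF c d]]]) auto
  have "smooth_on ?S (\<lambda>z. (?t (fst z), \<Sum>b\<in>Basis. (snd z \<bullet> b) *\<^sub>R fderiv ?t (fst z) b))"
    by (intro smooth_on_Pair smooth_on_sum smooth_on_scaleR smooth_on_inner smooth_on_const o 1 2 s)
  then show ?thesis
  proof (rule smooth_on_cong[OF o, rotated])
    fix z assume z: "z \<in> ?S"
    have "linear (fderiv ?t (fst z))"
      using z by (intro linear_frechet_derivative smooth_on_differentiable[OF smooth_transition[OF c d]]) auto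
    then show "(?t (fst z), \<Sum>b\<in>Basis. (snd z \<bullet> b) *\<^sub>R fderiv ?t (fst z) b) = (snd (sc d) \<circ> chart_inv (sc c)) z"
      using slit_transition[OF c d, of "fst z" "snd z"] z linear_in_basis[of "fderiv ?t (fst z)" "snd z"] by auto
  qed
qed

text \<open>From here on functions, fields and brackets on the slit bundle are served by the lemmas
  on atlases, with the prefix \<open>slit\<close>.\<close>

sublocale slit: smooth_atlas SA
proof
  fix c assume "c \<in> SA"
  then obtain c' where c: "c' \<in> A" "c = sc c'" by (auto simp: slit_atlas_def)
  show "inj_on (snd c) (fst c)" using slit_chart_inj c by simp
  fix d assume "d \<in> SA"
  then obtain d' where d: "d' \<in> A" "d = sc d'" by (auto simp: slit_atlas_def)
  show "open (snd c ` (fst c \<inter> fst d))"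
    unfolding c(2) d(2) slit_overlap[OF c(1)] by (intro open_Times open_overlap c d) auto
  show "smooth_on (snd c ` (fst c \<inter> fst d)) (snd d \<circ> chart_inv c)"
    unfolding c(2) d(2) slit_overlap[OF c(1)] by (rule smooth_slit_transition[OF c(1) d(1)])
qed

lemma slit_carrier: "carrier SA = SB"
  using slit_bundle_tangent(2) by (force simp: slit_atlas_def carrier_def slit_chart_def)

lemma slit_charts_at:
  assumes "u \<in> SB" shows "charts_at SA u = sc ` charts_at A (fst u)"
  using assms by (auto simp: charts_at_def slit_atlas_def)

lemma slit_chart_in: "c \<in> A \<Longrightarrow> sc c \<in> SA"
  by (simp add: slit_atlas_def)

lemma slit_charts_atI: "u \<in> SB \<Longrightarrow> c \<in> charts_at A (fst u) \<Longrightarrow> sc c \<in> charts_at SA u"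
  by (simp add: slit_charts_at)

lemma slit_ex_chart: "u \<in> SB \<Longrightarrow> \<exists>c. c \<in> charts_at A (fst u)"
  using slit_bundle_tangent(2) carrier_charts_at by blast

lemma slit_chart_inv_in:
  assumes "c \<in> A" "z \<in> chart_image (sc c)"
  shows "chart_inv (sc c) z \<in> SB" "c \<in> charts_at A (fst (chart_inv (sc c) z))"
    "fst (chart_inv (sc c) z) = chart_inv c (fst z)" "snd (chart_inv (sc c) z) c = snd z"
    "chart_inv (sc c) z \<in> fst (sc c)" "snd c (fst (chart_inv (sc c) z)) = fst z"
proof -
  let ?u = "chart_inv (sc c) z"
  have a: "?u \<in> SB" "fst ?u \<in> fst c" using chart_inv_image(1)[OF assms(2)] by simp_all
  have b: "z = (snd c (fst ?u), snd ?u c)" using chart_inv_image(2)[OF assms(2)] by simp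
  show "?u \<in> SB" "?u \<in> fst (sc c)" "c \<in> charts_at A (fst ?u)" using a assms(1) by (simp_all add: charts_at_def)
  show "fst ?u = chart_inv c (fst z)" by (simp add: slit_chart_inv[OF assms] slit_point_def)
  show "snd ?u c = snd z" "snd c (fst ?u) = fst z" by (subst b, simp)+
qed

lemma slit_smooth_funI:
  "(\<And>c. c \<in> A \<Longrightarrow> smooth_on (chart_image (sc c)) (f \<circ> chart_inv (sc c))) \<Longrightarrow> smooth_fun SA f"
  unfolding smooth_fun_def slit_atlas_def by blast

lemma slit_vector_fieldI:
  assumes "\<And>u. u \<in> SB \<Longrightarrow> X u \<in> tangent_space SA u" "\<And>u. u \<notin> SB \<Longrightarrow> X u = 0"
    "\<And>c. c \<in> A \<Longrightarrow> smooth_on (chart_image (sc c)) (\<lambda>z. X (chart_inv (sc c) z) (sc c))"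
  shows "vector_field SA X"
  by (rule slit.vector_fieldI) (use assms in \<open>auto simp: slit_carrier, auto simp: slit_atlas_def\<close>)

lemma smooth_on_fst_slit: "c \<in> A \<Longrightarrow> smooth_on (chart_image c) (f \<circ> chart_inv c) \<Longrightarrow>
   smooth_on (chart_image (sc c)) (\<lambda>z. f (fst (chart_inv (sc c) z)))"
  for f :: "'p \<Rightarrow> 'f::real_normed_vector"
proof -
  assume c: "c \<in> A" and f: "smooth_on (chart_image c) (f \<circ> chart_inv c)"
  have o: "open (chart_image (sc c))" using slit.open_chart_image[OF slit_chart_in[OF c]] .
  have "smooth_on (chart_image (sc c)) (\<lambda>z. (f \<circ> chart_inv c) (fst z))"
    by (rule smooth_on_compose[OF o smooth_on_bounded_linear[OF bounded_linear_fst] f])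
      (auto simp: slit_chart_image[OF c])
  then show ?thesis by (rule smooth_on_cong[OF o, rotated]) (simp add: slit_chart_inv_in[OF c])
qed

lemma smooth_fun_fst: assumes "smooth_fun A f" shows "smooth_fun SA (\<lambda>u. f (fst u))"
  by (rule slit_smooth_funI) (use smooth_on_fst_slit[OF _ smooth_funD[OF assms]] in \<open>simp add: o_def\<close>)

text \<open>Bump functions of the base can be used upstairs because slit charts are full preimages
  of base charts. The test \<open>u \<in> SB\<close> is there because \<open>cutoff\<close> asks for
  0 at every point outside \<open>K\<close>, also at pairs that do not belong to the slit
  bundle.\<close>

lemma slit_cutoff:
  assumes "cutoff c \<phi>" shows "slit.cutoff (sc c) (\<lambda>u. if u \<in> SB then \<phi> (fst u) else 0)"
proof -
  from assms obtain K where c: "c \<in> A" and s: "smooth_fun A \<phi>" and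
    K: "K \<subseteq> fst c" "\<And>p. p \<notin> K \<Longrightarrow> \<phi> p = 0" "\<And>d. d \<in> A \<Longrightarrow> open (snd d ` (fst d - K))"
    unfolding cutoff_def by blast
  let ?K = "{u \<in> SB. fst u \<in> K}"
  have "smooth_fun SA (\<lambda>u. if u \<in> SB then \<phi> (fst u) else 0)"
  proof (rule slit_smooth_funI)
    fix d assume d: "d \<in> A"
    show "smooth_on (chart_image (sc d)) ((\<lambda>u. if u \<in> SB then \<phi> (fst u) else 0) \<circ> chart_inv (sc d))"
      by (rule smooth_on_cong[OF _ _ slit.smooth_funD[OF smooth_fun_fst[OF s]]])
        (use slit.open_chart_image slit_chart_in[OF d] slit_chart_inv_in[OF d] in auto)
  qed
  moreover have "open (snd e ` (fst e - ?K))" if e: "e \<in> SA" for e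
  proof -
    obtain d where d: "d \<in> A" "e = sc d" using e unfolding slit_atlas_def by blast
    have "snd e ` (fst e - ?K) = snd d ` (fst d - K) \<times> (- {0})"
    proof (intro equalityI subsetI)
      fix z assume "z \<in> snd e ` (fst e - ?K)"
      then obtain u where u: "u \<in> SB" "fst u \<in> fst d" "fst u \<notin> K" "z = snd (sc d) u" using d(2) by auto
      then have "snd u d \<noteq> 0" using slit_component_nonzero[OF u(1)] d(1) by (simp add: charts_at_def)
      then show "z \<in> snd d ` (fst d - K) \<times> (- {0})" using u by simp
    next
      fix z assume z: "z \<in> snd d ` (fst d - K) \<times> (- {0 :: 'e})"
      obtain x y where xy: "z = (x, y)" by (cases z)
      then have x: "x \<in> chart_image d" "chart_inv d x \<notin> K" "y \<noteq> 0"
        using z d by (auto simp: chart_image_def)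
      have "slit_point d (x, y) \<in> fst e - ?K"
        using slit_point_in[OF d(1) x(1,3)] x(2) d by (simp add: slit_point_def)
      from imageI[OF this, of "snd e"] show "z \<in> snd e ` (fst e - ?K)"
        unfolding d(2) slit_point_in(2)[OF d(1) x(1,3)] xy .
    qed
    then show ?thesis by (simp add: open_Times K(3)[OF d(1)] open_Compl)
  qed
  ultimately show ?thesis
    unfolding slit.cutoff_def using c slit_chart_in K(1,2) by (intro conjI exI[of _ ?K]) auto
qed

section \<open>Sections of the pullback bundle\<close>

lemma pi_fieldI:
  assumes "\<And>u. u \<in> SB \<Longrightarrow> Z u \<in> tangent_space A (fst u)" "\<And>u. u \<notin> SB \<Longrightarrow> Z u = 0"
    "\<And>c. c \<in> A \<Longrightarrow> smooth_on (chart_image (sc c)) (\<lambda>z. Z (chart_inv (sc c) z) c)"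
  shows "pi_field A Z"
  using assms unfolding pi_field_def o_def by blast

lemma pi_fieldD:
  assumes "pi_field A Z"
  shows "u \<in> SB \<Longrightarrow> Z u \<in> tangent_space A (fst u)" "u \<notin> SB \<Longrightarrow> Z u = 0"
    "c \<in> A \<Longrightarrow> smooth_on (chart_image (sc c)) (\<lambda>z. Z (chart_inv (sc c) z) c)"
  using assms unfolding pi_field_def o_def by blast+

lemma open_slit_chart_image: "c \<in> A \<Longrightarrow> open (chart_image (sc c))"
  using slit.open_chart_image slit_chart_in by blast

lemma pi_field_add:
  assumes "pi_field A X" "pi_field A Y" shows "pi_field A (X + Y)"
  by (rule pi_fieldI)
    (simp_all add: pi_fieldD[OF assms(1)] pi_fieldD[OF assms(2)] tangent_add smooth_on_add open_slit_chart_image)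

lemma pi_field_fscale:
  assumes "smooth_fun SA f" "pi_field A X" shows "pi_field A (fscale f X)"
proof (rule pi_fieldI)
  fix c assume c: "c \<in> A"
  show "smooth_on (chart_image (sc c)) (\<lambda>z. fscale f X (chart_inv (sc c) z) c)"
    using smooth_on_scaleR[OF open_slit_chart_image[OF c] slit.smooth_funD[OF assms(1) slit_chart_in[OF c]]
        pi_fieldD(3)[OF assms(2) c]] by simp
qed (simp_all add: pi_fieldD[OF assms(2)] tangent_scale)

lemma fscale_minus_one: "fscale (\<lambda>p. -1) X = - X"
  by (auto simp: fun_eq_iff)

lemma pi_field_minus: "pi_field A X \<Longrightarrow> pi_field A (- X)"
  using pi_field_fscale[OF slit.smooth_fun_const[of "-1"]] by (simp add: fscale_minus_one)

lemma pi_field_diff: "pi_field A X \<Longrightarrow> pi_field A Y \<Longrightarrow> pi_field A (X - Y)"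
  using pi_field_add[OF _ pi_field_minus, of X Y] by simp

lemma pi_field_zero: "pi_field A 0"
  by (rule pi_fieldI) (simp_all add: tangent_zero smooth_on_const)

lemma pi_field_sum: "(\<And>i. i \<in> I \<Longrightarrow> pi_field A (X i)) \<Longrightarrow> pi_field A (\<Sum>i\<in>I. X i)"
  by (induction I rule: infinite_finite_induct) (auto intro: pi_field_zero pi_field_add)

lemma pi_field_fundamental: "pi_field A (fundamental_field A)"
proof (rule pi_fieldI)
  fix c assume c: "c \<in> A"
  show "smooth_on (chart_image (sc c)) (\<lambda>z. fundamental_field A (chart_inv (sc c) z) c)"
    by (rule smooth_on_cong[OF open_slit_chart_image[OF c] _ smooth_on_bounded_linear[OF bounded_linear_snd]])
      (simp add: fundamental_field_def slit_chart_inv_in[OF c])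
qed (simp_all add: fundamental_field_def slit_bundle_tangent)

text \<open>Cut off and pulled back, a coordinate field becomes a global section. For basis vectors
  \<open>e\<close> these sections form a basis of each fibre over which \<open>\<phi>\<close> is
  nonzero.\<close>

definition frame_field :: "('p, 'e) chart \<Rightarrow> ('p \<Rightarrow> real) \<Rightarrow> 'e \<Rightarrow> ('p, 'e) pifield" where
  "frame_field c \<phi> e = (\<lambda>u. if u \<in> SB then \<phi> (fst u) \<odot> coord_vec A c (fst u) e else 0)"

lemma pi_field_frame:
  assumes \<phi>: "cutoff c \<phi>" shows "pi_field A (frame_field c \<phi> e)"
proof (rule pi_fieldI)
  note c = cutoff_chart[OF \<phi>]
  note v = vector_field_cutoff[OF \<phi>, of e]
  show "frame_field c \<phi> e u \<in> tangent_space A (fst u)" if "u \<in> SB" for u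
    using vector_fieldD(1)[OF v slit_bundle_tangent(2)[OF that]] that by (simp add: frame_field_def)
  show "smooth_on (chart_image (sc d)) (\<lambda>z. frame_field c \<phi> e (chart_inv (sc d) z) d)" if d: "d \<in> A" for d
    by (rule smooth_on_cong[OF open_slit_chart_image[OF d] _ smooth_on_fst_slit[OF d vector_fieldD(3)[OF v d]]])
      (simp add: frame_field_def slit_chart_inv_in[OF d])
qed (simp add: frame_field_def)

lemma smooth_cutoff_component:
  assumes \<phi>: "cutoff c \<phi>" and Z: "pi_field A Z"
  shows "smooth_fun SA (\<lambda>u. \<phi> (fst u) * (Z u c \<bullet> b))"
proof (rule slit_smooth_funI)
  fix d assume d: "d \<in> A"
  note c = cutoff_chart[OF \<phi>]
  have "smooth_on (chart_image (sc c)) ((\<lambda>u. Z u c \<bullet> b) \<circ> chart_inv (sc c))"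
    using smooth_on_inner[OF open_slit_chart_image[OF c] pi_fieldD(3)[OF Z c] smooth_on_const[of _ b]] by (simp add: o_def)
  from slit.smooth_on_cutoff[OF slit_cutoff[OF \<phi>] slit_chart_in[OF d]
      slit.smooth_on_change_chart[OF slit_chart_in[OF c] slit_chart_in[OF d] this]]
  show "smooth_on (chart_image (sc d)) ((\<lambda>u. \<phi> (fst u) * (Z u c \<bullet> b)) \<circ> chart_inv (sc d))"
    by (rule smooth_on_cong[OF open_slit_chart_image[OF d], rotated]) (simp add: slit_chart_inv_in[OF d])
qed

text \<open>Justifies the choice in \<open>pi_extension\<close>. The constant
  \<open>1 / \<phi> (fst u)\<close> restores the value at \<open>u\<close> that the cutoff has
  scaled.\<close>

lemma ex_pi_field:
  assumes u: "u \<in> SB" and a: "a \<in> tangent_space A (fst u)"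
  shows "\<exists>Z. pi_field A Z \<and> Z u = a"
proof -
  obtain c where c: "c \<in> charts_at A (fst u)" using slit_ex_chart[OF u] by blast
  obtain \<phi> where \<phi>: "cutoff c \<phi>" "\<phi> (fst u) \<noteq> 0" using cutoffs[OF charts_atD[OF c]] by blast
  let ?Z = "fscale (\<lambda>w. 1 / \<phi> (fst u)) (frame_field c \<phi> (a c))"
  have "pi_field A ?Z" by (intro pi_field_fscale slit.smooth_fun_const pi_field_frame \<phi>)
  moreover have "?Z u = a" using \<phi>(2) u coord_vec_component[OF a c] by (simp add: frame_field_def)
  ultimately show ?thesis by blast
qed

lemma pi_extension:
  assumes "u \<in> SB" "a \<in> tangent_space A (fst u)"
  shows "pi_field A (pi_extension A u a)" "pi_extension A u a u = a"
  using someI_ex[OF ex_pi_field[OF assms]] unfolding pi_extension_def by blast+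

text \<open>The factor \<open>\<phi>\<^sup>2\<close> makes both the chart components and the coordinate fields global.\<close>

lemma frame_expansion:
  assumes \<phi>: "cutoff c \<phi>" and Z: "pi_field A Z"
  shows "fscale (\<lambda>u. \<phi> (fst u) * \<phi> (fst u)) Z =
    (\<Sum>b\<in>Basis. fscale (\<lambda>u. \<phi> (fst u) * (Z u c \<bullet> b)) (frame_field c \<phi> b))" (is "?l = ?r")
proof
  fix u
  show "?l u = ?r u"
  proof (cases "u \<in> SB \<and> fst u \<in> fst c")
    case True
    then have c: "c \<in> charts_at A (fst u)" using cutoff_chart[OF \<phi>] by (simp add: charts_at_def)
    have "?l u = (\<phi> (fst u) * \<phi> (fst u)) \<odot> (\<Sum>b\<in>Basis. (Z u c \<bullet> b) \<odot> coord_vec A c (fst u) b)"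
      using tangent_expansion[OF pi_fieldD(1)[OF Z] c] True by simp
    also have "\<dots> = ?r u"
      using True by (simp add: tscale_sum sum_fun_apply frame_field_def mult.commute mult.left_commute)
    finally show ?thesis .
  next
    case False
    then show ?thesis
      using cutoff_outside[OF \<phi>, of "fst u"] pi_fieldD(2)[OF Z, of u] by (auto simp: sum_fun_apply frame_field_def)
  qed
qed

text \<open>Linearity over smooth functions, evaluated at the single point \<open>u\<close>, makes
  \<open>\<Phi> Z\<close> depend on \<open>Z u\<close> only: apply \<open>\<Phi>\<close> to
  \<open>frame_expansion\<close> and divide by \<open>\<phi>\<^sup>2\<close>. The values lie in an
  arbitrary vector space, since \<open>\<Phi>\<close> will be a chart component of \<open>R\<close>
  as well as the Ricci curvature.\<close>

lemma tensorial_expansion: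
  fixes \<Phi> :: "('p, 'e) pifield \<Rightarrow> 'v::real_vector"
  assumes add: "\<And>X Y. pi_field A X \<Longrightarrow> pi_field A Y \<Longrightarrow> \<Phi> (X + Y) = \<Phi> X + \<Phi> Y"
    and scale: "\<And>f X. smooth_fun SA f \<Longrightarrow> pi_field A X \<Longrightarrow> \<Phi> (fscale f X) = f u *\<^sub>R \<Phi> X"
    and \<phi>: "cutoff c \<phi>" "\<phi> (fst u) \<noteq> 0" and Z: "pi_field A Z"
  shows "\<Phi> Z = (\<Sum>b\<in>Basis. ((Z u c \<bullet> b) / \<phi> (fst u)) *\<^sub>R \<Phi> (frame_field c \<phi> b))"
proof -
  let ?s = "\<phi> (fst u)"
  have "\<Phi> (fscale (\<lambda>w. 0) 0) = 0 *\<^sub>R \<Phi> 0" by (rule scale[OF slit.smooth_fun_const pi_field_zero])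
  moreover have "fscale (\<lambda>w. 0) (0 :: ('p, 'e) pifield) = 0" by (auto simp: fun_eq_iff)
  ultimately have z: "\<Phi> 0 = 0" by simp
  have sum: "\<Phi> (\<Sum>i\<in>I. X i) = (\<Sum>i\<in>I. \<Phi> (X i))" if "\<And>i. i \<in> I \<Longrightarrow> pi_field A (X i)" for I :: "'e set" and X
    using that by (induction I rule: infinite_finite_induct) (simp_all add: z add pi_field_sum)
  have "(?s * ?s) *\<^sub>R \<Phi> Z = \<Phi> (fscale (\<lambda>u. \<phi> (fst u) * \<phi> (fst u)) Z)"
    using scale[OF slit.smooth_fun_mult Z] smooth_fun_fst[OF cutoff_smooth[OF \<phi>(1)]] by simp
  also have "\<dots> = \<Phi> (\<Sum>b\<in>Basis. fscale (\<lambda>u. \<phi> (fst u) * (Z u c \<bullet> b)) (frame_field c \<phi> b))"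
    by (simp only: frame_expansion[OF \<phi>(1) Z])
  also have "\<dots> = (\<Sum>b\<in>Basis. \<Phi> (fscale (\<lambda>u. \<phi> (fst u) * (Z u c \<bullet> b)) (frame_field c \<phi> b)))"
    by (intro sum pi_field_fscale smooth_cutoff_component pi_field_frame \<phi> Z)
  also have "\<dots> = (\<Sum>b\<in>Basis. (?s * (Z u c \<bullet> b)) *\<^sub>R \<Phi> (frame_field c \<phi> b))"
    by (intro sum.cong refl scale smooth_cutoff_component pi_field_frame \<phi> Z)
  also have "\<dots> = (?s * ?s) *\<^sub>R (\<Sum>b\<in>Basis. ((Z u c \<bullet> b) / ?s) *\<^sub>R \<Phi> (frame_field c \<phi> b))"
    using \<phi>(2) by (simp add: scaleR_sum_right)
  finally show ?thesis using \<phi>(2) by simp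
qed

text \<open>In the induced charts the bundle projection is \<open>fst\<close>, and hence so is its
  derivative, whichever chart \<open>tangent_map\<close> picks.\<close>

lemma rho_at_chart:
  assumes u: "u \<in> SB" and X: "X \<in> tangent_space SA u" and d: "d \<in> charts_at A (fst u)"
  shows "rho_at A u X d = fst (X (sc d))"
proof -
  let ?c = "some_chart SA u"
  have c: "?c \<in> charts_at SA u" using slit.some_chart_in slit_carrier u by blast
  then obtain c where cc: "c \<in> charts_at A (fst u)" "?c = sc c" using slit_charts_at[OF u] by auto
  have cA: "c \<in> A" "d \<in> A" using cc d charts_atD by auto
  have dd: "sc d \<in> charts_at SA u" by (rule slit_charts_atI[OF u d])
  let ?f = "\<lambda>w. snd d (fst w)"
  have m: "snd (sc d) u \<in> chart_image (sc d)" by (rule slit.charts_at_image[OF dd])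
  have "((?f \<circ> chart_inv (sc d)) has_derivative fst) (at (snd (sc d) u))"
    by (rule has_derivative_transform_within_open[OF bounded_linear_imp_has_derivative[OF bounded_linear_fst] open_slit_chart_image[OF cA(2)] m])
      (simp add: slit_chart_inv_in(6)[OF cA(2)])
  then have D: "fderiv (?f \<circ> chart_inv (sc d)) (snd (sc d) u) = fst"
    "(?f \<circ> chart_inv (sc d)) differentiable (at (snd (sc d) u))"
    using fderiv_eq differentiable_def by blast+
  have "rho_at A u X d = fderiv (snd d \<circ> fst \<circ> chart_inv ?c) (snd ?c u) (X ?c)"
    using d by (simp add: rho_at_def tangent_map_def Let_def)
  also have "snd d \<circ> fst \<circ> chart_inv ?c = ?f \<circ> chart_inv ?c" by auto
  also have "fderiv (?f \<circ> chart_inv ?c) (snd ?c u) (X ?c) = fst (slit.jac u ?c (sc d) (X ?c))"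
    using fderiv_eq[OF slit.fderiv_change_chart[OF c dd D(2)]] D(1) by simp
  also have "slit.jac u ?c (sc d) (X ?c) = X (sc d)" using slit.tangent_jac[OF X c dd] by simp
  finally show ?thesis .
qed

text \<open>The first component of a slit transition map is the base transition map after
  \<open>fst\<close>. Differentiating it in both forms shows that the first components of slit
  tangent vectors transform like tangent vectors of the base.\<close>

lemma rho_at_tangent:
  assumes u: "u \<in> SB" and X: "X \<in> tangent_space SA u"
  shows "rho_at A u X \<in> tangent_space A (fst u)"
proof (rule tangent_spaceI)
  fix c d assume c: "c \<in> charts_at A (fst u)" and d: "d \<in> charts_at A (fst u)"
  have cA: "c \<in> A" "d \<in> A" using c d charts_atD by auto
  have m: "snd (sc c) u \<in> snd (sc c) ` (fst (sc c) \<inter> fst (sc d))"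
    by (rule slit.charts_at_overlap[OF slit_charts_atI[OF u c] slit_charts_atI[OF u d]])
  have fd: "(snd (sc d) \<circ> chart_inv (sc c)) differentiable (at (snd (sc c) u))"
    by (rule slit.transition_differentiable[OF slit_charts_atI[OF u c] slit_charts_atI[OF u d]])
  have "((\<lambda>z. fst ((snd (sc d) \<circ> chart_inv (sc c)) z)) has_derivative (\<lambda>v. fst (slit.jac u (sc c) (sc d) v))) (at (snd (sc c) u))"
    by (rule has_derivative_fst[OF has_fderiv[OF fd]])
  moreover have "((\<lambda>z. fst ((snd (sc d) \<circ> chart_inv (sc c)) z)) has_derivative (\<lambda>v. jac (fst u) c d (fst v))) (at (snd (sc c) u))"
  proof (rule has_derivative_transform_within_open[OF _ slit.open_overlap[OF slit_chart_in[OF cA(1)] slit_chart_in[OF cA(2)]] m])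
    show "((\<lambda>z. (snd d \<circ> chart_inv c) (fst z)) has_derivative (\<lambda>v. jac (fst u) c d (fst v))) (at (snd (sc c) u))"
      by (rule has_derivative_compose[OF bounded_linear_imp_has_derivative[OF bounded_linear_fst]])
        (use has_fderiv[OF transition_differentiable[OF c d]] in \<open>simp add: o_def\<close>)
    fix z assume "z \<in> snd (sc c) ` (fst (sc c) \<inter> fst (sc d))"
    then have "fst z \<in> snd c ` (fst c \<inter> fst d)" "snd z \<noteq> 0"
      unfolding slit_overlap[OF cA(1)] by auto
    from slit_transition[OF cA this]
    show "(snd d \<circ> chart_inv c) (fst z) = fst ((snd (sc d) \<circ> chart_inv (sc c)) z)" by simp
  qed
  ultimately have "(\<lambda>v. fst (slit.jac u (sc c) (sc d) v)) = (\<lambda>v. jac (fst u) c d (fst v))"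
    by (rule has_derivative_unique)
  from fun_cong[OF this] have "fst (slit.jac u (sc c) (sc d) v) = jac (fst u) c d (fst v)" for v .
  then show "rho_at A u X d = jac (fst u) c d (rho_at A u X c)"
    using slit.tangent_jac[OF X slit_charts_atI[OF u c] slit_charts_atI[OF u d]]
    by (simp only: rho_at_chart[OF u X c] rho_at_chart[OF u X d])
qed (simp add: rho_at_def tangent_map_def)

lemma rho_at_add:
  assumes u: "u \<in> SB" and X: "X \<in> tangent_space SA u" "Y \<in> tangent_space SA u"
  shows "rho_at A u (X + Y) = rho_at A u X + rho_at A u Y"
proof -
  obtain c where c: "c \<in> charts_at A (fst u)" using slit_ex_chart[OF u] by blast
  show ?thesis
    by (rule tangent_eqI[OF _ _ c])
      (simp_all add: rho_at_tangent tangent_add slit.tangent_add rho_at_chart c u X)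
qed

lemma rho_at_scale:
  assumes u: "u \<in> SB" and X: "X \<in> tangent_space SA u"
  shows "rho_at A u (s \<odot> X) = s \<odot> rho_at A u X"
proof -
  obtain c where c: "c \<in> charts_at A (fst u)" using slit_ex_chart[OF u] by blast
  show ?thesis
    by (rule tangent_eqI[OF _ _ c])
      (simp_all add: rho_at_tangent tangent_scale slit.tangent_scale rho_at_chart c u X)
qed

end

section \<open>Regular connections and the horizontal map\<close>

lemma real_vec_expansion: "(x :: real^'n) = (\<Sum>i\<in>UNIV. x $ i *\<^sub>R axis i 1)"
  by (simp add: vec_eq_iff axis_def if_distrib cong: if_cong)

lemma smooth_on_vec:
  fixes f :: "'a::real_normed_vector \<Rightarrow> real^'n"
  assumes "open S" "\<And>i. smooth_on S (\<lambda>x. f x $ i)"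
  shows "smooth_on S f"
proof -
  have "smooth_on S (\<lambda>x. \<Sum>i\<in>UNIV. f x $ i *\<^sub>R axis i (1::real))"
    by (intro smooth_on_sum smooth_on_scaleR smooth_on_const assms)
  then show ?thesis by (simp only: real_vec_expansion[symmetric])
qed

locale pullback_connection = pullback A for A :: "('p, real^'n) chart set" +
  fixes D :: "('p, real^'n) picon"
  assumes regular: "regular_connection A D"
begin

section \<open>Pointwise rules for the connection\<close>

lemma linear_D: "linear_connection A D"
  using regular by (simp add: regular_connection_def)

lemma D_tangent:
  "u \<in> SB \<Longrightarrow> X \<in> tangent_space SA u \<Longrightarrow> pi_field A Z \<Longrightarrow> D u X Z \<in> tangent_space A (fst u)"
  using linear_D unfolding linear_connection_def by simp

lemma D_add_direction:
  "u \<in> SB \<Longrightarrow> X \<in> tangent_space SA u \<Longrightarrow> Y \<in> tangent_space SA u \<Longrightarrow> pi_field A Z \<Longrightarrow>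
    D u (X + Y) Z = D u X Z + D u Y Z"
  using linear_D unfolding linear_connection_def by blast

lemma D_scale_direction:
  "u \<in> SB \<Longrightarrow> X \<in> tangent_space SA u \<Longrightarrow> pi_field A Z \<Longrightarrow> D u (s \<odot> X) Z = s \<odot> D u X Z"
  using linear_D unfolding linear_connection_def by blast

lemma D_add:
  "u \<in> SB \<Longrightarrow> X \<in> tangent_space SA u \<Longrightarrow> pi_field A Z \<Longrightarrow> pi_field A W \<Longrightarrow>
    D u X (Z + W) = D u X Z + D u X W"
  using linear_D unfolding linear_connection_def by blast

lemma D_fscale:
  "u \<in> SB \<Longrightarrow> X \<in> tangent_space SA u \<Longrightarrow> smooth_fun SA f \<Longrightarrow> pi_field A Z \<Longrightarrow>
    D u X (fscale f Z) = dir_deriv SA u X f \<odot> Z u + f u \<odot> D u X Z"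
  using linear_D unfolding linear_connection_def by blast

lemma pi_field_cov: "vector_field SA X \<Longrightarrow> pi_field A Z \<Longrightarrow> pi_field A (cov A D X Z)"
  using linear_D unfolding linear_connection_def by blast

lemma D_zero_direction:
  assumes "u \<in> SB" "pi_field A Z" shows "D u 0 Z = 0"
  using D_scale_direction[OF assms(1) slit.tangent_zero assms(2), of 0] by simp

lemma D_sum_direction:
  assumes u: "u \<in> SB" and Z: "pi_field A Z" and X: "\<And>i. i \<in> I \<Longrightarrow> X i \<in> tangent_space SA u"
  shows "D u (\<Sum>i\<in>I. X i) Z = (\<Sum>i\<in>I. D u (X i) Z)"
  using X
proof (induction I rule: infinite_finite_induct)
  case (insert i I)
  have "X i \<in> tangent_space SA u" "sum X I \<in> tangent_space SA u"
    using insert by (auto intro: slit.tangent_sum)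
  from D_add_direction[OF u this Z] insert show ?case by (simp only: sum.insert insert_iff simp_thms)
qed (simp_all add: D_zero_direction[OF u Z])

section \<open>Horizontal vectors and horizontal lifts\<close>

lemma horizontal_tangent: "X \<in> horizontal_space A D u \<Longrightarrow> X \<in> tangent_space SA u"
  by (simp add: horizontal_space_def)

lemma horizontal_add:
  "u \<in> SB \<Longrightarrow> X \<in> horizontal_space A D u \<Longrightarrow> Y \<in> horizontal_space A D u \<Longrightarrow> X + Y \<in> horizontal_space A D u"
  by (simp add: horizontal_space_def D_add_direction pi_field_fundamental slit.tangent_add)

lemma horizontal_scale:
  "u \<in> SB \<Longrightarrow> X \<in> horizontal_space A D u \<Longrightarrow> s \<odot> X \<in> horizontal_space A D u"
  by (simp add: horizontal_space_def D_scale_direction pi_field_fundamental slit.tangent_scale)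

lemma horizontal_vertical:
  "u \<in> SB \<Longrightarrow> X \<in> horizontal_space A D u \<Longrightarrow> rho_at A u X = 0 \<Longrightarrow> X = 0"
  using regular unfolding regular_connection_def vertical_space_def horizontal_space_def by blast

lemma horizontal_unique:
  assumes u: "u \<in> SB" and X: "X \<in> horizontal_space A D u" and Y: "Y \<in> horizontal_space A D u"
    and e: "rho_at A u X = rho_at A u Y"
  shows "X = Y"
proof -
  have "rho_at A u (X + (-1) \<odot> Y) = 0"
    using e by (simp add: rho_at_add rho_at_scale u horizontal_tangent X Y slit.tangent_scale fun_eq_iff)
  then have "X + (-1) \<odot> Y = 0"
    by (intro horizontal_vertical[OF u] horizontal_add horizontal_scale u X Y)
  then show ?thesis by (simp add: fun_eq_iff)
qed

text \<open>Take any lift, here the one with fibre component 0 in a chart, and keep its horizontal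
  part: the vertical part that is discarded has image 0 under \<open>rho_at\<close>.\<close>

lemma horizontal_lift_exists:
  assumes u: "u \<in> SB" and a: "a \<in> tangent_space A (fst u)"
  shows "\<exists>X\<in>horizontal_space A D u. rho_at A u X = a"
proof -
  obtain c where c: "c \<in> charts_at A (fst u)" using slit_ex_chart[OF u] by blast
  note cc = slit_charts_atI[OF u c]
  let ?X = "coord_vec SA (sc c) u (a c, 0)"
  have X: "?X \<in> tangent_space SA u" by (rule slit.coord_vec_tangent[OF cc])
  have r: "rho_at A u ?X = a"
    by (rule tangent_eqI[OF rho_at_tangent[OF u X] a c])
      (simp add: rho_at_chart[OF u X c] slit.coord_vec_chart[OF cc])
  obtain V H where VH: "V \<in> vertical_space A u" "H \<in> horizontal_space A D u" "?X = V + H"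
    using regular u X unfolding regular_connection_def by blast
  then have "rho_at A u H = a"
    using r rho_at_add[OF u, of V H] horizontal_tangent[of H u] by (simp add: vertical_space_def)
  with VH(2) show ?thesis by blast
qed

text \<open>The \<open>inv_into\<close> in \<open>beta\<close> returns a genuine preimage because
  the horizontal space maps onto the fibre.\<close>

lemma beta_at:
  assumes u: "u \<in> SB" and a: "Z u \<in> tangent_space A (fst u)"
  shows "beta A D Z u \<in> horizontal_space A D u" "rho_at A u (beta A D Z u) = Z u"
proof -
  have "Z u \<in> rho_at A u ` horizontal_space A D u" using horizontal_lift_exists[OF assms] by (metis imageI)
  then show "beta A D Z u \<in> horizontal_space A D u" "rho_at A u (beta A D Z u) = Z u"
    using u by (simp_all add: beta_def inv_into_into f_inv_into_f)
qed

lemma beta_outside: "u \<notin> SB \<Longrightarrow> beta A D Z u = 0"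
  by (simp add: beta_def)

lemma beta_eqI:
  assumes "u \<in> SB" "Z u \<in> tangent_space A (fst u)" "X \<in> horizontal_space A D u" "rho_at A u X = Z u"
  shows "beta A D Z u = X"
  by (rule horizontal_unique[OF assms(1) beta_at(1)[of u Z, OF assms(1,2)] assms(3)])
    (simp add: beta_at(2)[of u Z, OF assms(1,2)] assms)

lemma beta_add:
  assumes X: "pi_field A X" and Y: "pi_field A Y"
  shows "beta A D (X + Y) = beta A D X + beta A D Y"
proof
  fix u show "beta A D (X + Y) u = (beta A D X + beta A D Y) u"
  proof (cases "u \<in> SB")
    case u: True
    note x = beta_at[of u X, OF u pi_fieldD(1)[OF X u]] and y = beta_at[of u Y, OF u pi_fieldD(1)[OF Y u]]
    show ?thesis
      by (rule beta_eqI[OF u])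
        (simp_all add: x y u horizontal_add rho_at_add horizontal_tangent pi_fieldD(1)[OF X] pi_fieldD(1)[OF Y] tangent_add)
  qed (simp add: beta_outside)
qed

lemma beta_fscale:
  assumes X: "pi_field A X"
  shows "beta A D (fscale f X) = fscale f (beta A D X)"
proof
  fix u show "beta A D (fscale f X) u = fscale f (beta A D X) u"
  proof (cases "u \<in> SB")
    case u: True
    note x = beta_at[of u X, OF u pi_fieldD(1)[OF X u]]
    show ?thesis
      by (rule beta_eqI[OF u])
        (simp_all add: x u horizontal_scale rho_at_scale horizontal_tangent pi_fieldD(1)[OF X] tangent_scale)
  qed (simp add: beta_outside)
qed

text \<open>In a chart, with \<open>(z, w)\<close> the components of a horizontal vector, the equation
  \<open>D u X \<eta> = 0\<close> is a linear system for \<open>w\<close> whose matrix is invertible by regularity.\<close>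

lemma smooth_beta_component:
  assumes Z: "pi_field A Z" and c: "c \<in> A"
  shows "smooth_on (chart_image (sc c)) (\<lambda>z. beta A D Z (chart_inv (sc c) z) (sc c))"
proof (rule smooth_on_local)
  fix z0 assume z0: "z0 \<in> chart_image (sc c)"
  have "chart_inv c (fst z0) \<in> fst c"
    using slit_chart_inv_in[OF c z0] by (simp add: charts_at_def)
  then obtain \<phi> where \<phi>: "cutoff c \<phi>" and \<phi>0: "\<phi> (chart_inv c (fst z0)) \<noteq> 0" using cutoffs[OF c] by blast
  note SC = slit_chart_in[OF c]
  let ?\<phi> = "\<lambda>u. if u \<in> SB then \<phi> (fst u) else 0"
  note s\<phi> = slit_cutoff[OF \<phi>]
  define V where "V e = (\<lambda>u. ?\<phi> u \<odot> coord_vec SA (sc c) u e)" for e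
  have V: "vector_field SA (V e)" for e unfolding V_def by (rule slit.vector_field_cutoff[OF s\<phi>])
  let ?\<eta> = "fundamental_field A"
  \<comment> \<open>Up to the factor \<open>?\<phi>\<close>, the component of the derivative of
    \<open>?\<eta>\<close> in the coordinate direction \<open>e\<close>. It is smooth since
    \<open>linear_connection\<close> turns the global field \<open>V e\<close> into a
    section.\<close>
  define k where "k e = (\<lambda>z. cov A D (V e) ?\<eta> (chart_inv (sc c) z) c)" for e
  have k: "smooth_on (chart_image (sc c)) (k e)" for e
    unfolding k_def by (rule pi_fieldD(3)[OF pi_field_cov[OF V pi_field_fundamental] c])
  define U where "U = {z \<in> chart_image (sc c). ?\<phi> (chart_inv (sc c) z) \<noteq> 0}"
  have oU: "open U" unfolding U_def by (rule slit.open_cutoff_support[OF slit.cutoff_smooth[OF s\<phi>] SC])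
  have UI: "U \<subseteq> chart_image (sc c)" by (auto simp: U_def)
  have z0U: "z0 \<in> U" using z0 \<phi>0 slit_chart_inv_in[OF c z0] by (simp add: U_def)
  note kU = smooth_on_subset[OF k UI]
  define B where "B z = (\<chi> i j. k (0, axis j 1) z $ i)" for z
  define b where "b z = - (\<Sum>i\<in>UNIV. Z (chart_inv (sc c) z) c $ i *\<^sub>R k (axis i 1, 0) z)" for z
  have comp: "smooth_on U (\<lambda>z. f z $ i)" if "smooth_on U f" for f :: "(real^'n) \<times> (real^'n) \<Rightarrow> real^'n" and i
    using smooth_on_inner[OF oU that smooth_on_const[of U "axis i 1"]] by (simp add: inner_axis)
  have sB: "smooth_on U (\<lambda>z. B z $ i $ j)" for i j unfolding B_def by (simp add: comp[OF kU])
  have sZ: "smooth_on U (\<lambda>z. Z (chart_inv (sc c) z) c)" by (rule smooth_on_subset[OF pi_fieldD(3)[OF Z c] UI])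
  have sb: "smooth_on U b"
    unfolding b_def by (intro smooth_on_minus smooth_on_sum smooth_on_scaleR comp oU sZ kU)
  have key: "(D u X ?\<eta> = 0) = (B z *v snd (X (sc c)) + (\<Sum>i\<in>UNIV. fst (X (sc c)) $ i *\<^sub>R k (axis i 1, 0) z) = 0)"
    if z: "z \<in> U" and u: "u = chart_inv (sc c) z" and X: "X \<in> tangent_space SA u" for z u X
  proof -
    have zi: "z \<in> chart_image (sc c)" and p0: "?\<phi> u \<noteq> 0" using z unfolding U_def u by blast+
    have uS: "u \<in> SB" and cu: "c \<in> charts_at A (fst u)" using slit_chart_inv_in(1,2)[OF c zi] by (simp_all add: u)
    note cc = slit_charts_atI[OF uS cu]
    obtain x w where xw: "X (sc c) = (x, w)" by (cases "X (sc c)")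
    have cT: "coord_vec SA (sc c) u e \<in> tangent_space SA u" for e by (rule slit.coord_vec_tangent[OF cc])
    have VT: "V e u \<in> tangent_space SA u" for e
      unfolding V_def by (rule slit.tangent_scale[OF cT])
    have "(x, w) = (\<Sum>i\<in>UNIV. x $ i *\<^sub>R (axis i 1, 0)) + (\<Sum>i\<in>UNIV. w $ i *\<^sub>R (0, axis i 1))"
      using real_vec_expansion[of x] real_vec_expansion[of w]
      by (simp add: prod_eq_iff fst_sum snd_sum)
    then have "X = coord_vec SA (sc c) u ((\<Sum>i\<in>UNIV. x $ i *\<^sub>R (axis i 1, 0)) + (\<Sum>i\<in>UNIV. w $ i *\<^sub>R (0, axis i 1)))"
      using slit.coord_vec_component[OF X cc] xw by simp
    then have "?\<phi> u \<odot> X = (\<Sum>i\<in>UNIV. x $ i \<odot> V (axis i 1, 0) u) + (\<Sum>i\<in>UNIV. w $ i \<odot> V (0, axis i 1) u)"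
      by (simp add: slit.coord_vec_add[OF cc] slit.coord_vec_sum[OF cc] slit.coord_vec_scale[OF cc] V_def
          tscale_distribs tscale_sum mult.commute del: scaleR_Pair)
    then have "?\<phi> u \<odot> D u X ?\<eta> = D u ((\<Sum>i\<in>UNIV. x $ i \<odot> V (axis i 1, 0) u) + (\<Sum>i\<in>UNIV. w $ i \<odot> V (0, axis i 1) u)) ?\<eta>"
      using D_scale_direction[OF uS X pi_field_fundamental, of "?\<phi> u"] by simp
    also have "\<dots> = (\<Sum>i\<in>UNIV. x $ i \<odot> D u (V (axis i 1, 0) u) ?\<eta>) + (\<Sum>i\<in>UNIV. w $ i \<odot> D u (V (0, axis i 1) u) ?\<eta>)"
      by (simp add: D_add_direction D_sum_direction D_scale_direction uS VT pi_field_fundamental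
          slit.tangent_sum slit.tangent_scale)
    finally have e: "(?\<phi> u \<odot> D u X ?\<eta>) c = (\<Sum>i\<in>UNIV. x $ i *\<^sub>R k (axis i 1, 0) z) + (\<Sum>i\<in>UNIV. w $ i *\<^sub>R k (0, axis i 1) z)"
      using uS u by (simp add: k_def cov_def sum_fun_apply)
    have DT: "D u X ?\<eta> \<in> tangent_space A (fst u)" by (rule D_tangent[OF uS X pi_field_fundamental])
    have "(D u X ?\<eta> = 0) = (D u X ?\<eta> c = 0)" using tangent_eqI[OF DT tangent_zero cu] by auto
    also have "\<dots> = ((?\<phi> u \<odot> D u X ?\<eta>) c = 0)" using p0 by simp
    finally have 1: "(D u X ?\<eta> = 0) = ((\<Sum>i\<in>UNIV. x $ i *\<^sub>R k (axis i 1, 0) z) + (\<Sum>i\<in>UNIV. w $ i *\<^sub>R k (0, axis i 1) z) = 0)"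
      unfolding e .
    have 2: "(\<Sum>i\<in>UNIV. w $ i *\<^sub>R k (0, axis i 1) z) = B z *v w"
      by (simp add: vec_eq_iff B_def matrix_vector_mult_def mult.commute)
    show ?thesis unfolding 1 2 xw by (simp add: add.commute)
  qed
  \<comment> \<open>A kernel vector \<open>w\<close> of \<open>B z\<close> yields a tangent vector
    with components \<open>(0, w)\<close> that is vertical and horizontal at once.\<close>
  have detB: "det (B z) \<noteq> 0" if z: "z \<in> U" for z
  proof
    assume "det (B z) = 0"
    then have "\<not> inj ((*v) (B z))" using invertible_det_nz
      by (metis invertible_left_inverse matrix_left_invertible_injective)
    then obtain w where w: "B z *v w = 0" "w \<noteq> 0"
      using vec.inj_iff_eq_0[of "B z"] by (auto simp: matrix_left_invertible_injective)
    define u where "u = chart_inv (sc c) z"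
    have zi: "z \<in> chart_image (sc c)" using z by (auto simp: U_def)
    have uS: "u \<in> SB" and cu: "c \<in> charts_at A (fst u)" using slit_chart_inv_in(1,2)[OF c zi] by (simp_all add: u_def)
    note cc = slit_charts_atI[OF uS cu]
    let ?X = "coord_vec SA (sc c) u (0, w)"
    have X: "?X \<in> tangent_space SA u" by (rule slit.coord_vec_tangent[OF cc])
    have "D u ?X ?\<eta> = 0" unfolding key[OF z u_def X] by (simp add: slit.coord_vec_chart[OF cc] w)
    then have "?X \<in> horizontal_space A D u" using X by (simp add: horizontal_space_def)
    moreover have "rho_at A u ?X = 0"
      by (rule tangent_eqI[OF rho_at_tangent[OF uS X] tangent_zero cu])
        (simp add: rho_at_chart[OF uS X cu] slit.coord_vec_chart[OF cc])
    ultimately have "?X = 0" by (rule horizontal_vertical[OF uS])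
    then have "?X (sc c) = 0" by simp
    then show False using w(2) by (simp add: slit.coord_vec_chart[OF cc] zero_prod_def)
  qed
  \<comment> \<open>Cramer's rule: the fibre components of the lift as quotients of smooth
    determinants.\<close>
  let ?w = "\<lambda>z. \<chi> m. det (\<chi> i j. if j = m then b z $ i else B z $ i $ j) / det (B z)"
  have sif: "smooth_on U (\<lambda>z. if j = m then b z $ i else B z $ i $ j)" for i j m
    by (cases "j = m") (simp_all add: sB comp[OF sb])
  have "smooth_on U (\<lambda>z. det (\<chi> i j. if j = m then b z $ i else B z $ i $ j) / det (B z))" for m
    by (intro smooth_on_divide smooth_on_det oU sB detB) (simp_all add: sB sif)
  then have sw: "smooth_on U ?w" by (intro smooth_on_vec oU) simp
  have "smooth_on U (\<lambda>z. (Z (chart_inv (sc c) z) c, ?w z))" by (rule smooth_on_Pair[OF oU sZ sw])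
  then have "smooth_on U (\<lambda>z. beta A D Z (chart_inv (sc c) z) (sc c))"
  proof (rule smooth_on_cong[OF oU, rotated])
    fix z assume z: "z \<in> U"
    define u where "u = chart_inv (sc c) z"
    have zi: "z \<in> chart_image (sc c)" using z by (auto simp: U_def)
    have uS: "u \<in> SB" and cu: "c \<in> charts_at A (fst u)" using slit_chart_inv_in(1,2)[OF c zi] by (simp_all add: u_def)
    note h = beta_at[of u Z, OF uS pi_fieldD(1)[OF Z uS]]
    have f: "fst (beta A D Z u (sc c)) = Z u c"
      using rho_at_chart[OF uS horizontal_tangent[OF h(1)] cu] h(2) by simp
    have "D u (beta A D Z u) ?\<eta> = 0" using h(1) by (simp add: horizontal_space_def)
    from this[unfolded key[OF z u_def horizontal_tangent[OF h(1)]] f]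
    have "B z *v snd (beta A D Z u (sc c)) = b z"
      unfolding b_def u_def by (simp add: eq_neg_iff_add_eq_0)
    then have "snd (beta A D Z u (sc c)) = ?w z"
      using cramer[OF detB[OF z]] by blast
    with f show "(Z (chart_inv (sc c) z) c, ?w z) = beta A D Z (chart_inv (sc c) z) (sc c)"
      unfolding u_def by (simp add: prod_eq_iff)
  qed
  with oU z0U show "\<exists>T. open T \<and> z0 \<in> T \<and> smooth_on T (\<lambda>z. beta A D Z (chart_inv (sc c) z) (sc c))" by blast
qed

lemma vector_field_beta:
  assumes Z: "pi_field A Z" shows "vector_field SA (beta A D Z)"
  by (rule slit_vector_fieldI)
    (simp_all add: smooth_beta_component[OF Z] beta_outside horizontal_tangent[OF beta_at(1)] pi_fieldD(1)[OF Z])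

end

context pullback_connection
begin

section \<open>Curvature\<close>

lemma cov_at: "u \<in> SB \<Longrightarrow> cov A D X Z u = D u (X u) Z" "u \<notin> SB \<Longrightarrow> cov A D X Z u = 0"
  by (simp_all add: cov_def)

lemma vf_tangent: "vector_field SA X \<Longrightarrow> u \<in> SB \<Longrightarrow> X u \<in> tangent_space SA u"
  using slit.vector_fieldD(1) slit_carrier by blast

abbreviation lie_derivative :: "('p, real^'n) ttfield \<Rightarrow> (('p, real^'n) tpoint \<Rightarrow> real) \<Rightarrow> ('p, real^'n) tpoint \<Rightarrow> real" where
  "lie_derivative X f \<equiv> (\<lambda>u. dir_deriv SA u (X u) f)"

section \<open>Leibniz rules for covariant derivatives along fields\<close>

lemma cov_add:
  assumes X: "vector_field SA X" and Z: "pi_field A Z" and W: "pi_field A W"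
  shows "cov A D X (Z + W) = cov A D X Z + cov A D X W"
proof
  fix u show "cov A D X (Z + W) u = (cov A D X Z + cov A D X W) u"
    using D_add[OF _ vf_tangent[OF X] Z W, of u] by (cases "u \<in> SB") (simp_all only: cov_at plus_fun_apply add_0 simp_thms)
qed

lemma cov_add_direction:
  assumes X: "vector_field SA X" and Y: "vector_field SA Y" and Z: "pi_field A Z"
  shows "cov A D (X + Y) Z = cov A D X Z + cov A D Y Z"
proof
  fix u show "cov A D (X + Y) Z u = (cov A D X Z + cov A D Y Z) u"
    using D_add_direction[OF _ vf_tangent[OF X] vf_tangent[OF Y] Z, of u]
    by (cases "u \<in> SB") (simp_all only: cov_at plus_fun_apply add_0 simp_thms)
qed

lemma cov_fscale_direction:
  assumes X: "vector_field SA X" and Z: "pi_field A Z"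
  shows "cov A D (fscale f X) Z = fscale f (cov A D X Z)"
proof
  fix u show "cov A D (fscale f X) Z u = fscale f (cov A D X Z) u"
    using D_scale_direction[OF _ vf_tangent[OF X] Z, of u]
    by (cases "u \<in> SB") (simp_all only: cov_at fscale_apply tscale_simps simp_thms)
qed

lemma cov_fscale:
  assumes X: "vector_field SA X" and f: "smooth_fun SA f" and Z: "pi_field A Z"
  shows "cov A D X (fscale f Z) = fscale (lie_derivative X f) Z + fscale f (cov A D X Z)"
proof
  fix u show "cov A D X (fscale f Z) u = (fscale (lie_derivative X f) Z + fscale f (cov A D X Z)) u"
    using D_fscale[OF _ vf_tangent[OF X] f Z, of u] pi_fieldD(2)[OF Z, of u]
    by (cases "u \<in> SB") (simp_all only: cov_at plus_fun_apply fscale_apply tscale_simps add_0 simp_thms)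
qed

lemma cov_minus_direction:
  assumes X: "vector_field SA X" and Z: "pi_field A Z"
  shows "cov A D (- X) Z = - cov A D X Z"
  using cov_fscale_direction[OF X Z, of "\<lambda>u. -1"] by (simp add: fscale_minus_one)

lemma cov_zero: assumes X: "vector_field SA X" shows "cov A D X 0 = 0"
  using cov_add[OF X pi_field_zero pi_field_zero] by simp

lemma cov_minus:
  assumes X: "vector_field SA X" and Z: "pi_field A Z"
  shows "cov A D X (- Z) = - cov A D X Z"
proof -
  have "cov A D X Z + cov A D X (- Z) = 0"
    using cov_add[OF X Z pi_field_minus[OF Z]] cov_zero[OF X] by simp
  then show ?thesis by (simp add: add_eq_0_iff)
qed

lemma cov_diff:
  assumes X: "vector_field SA X" and Z: "pi_field A Z" and W: "pi_field A W"
  shows "cov A D X (Z - W) = cov A D X Z - cov A D X W"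
  using cov_add[OF X Z pi_field_minus[OF W]] cov_minus[OF X W] by simp

section \<open>Tensoriality of the curvature\<close>

abbreviation "curv \<equiv> classical_curvature A D"

lemma pi_field_curv:
  "vector_field SA X \<Longrightarrow> vector_field SA Y \<Longrightarrow> pi_field A Z \<Longrightarrow> pi_field A (curv X Y Z)"
  unfolding classical_curvature_def
  by (intro pi_field_add pi_field_minus pi_field_cov slit.vector_field_lie_bracket)

lemma curv_antisym:
  assumes X: "vector_field SA X" and Y: "vector_field SA Y" and Z: "pi_field A Z"
  shows "curv Y X Z = - curv X Y Z"
  unfolding classical_curvature_def slit.lie_bracket_antisym[of Y X]
    cov_minus_direction[OF slit.vector_field_lie_bracket[OF X Y] Z] by simp

lemma curv_add_left:
  assumes X: "vector_field SA X" and X': "vector_field SA X'" and Y: "vector_field SA Y" and Z: "pi_field A Z"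
  shows "curv (X + X') Y Z = curv X Y Z + curv X' Y Z"
  unfolding classical_curvature_def
  by (simp only: cov_add_direction X X' Y Z pi_field_cov cov_add slit.lie_bracket_add_left slit.vector_field_lie_bracket)
    (simp add: algebra_simps)

text \<open>The derivative of \<open>f\<close> along \<open>Y\<close> appears twice, from
  \<open>Y\<close> acting on \<open>f\<close> times the derivative of \<open>Z\<close> along
  \<open>X\<close> and from the bracket of \<open>fscale f X\<close> with \<open>Y\<close>, with
  opposite signs.\<close>

lemma curv_fscale_left:
  assumes f: "smooth_fun SA f" and X: "vector_field SA X" and Y: "vector_field SA Y" and Z: "pi_field A Z"
  shows "curv (fscale f X) Y Z = fscale f (curv X Y Z)"
proof -
  have b: "lie_bracket SA (fscale f X) Y = fscale f (lie_bracket SA X Y) + - fscale (lie_derivative Y f) X"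
    using slit.lie_bracket_fscale_left[OF f X Y] by simp
  note v = slit.vector_field_lie_bracket[OF X Y] slit.smooth_dir_deriv[OF f Y]
  show ?thesis
    unfolding classical_curvature_def b
    by (simp only: cov_fscale_direction cov_fscale cov_add_direction cov_minus_direction
        X Y Z f v pi_field_cov slit.vector_field_fscale slit.vector_field_minus)
      (simp add: fun_eq_iff algebra_simps)
qed

lemma curv_add_arg:
  assumes X: "vector_field SA X" and Y: "vector_field SA Y" and Z: "pi_field A Z" and W: "pi_field A W"
  shows "curv X Y (Z + W) = curv X Y Z + curv X Y W"
  unfolding classical_curvature_def
  by (simp only: cov_add X Y Z W pi_field_cov slit.vector_field_lie_bracket) (simp add: algebra_simps)

text \<open>The mixed first-order terms cancel in pairs. What remains is the commutator of the
  second derivatives of \<open>f\<close>, which the bracket term compensates by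
  \<open>slit.dir_deriv_lie_bracket\<close>.\<close>

lemma curv_fscale_arg:
  assumes f: "smooth_fun SA f" and X: "vector_field SA X" and Y: "vector_field SA Y" and Z: "pi_field A Z"
  shows "curv X Y (fscale f Z) = fscale f (curv X Y Z)"
proof
  fix u
  note v = slit.vector_field_lie_bracket[OF X Y] slit.smooth_dir_deriv[OF f Y] slit.smooth_dir_deriv[OF f X]
  have e: "curv X Y (fscale f Z) =
      - (fscale (lie_derivative X (lie_derivative Y f)) Z + fscale (lie_derivative Y f) (cov A D X Z)
          + (fscale (lie_derivative X f) (cov A D Y Z) + fscale f (cov A D X (cov A D Y Z))))
      + (fscale (lie_derivative Y (lie_derivative X f)) Z + fscale (lie_derivative X f) (cov A D Y Z)
          + (fscale (lie_derivative Y f) (cov A D X Z) + fscale f (cov A D Y (cov A D X Z))))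
      + (fscale (lie_derivative (lie_bracket SA X Y) f) Z + fscale f (cov A D (lie_bracket SA X Y) Z))"
    unfolding classical_curvature_def
    by (simp only: cov_fscale cov_add X Y Z f v pi_field_cov pi_field_fscale)
  show "curv X Y (fscale f Z) u = fscale f (curv X Y Z) u"
  proof (cases "u \<in> SB")
    case True
    have "dir_deriv SA u (lie_bracket SA X Y u) f =
        dir_deriv SA u (X u) (lie_derivative Y f) - dir_deriv SA u (Y u) (lie_derivative X f)"
      by (rule slit.dir_deriv_lie_bracket[OF f X Y]) (use True slit_carrier in simp)
    then have "fscale (lie_derivative (lie_bracket SA X Y) f) Z u =
        (lie_derivative X (lie_derivative Y f) u - lie_derivative Y (lie_derivative X f) u) \<odot> Z u" by simp
    then show ?thesis
      unfolding e plus_fun_apply by (simp only:) (simp add: classical_curvature_def fun_eq_iff algebra_simps)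
  next
    case False
    then show ?thesis
      using pi_fieldD(2)[OF pi_field_curv[OF X Y pi_field_fscale[OF f Z]]] pi_fieldD(2)[OF pi_field_curv[OF X Y Z]]
      by simp
  qed
qed

abbreviation "R \<equiv> h_curvature A D"

lemma pi_field_R: "pi_field A X \<Longrightarrow> pi_field A Y \<Longrightarrow> pi_field A Z \<Longrightarrow> pi_field A (R X Y Z)"
  unfolding h_curvature_def by (intro pi_field_curv vector_field_beta)

lemma R_antisym: "pi_field A X \<Longrightarrow> pi_field A Y \<Longrightarrow> pi_field A Z \<Longrightarrow> R Y X Z = - R X Y Z"
  unfolding h_curvature_def by (intro curv_antisym vector_field_beta)

lemma R_add_1:
  "pi_field A X \<Longrightarrow> pi_field A X' \<Longrightarrow> pi_field A Y \<Longrightarrow> pi_field A Z \<Longrightarrow> R (X + X') Y Z = R X Y Z + R X' Y Z"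
  unfolding h_curvature_def by (simp only: beta_add curv_add_left vector_field_beta)

lemma R_fscale_1:
  "smooth_fun SA f \<Longrightarrow> pi_field A X \<Longrightarrow> pi_field A Y \<Longrightarrow> pi_field A Z \<Longrightarrow> R (fscale f X) Y Z = fscale f (R X Y Z)"
  unfolding h_curvature_def by (simp only: beta_fscale curv_fscale_left vector_field_beta)

text \<open>Antisymmetry transfers linearity from the first argument.\<close>

lemma R_add_2:
  assumes "pi_field A X" "pi_field A Y" "pi_field A Y'" "pi_field A Z"
  shows "R X (Y + Y') Z = R X Y Z + R X Y' Z"
  using R_add_1[of Y Y' X Z] assms by (simp only: R_antisym[of _ X] pi_field_add) simp

lemma R_fscale_2:
  assumes "smooth_fun SA f" "pi_field A X" "pi_field A Y" "pi_field A Z"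
  shows "R X (fscale f Y) Z = fscale f (R X Y Z)"
  using R_fscale_1[of f Y X Z] assms by (simp only: R_antisym[of _ X] pi_field_fscale) (simp add: fun_eq_iff)

lemma R_add_3:
  "pi_field A X \<Longrightarrow> pi_field A Y \<Longrightarrow> pi_field A Z \<Longrightarrow> pi_field A Z' \<Longrightarrow> R X Y (Z + Z') = R X Y Z + R X Y Z'"
  unfolding h_curvature_def by (simp only: curv_add_arg vector_field_beta)

lemma R_fscale_3:
  "smooth_fun SA f \<Longrightarrow> pi_field A X \<Longrightarrow> pi_field A Y \<Longrightarrow> pi_field A Z \<Longrightarrow> R X Y (fscale f Z) = fscale f (R X Y Z)"
  unfolding h_curvature_def by (simp only: curv_fscale_arg vector_field_beta)

lemma sum_Basis_axis: "(\<Sum>b\<in>Basis. f (b :: real^'n)) = (\<Sum>i\<in>UNIV. f (axis i 1))"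
proof -
  have "(Basis :: (real^'n) set) = range (\<lambda>i. axis i 1)" by (auto simp: Basis_vec_def)
  moreover have "inj (\<lambda>i :: 'n. axis i (1::real))" by (simp add: inj_on_def axis_eq_axis)
  ultimately show ?thesis using sum.reindex[of "\<lambda>i. axis i 1" UNIV f] by (simp only: o_def)
qed

lemma matrix_vector_mult_axis: "(N *v axis j 1) $ i = N $ i $ j" for N :: "real^'n^'n"
  by (simp add: matrix_vector_mult_basis column_def)

lemma tensorial_expansion_axis:
  fixes \<Phi> :: "('p, real^'n) pifield \<Rightarrow> 'v::real_vector"
  assumes "\<And>X Y. pi_field A X \<Longrightarrow> pi_field A Y \<Longrightarrow> \<Phi> (X + Y) = \<Phi> X + \<Phi> Y"
    and "\<And>f X. smooth_fun SA f \<Longrightarrow> pi_field A X \<Longrightarrow> \<Phi> (fscale f X) = f u *\<^sub>R \<Phi> X"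
    and "cutoff c \<phi>" "\<phi> (fst u) \<noteq> 0" and "pi_field A Z"
  shows "\<Phi> Z = (\<Sum>i\<in>UNIV. ((Z u c $ i) / \<phi> (fst u)) *\<^sub>R \<Phi> (frame_field c \<phi> (axis i 1)))"
  using tensorial_expansion[OF assms] by (simp add: sum_Basis_axis inner_axis)

section \<open>Ricci and scalar curvature in a chart\<close>

definition jac_matrix :: "'p \<Rightarrow> ('p, real^'n) chart \<Rightarrow> ('p, real^'n) chart \<Rightarrow> real^'n^'n" where
  "jac_matrix p c d = matrix (jac p c d)"

lemma jac_matrix_mult:
  "c \<in> charts_at A p \<Longrightarrow> d \<in> charts_at A p \<Longrightarrow> jac_matrix p c d *v v = jac p c d v"
  unfolding jac_matrix_def by (simp add: fun_cong[OF matrix_vector_mul(2)[OF linear_jac]])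

lemma jac_matrix_inverse:
  assumes "c \<in> charts_at A p" "d \<in> charts_at A p"
  shows "jac_matrix p c d ** jac_matrix p d c = mat 1"
proof -
  have "(jac_matrix p c d ** jac_matrix p d c) *v v = mat 1 *v v" for v
    by (simp add: matrix_vector_mul_assoc[symmetric] jac_matrix_mult assms jac_trans jac_refl)
  then show ?thesis using matrix_eq by blast
qed

lemma coord_basis:
  assumes u: "u \<in> SB" and c: "c \<in> charts_at A (fst u)"
  shows "coord_basis A u i \<in> tangent_space A (fst u)"
    "coord_basis A u i c = jac_matrix (fst u) (some_chart A (fst u)) c *v axis i 1"
proof -
  have c0: "some_chart A (fst u) \<in> charts_at A (fst u)" using some_chart_in slit_bundle_tangent(2)[OF u] by blast
  show t: "coord_basis A u i \<in> tangent_space A (fst u)"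
    unfolding coord_basis_def by (rule coord_vec_tangent[OF c0])
  show "coord_basis A u i c = jac_matrix (fst u) (some_chart A (fst u)) c *v axis i 1"
    using tangent_jac[OF t c0 c] coord_vec_chart[OF c0] jac_matrix_mult[OF c0 c] by (simp add: coord_basis_def)
qed

text \<open>Tensoriality removes the arbitrary extensions. The matrices of one endomorphism in two
  charts are conjugate by the Jacobian, so the trace may be taken in the chart \<open>c\<close>; the
  division undoes the factor \<open>\<phi>\<close> of the frame.\<close>

lemma h_ricci_chart:
  assumes u: "u \<in> SB" and \<phi>: "cutoff c \<phi>" "\<phi> (fst u) \<noteq> 0" and X: "pi_field A X" and Z: "pi_field A Z"
  shows "h_ricci A D X Z u = (\<Sum>b\<in>UNIV. R X (frame_field c \<phi> (axis b 1)) Z u c $ b) / \<phi> (fst u)"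
proof -
  let ?p = "fst u" let ?d = "some_chart A ?p" let ?s = "\<phi> ?p"
  have c: "c \<in> charts_at A ?p" using cutoff_outside[OF \<phi>(1)] \<phi>(2) cutoff_chart[OF \<phi>(1)] by (auto simp: charts_at_def)
  have d: "?d \<in> charts_at A ?p" using some_chart_in slit_bundle_tangent(2)[OF u] by blast
  let ?P = "jac_matrix ?p ?d c" and ?Q = "jac_matrix ?p c ?d"
  define M :: "real^'n^'n" where "M = (\<chi> e b. R X (frame_field c \<phi> (axis b 1)) Z u c $ e / ?s)"
  have M: "R X Y Z u c = M *v (Y u c)" if Y: "pi_field A Y" for Y
  proof -
    have "R X Y Z u c = (\<Sum>i\<in>UNIV. ((Y u c $ i) / ?s) *\<^sub>R R X (frame_field c \<phi> (axis i 1)) Z u c)"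
      by (rule tensorial_expansion_axis[of "\<lambda>Y. R X Y Z u c", OF _ _ \<phi> Y])
        (simp_all add: R_add_2 R_fscale_2 X Z)
    then show ?thesis by (simp add: vec_eq_iff M_def matrix_vector_mult_def mult.commute)
  qed
  have "R X (pi_extension A u (coord_basis A u i)) Z u ?d $ i = (?Q ** (M ** ?P)) $ i $ i" for i
  proof -
    note e = pi_extension[OF u coord_basis(1)[OF u c], of i]
    have "R X (pi_extension A u (coord_basis A u i)) Z u ?d = ?Q *v (M *v (?P *v axis i 1))"
      using tangent_jac[OF pi_fieldD(1)[OF pi_field_R[OF X e(1) Z] u] c d]
      by (simp add: jac_matrix_mult[OF c d] M[OF e(1)] e(2) coord_basis(2)[OF u c])
    also have "\<dots> $ i = (?Q ** (M ** ?P)) $ i $ i"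
      by (simp only: matrix_vector_mul_assoc matrix_vector_mult_axis matrix_mul_assoc)
    finally show ?thesis .
  qed
  then have "h_ricci A D X Z u = trace (?Q ** (M ** ?P))"
    by (simp add: h_ricci_def trace_def)
  also have "\<dots> = trace M"
    by (simp add: trace_mul_sym[of ?Q] matrix_mul_assoc[symmetric] jac_matrix_inverse[OF d c])
  finally show ?thesis by (simp add: trace_def M_def sum_divide_distrib)
qed

text \<open>\<open>h_ricci_chart\<close> passes the linearity of \<open>R\<close> over functions on
  to both arguments, and each expansion costs one factor \<open>\<phi>\<close>.\<close>

lemma h_ricci_frame_expansion:
  assumes u: "u \<in> SB" and \<phi>: "cutoff c \<phi>" "\<phi> (fst u) \<noteq> 0" and X: "pi_field A X" and Z: "pi_field A Z"
  shows "h_ricci A D X Z u = (\<Sum>i\<in>UNIV. \<Sum>j\<in>UNIV. (X u c $ i) * (Z u c $ j) *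
      (h_ricci A D (frame_field c \<phi> (axis i 1)) (frame_field c \<phi> (axis j 1)) u / (\<phi> (fst u) * \<phi> (fst u))))"
proof -
  note E = pi_field_frame[OF \<phi>(1)]
  note rc = h_ricci_chart[OF u \<phi>]
  have 1: "h_ricci A D X Z u = (\<Sum>i\<in>UNIV. ((X u c $ i) / \<phi> (fst u)) *\<^sub>R h_ricci A D (frame_field c \<phi> (axis i 1)) Z u)"
    by (rule tensorial_expansion_axis[of "\<lambda>X. h_ricci A D X Z u", OF _ _ \<phi> X])
      (simp_all add: rc R_add_1 R_fscale_1 Z E pi_field_add pi_field_fscale sum.distrib add_divide_distrib sum_distrib_left)
  have 2: "h_ricci A D Y Z u = (\<Sum>j\<in>UNIV. ((Z u c $ j) / \<phi> (fst u)) *\<^sub>R h_ricci A D Y (frame_field c \<phi> (axis j 1)) u)"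
    if Y: "pi_field A Y" for Y
    by (rule tensorial_expansion_axis[of "\<lambda>Z. h_ricci A D Y Z u", OF _ _ \<phi> Z])
      (simp_all add: rc R_add_3 R_fscale_3 Y E pi_field_add pi_field_fscale sum.distrib add_divide_distrib sum_distrib_left)
  show ?thesis
    unfolding 1 2[OF E] by (simp add: sum_distrib_left mult.assoc)
qed

end

section \<open>The Finsler metric\<close>

text \<open>The direction \<open>V x\<close> is frozen in the inner derivative. Letting it move
  produces the extra term \<open>Df(DV(W))\<close>, which is smooth and can be subtracted.\<close>

lemma smooth_on_fderiv2_along:
  fixes f :: "'a::euclidean_space \<Rightarrow> 'b::euclidean_space"
  assumes "open S" "smooth_on S f" "smooth_on S V" "smooth_on S W"
  shows "smooth_on S (\<lambda>x. fderiv (\<lambda>z. fderiv f z (V x)) x (W x))"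
proof -
  have "smooth_on S (\<lambda>x. fderiv (\<lambda>z. fderiv f z (V z)) x (W x) - fderiv f x (fderiv V x (W x)))"
    by (intro smooth_on_diff smooth_on_fderiv_along assms)
  then show ?thesis
    by (rule smooth_on_cong[OF assms(1), rotated])
      (simp add: fderiv_fderiv_apply[OF assms(1,2) _ smooth_on_differentiable[OF assms(3)]])
qed

locale finsler_connection = pullback_connection A D for A :: "('p, real^'n) chart set" and D +
  fixes L :: "('p, real^'n) tpoint \<Rightarrow> real"
  assumes smooth_L: "smooth_fun SA L"
    and positive: "u \<in> SB \<Longrightarrow> a \<in> tangent_space A (fst u) \<Longrightarrow> a \<noteq> 0 \<Longrightarrow> finsler_metric L u a a > 0"
    and metric: "metric_connection A L D"
begin

abbreviation "g \<equiv> finsler_metric L"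

definition energy :: "('p, real^'n) chart \<Rightarrow> (real^'n) \<times> (real^'n) \<Rightarrow> real" where
  "energy c = (\<lambda>u. (L u)\<^sup>2 / 2) \<circ> chart_inv (sc c)"

lemma smooth_energy: "c \<in> A \<Longrightarrow> smooth_on (chart_image (sc c)) (energy c)"
proof -
  assume c: "c \<in> A"
  have "smooth_on (chart_image (sc c)) (\<lambda>z. (1/2) * ((L \<circ> chart_inv (sc c)) z)\<^sup>2)"
    by (intro smooth_on_mult smooth_on_power smooth_on_const open_slit_chart_image c
        slit.smooth_funD[OF smooth_L] slit_chart_in)
  then show ?thesis by (simp add: energy_def o_def)
qed

lemma energy_fibre:
  assumes u: "u \<in> SB" and c: "c \<in> charts_at A (fst u)" and w: "w \<in> tangent_space A (fst u)" "w c \<noteq> 0"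
  shows "energy c (snd c (fst u), w c) = (L (fst u, w))\<^sup>2 / 2"
proof -
  have "(fst u, w) \<in> SB" using slit_bundle_tangent(2)[OF u] w by (intro slit_bundleI) auto
  then have "chart_inv (sc c) (snd (sc c) (fst u, w)) = (fst u, w)"
    using charts_atD[OF c] by (intro slit.chart_inv_chart slit_chart_in) auto
  then show ?thesis by (simp add: energy_def)
qed

text \<open>In a chart the iterated one-variable derivatives defining \<open>g\<close> are a second
  derivative of \<open>energy c\<close> in vertical directions; smoothness and bilinearity of
  \<open>g\<close> are drawn from this form.\<close>

lemma metric_chart:
  assumes u: "u \<in> SB" and c: "c \<in> charts_at A (fst u)"
    and a: "a \<in> tangent_space A (fst u)" and b: "b \<in> tangent_space A (fst u)"
  shows "g u a b = fderiv (\<lambda>z. fderiv (energy c) z (0, b c)) (snd (sc c) u) (0, a c)"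
proof -
  have cA: "c \<in> A" using c charts_atD by blast
  let ?v = "snd u" let ?z = "(snd c (fst u), ?v c)" let ?e = "energy c"
  have v: "?v \<in> tangent_space A (fst u)" by (rule slit_bundle_tangent(1)[OF u])
  have y: "?v c \<noteq> 0" by (rule slit_component_nonzero[OF u c])
  have im: "(snd c (fst u), w) \<in> chart_image (sc c)" if "w \<noteq> 0" for w
    using that charts_at_image[OF c] by (simp add: slit_chart_image[OF cA])
  \<comment> \<open>Slit charts omit the zero vector, so \<open>energy c\<close> describes the curve
    only while its fibre component is nonzero; this holds on an open set of parameters.\<close>
  have op: "open {t. w + t *\<^sub>R b' \<noteq> 0}" for w b' :: "real^'n"
  proof -
    have "open ((\<lambda>t. w + t *\<^sub>R b') -` (- {0}))"
      by (intro open_vimage open_Compl closed_singleton continuous_intros)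
    then show ?thesis by (simp add: vimage_def)
  qed
  have inner: "deriv (\<lambda>t. (L (fst u, ?v + s \<odot> a + t \<odot> b))\<^sup>2 / 2) 0 = fderiv ?e (?z + s *\<^sub>R (0, a c)) (0, b c)"
    if s: "?v c + s *\<^sub>R a c \<noteq> 0" for s
  proof (rule DERIV_imp_deriv)
    let ?w = "?v c + s *\<^sub>R a c"
    have z: "?z + s *\<^sub>R (0, a c) = (snd c (fst u), ?w)" by simp
    have "((\<lambda>t. ?e ((snd c (fst u), ?w) + t *\<^sub>R (0, b c))) has_real_derivative
        fderiv ?e ((snd c (fst u), ?w) + 0 *\<^sub>R (0, b c)) (0, b c)) (at 0)"
      by (rule has_real_derivative_along_line) (use smooth_on_differentiable[OF smooth_energy[OF cA] im[OF s]] in simp)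
    then have "((\<lambda>t. ?e ((snd c (fst u), ?w) + t *\<^sub>R (0, b c))) has_real_derivative
        fderiv ?e (?z + s *\<^sub>R (0, a c)) (0, b c)) (at 0)" unfolding z by simp
    then show "((\<lambda>t. (L (fst u, ?v + s \<odot> a + t \<odot> b))\<^sup>2 / 2) has_real_derivative
        fderiv ?e (?z + s *\<^sub>R (0, a c)) (0, b c)) (at 0)"
    proof (rule has_field_derivative_transform_within_open[OF _ op[of ?w "b c"]])
      fix t assume "t \<in> {t. ?w + t *\<^sub>R b c \<noteq> 0}"
      then show "?e ((snd c (fst u), ?w) + t *\<^sub>R (0, b c)) = (L (fst u, ?v + s \<odot> a + t \<odot> b))\<^sup>2 / 2"
        using energy_fibre[OF u c, of "?v + s \<odot> a + t \<odot> b"] by (simp add: tangent_add tangent_scale v a b)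
    qed (use s in simp)
  qed
  have "((\<lambda>s. fderiv ?e (?z + s *\<^sub>R (0, a c)) (0, b c)) has_real_derivative
      fderiv (\<lambda>z. fderiv ?e z (0, b c)) (?z + 0 *\<^sub>R (0, a c)) (0, a c)) (at 0)"
    by (rule has_real_derivative_along_line)
      (use smooth_on_differentiable[OF smooth_on_fderiv[OF smooth_energy[OF cA]] im[OF y]] in simp)
  then have "((\<lambda>s. deriv (\<lambda>t. (L (fst u, ?v + s \<odot> a + t \<odot> b))\<^sup>2 / 2) 0) has_real_derivative
      fderiv (\<lambda>z. fderiv ?e z (0, b c)) (?z + 0 *\<^sub>R (0, a c)) (0, a c)) (at 0)"
    by (rule has_field_derivative_transform_within_open[OF _ op[of "?v c" "a c"]]) (use y inner in auto)
  then show ?thesis unfolding finsler_metric_def by (simp add: DERIV_imp_deriv)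
qed

text \<open>Linearity in the left argument is that of the outer derivative. In the right argument
  the inner derivative is linear at every point of the chart, and this identity of functions is then
  differentiated.\<close>

lemma metric_bilinear:
  assumes u: "u \<in> SB" and a: "a \<in> tangent_space A (fst u)" and b: "b \<in> tangent_space A (fst u)"
    and a': "a' \<in> tangent_space A (fst u)"
  shows metric_add_left: "g u (a + a') b = g u a b + g u a' b"
    and metric_scale_left: "g u (s \<odot> a) b = s * g u a b"
    and metric_add_right: "g u b (a + a') = g u b a + g u b a'"
    and metric_scale_right: "g u b (s \<odot> a) = s * g u b a"
proof -
  obtain c where c: "c \<in> charts_at A (fst u)" using slit_ex_chart[OF u] by blast
  have cA: "c \<in> A" using c charts_atD by blast
  let ?z = "snd (sc c) u" let ?e = "energy c"
  have z: "?z \<in> chart_image (sc c)" by (rule slit.charts_at_image[OF slit_charts_atI[OF u c]])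
  note o = open_slit_chart_image[OF cA]
  have df: "(\<lambda>z. fderiv ?e z w) differentiable (at ?z)" for w
    by (rule smooth_on_differentiable[OF smooth_on_fderiv[OF smooth_energy[OF cA]] z])
  have l1: "linear (fderiv (\<lambda>z. fderiv ?e z w) ?z)" for w by (rule linear_frechet_derivative[OF df])
  have l2: "linear (fderiv ?e z)" if "z \<in> chart_image (sc c)" for z
    by (rule linear_frechet_derivative[OF smooth_on_differentiable[OF smooth_energy[OF cA] that]])
  have "fderiv (\<lambda>z. fderiv ?e z (w + w')) ?z = fderiv (\<lambda>z. fderiv ?e z w + fderiv ?e z w') ?z" for w w'
    by (rule fderiv_cong_open[OF df o z]) (simp add: linear_add[OF l2])
  then have r1: "fderiv (\<lambda>z. fderiv ?e z (w + w')) ?z v = fderiv (\<lambda>z. fderiv ?e z w) ?z v + fderiv (\<lambda>z. fderiv ?e z w') ?z v" for w w' v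
    using fderiv_add[OF df df] by simp
  have "fderiv (\<lambda>z. fderiv ?e z (s *\<^sub>R w)) ?z = fderiv (\<lambda>z. s *\<^sub>R fderiv ?e z w) ?z" for w
    by (rule fderiv_cong_open[OF df o z]) (simp add: linear_scale[OF l2])
  then have r2: "fderiv (\<lambda>z. fderiv ?e z (s *\<^sub>R w)) ?z v = s * fderiv (\<lambda>z. fderiv ?e z w) ?z v" for w v
    using fderiv_scaleR[OF differentiable_const df] by simp
  have p: "(0 :: real^'n, x + x') = (0, x) + (0, x')" "(0 :: real^'n, s *\<^sub>R x) = s *\<^sub>R (0, x)" for x x' :: "real^'n" by auto
  note m = metric_chart[OF u c] tangent_add tangent_scale a b a'
  show "g u (a + a') b = g u a b + g u a' b" "g u (s \<odot> a) b = s * g u a b"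
    by (simp_all only: m plus_fun_apply tscale_apply p linear_add[OF l1] linear_scale[OF l1] real_scaleR_def)
  show "g u b (a + a') = g u b a + g u b a'" "g u b (s \<odot> a) = s * g u b a"
    by (simp_all only: m plus_fun_apply tscale_apply p r1 r2)
qed

lemma smooth_metric:
  assumes Y: "pi_field A Y" and Z: "pi_field A Z"
  shows "smooth_fun SA (\<lambda>u. g u (Y u) (Z u))"
proof (rule slit_smooth_funI)
  fix c assume c: "c \<in> A"
  note o = open_slit_chart_image[OF c]
  let ?Y = "\<lambda>z. Y (chart_inv (sc c) z) c" and ?Z = "\<lambda>z. Z (chart_inv (sc c) z) c"
  have "smooth_on (chart_image (sc c)) (\<lambda>z. fderiv (\<lambda>z'. fderiv (energy c) z' (0, ?Z z)) z (0, ?Y z))"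
    by (intro smooth_on_fderiv2_along smooth_on_Pair smooth_on_const smooth_energy o c pi_fieldD(3)[OF Y c] pi_fieldD(3)[OF Z c])
  then show "smooth_on (chart_image (sc c)) ((\<lambda>u. g u (Y u) (Z u)) \<circ> chart_inv (sc c))"
  proof (rule smooth_on_cong[OF o, rotated])
    fix z assume z: "z \<in> chart_image (sc c)"
    note u = slit_chart_inv_in(1,2)[OF c z]
    show "fderiv (\<lambda>z'. fderiv (energy c) z' (0, ?Z z)) z (0, ?Y z) = ((\<lambda>u. g u (Y u) (Z u)) \<circ> chart_inv (sc c)) z"
      using metric_chart[OF u pi_fieldD(1)[OF Y u(1)] pi_fieldD(1)[OF Z u(1)]] chart_inv_image(2)[OF z] by simp
  qed
qed

definition gram :: "('p, real^'n) chart \<Rightarrow> ('p, real^'n) tpoint \<Rightarrow> real^'n^'n" where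
  "gram c u = (\<chi> i j. g u (coord_vec A c (fst u) (axis i 1)) (coord_vec A c (fst u) (axis j 1)))"

lemma smooth_gram:
  assumes c: "c \<in> A"
  shows "smooth_on (chart_image (sc c)) (\<lambda>z. gram c (chart_inv (sc c) z) $ i $ j)"
proof -
  note o = open_slit_chart_image[OF c]
  have "smooth_on (chart_image (sc c)) (\<lambda>z. fderiv (\<lambda>z. fderiv (energy c) z (0, axis j 1)) z (0, axis i 1))"
    by (intro smooth_on_fderiv smooth_energy c)
  then show ?thesis
  proof (rule smooth_on_cong[OF o, rotated])
    fix z assume z: "z \<in> chart_image (sc c)"
    note u = slit_chart_inv_in(1,2)[OF c z]
    show "fderiv (\<lambda>z. fderiv (energy c) z (0, axis j 1)) z (0, axis i 1) = gram c (chart_inv (sc c) z) $ i $ j"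
      using metric_chart[OF u coord_vec_tangent[OF u(2)] coord_vec_tangent[OF u(2)]] chart_inv_image(2)[OF z]
      by (simp add: gram_def coord_vec_chart[OF u(2)])
  qed
qed

lemma metric_gram:
  assumes u: "u \<in> SB" and c: "c \<in> charts_at A (fst u)"
    and a: "a \<in> tangent_space A (fst u)" and b: "b \<in> tangent_space A (fst u)"
  shows "g u a b = a c \<bullet> (gram c u *v b c)"
proof -
  let ?e = "\<lambda>i. coord_vec A c (fst u) (axis i (1::real))"
  have e: "?e i \<in> tangent_space A (fst u)" for i by (rule coord_vec_tangent[OF c])
  have ex: "x = (\<Sum>i\<in>UNIV. x c $ i \<odot> ?e i)" if "x \<in> tangent_space A (fst u)" for x
    using tangent_expansion[OF that c] by (simp add: sum_Basis_axis inner_axis)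
  have sl: "g u (\<Sum>i\<in>I. s i \<odot> ?e i) y = (\<Sum>i\<in>I. s i * g u (?e i) y)"
    if y: "y \<in> tangent_space A (fst u)" and "finite I" for s I y
    using \<open>finite I\<close>
  proof (induction I rule: finite_induct)
    case empty
    show ?case using metric_scale_left[OF u tangent_zero y tangent_zero, of 0] by (simp only: sum.empty tscale_simps mult_zero_left)
  next
    case (insert i I)
    have "g u (s i \<odot> ?e i + (\<Sum>i\<in>I. s i \<odot> ?e i)) y = s i * g u (?e i) y + g u (\<Sum>i\<in>I. s i \<odot> ?e i) y"
      using metric_add_left[OF u tangent_scale[OF e] y tangent_sum[OF tangent_scale[OF e]]]
        metric_scale_left[OF u e y e] by simp
    then show ?case unfolding sum.insert[OF insert.hyps] insert.IH .
  qed
  have sr: "g u y (\<Sum>i\<in>I. s i \<odot> ?e i) = (\<Sum>i\<in>I. s i * g u y (?e i))"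
    if y: "y \<in> tangent_space A (fst u)" and "finite I" for s I y
    using \<open>finite I\<close>
  proof (induction I rule: finite_induct)
    case empty
    show ?case using metric_scale_right[OF u tangent_zero y tangent_zero, of 0] by (simp only: sum.empty tscale_simps mult_zero_left)
  next
    case (insert i I)
    have "g u y (s i \<odot> ?e i + (\<Sum>i\<in>I. s i \<odot> ?e i)) = s i * g u y (?e i) + g u y (\<Sum>i\<in>I. s i \<odot> ?e i)"
      using metric_add_right[OF u tangent_scale[OF e] y tangent_sum[OF tangent_scale[OF e]]]
        metric_scale_right[OF u e y e] by simp
    then show ?case unfolding sum.insert[OF insert.hyps] insert.IH .
  qed
  have "g u a b = g u (\<Sum>i\<in>UNIV. a c $ i \<odot> ?e i) b" using ex[OF a] by simp
  also have "\<dots> = (\<Sum>i\<in>UNIV. a c $ i * g u (?e i) b)" by (rule sl[OF b]) simp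
  also have "\<dots> = (\<Sum>i\<in>UNIV. a c $ i * g u (?e i) (\<Sum>j\<in>UNIV. b c $ j \<odot> ?e j))" using ex[OF b] by simp
  also have "\<dots> = (\<Sum>i\<in>UNIV. a c $ i * (\<Sum>j\<in>UNIV. b c $ j * g u (?e i) (?e j)))" by (simp add: sr[OF e])
  finally show ?thesis
    by (simp add: inner_vec_def matrix_vector_mult_def gram_def mult.commute)
qed

text \<open>A nonzero kernel vector of the Gram matrix would have length 0, against positive
  definiteness.\<close>

lemma det_gram:
  assumes u: "u \<in> SB" and c: "c \<in> charts_at A (fst u)"
  shows "det (gram c u) \<noteq> 0"
proof
  assume "det (gram c u) = 0"
  then obtain w where w: "gram c u *v w = 0" "w \<noteq> 0"
    by (metis invertible_det_nz invertible_left_inverse matrix_left_invertible_injective vec.inj_iff_eq_0)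
  let ?a = "coord_vec A c (fst u) w"
  have a: "?a \<in> tangent_space A (fst u)" "?a c = w" using coord_vec_tangent[OF c] coord_vec_chart[OF c] by auto
  then have "?a \<noteq> 0" using w(2) by auto
  then have "g u ?a ?a > 0" by (rule positive[OF u a(1)])
  then show False using metric_gram[OF u c a(1) a(1)] a(2) w(1) by simp
qed

abbreviation "scal \<equiv> h_scalar_curvature A L D"

lemma inner_matrix_axis: "axis i 1 \<bullet> (N *v axis j 1) = N $ i $ j" for N :: "real^'n^'n"
  by (simp add: inner_axis' matrix_vector_mult_axis)

lemma inner_transpose_mult: "(P *v x) \<bullet> (N *v (P *v y)) = x \<bullet> ((transpose P ** N ** P) *v y)" for P N :: "real^'n^'n"
proof -
  have "(P *v x) \<bullet> z = x \<bullet> (transpose P *v z)" for z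
    by (metis dot_lmul_matrix inner_commute transpose_matrix_vector)
  then show ?thesis by (simp only: matrix_vector_mul_assoc matrix_mul_assoc)
qed

text \<open>With \<open>?P\<close> the Jacobian, the Gram and Ricci matrices in the chosen chart are
  \<open>transpose ?P ** _ ** ?P\<close> of those in \<open>c\<close>, and the inverse Gram matrix
  transforms inversely, so \<open>?P\<close> drops out of the trace. Of the three factors
  \<open>\<phi>\<close>, two belong to the arguments of Ricci and one to its trace.\<close>

lemma scalar_curvature_chart:
  assumes u: "u \<in> SB" and \<phi>: "cutoff c \<phi>" "\<phi> (fst u) \<noteq> 0"
  shows "scal u = (\<Sum>i\<in>UNIV. \<Sum>j\<in>UNIV. matrix_inv (gram c u) $ i $ j *
    ((\<Sum>b\<in>UNIV. R (frame_field c \<phi> (axis i 1)) (frame_field c \<phi> (axis b 1)) (frame_field c \<phi> (axis j 1)) u c $ b)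
      / \<phi> (fst u) ^ 3))"
proof -
  let ?p = "fst u" let ?d = "some_chart A ?p" let ?s = "\<phi> ?p" let ?E = "\<lambda>i. frame_field c \<phi> (axis i (1::real))"
  have c: "c \<in> charts_at A ?p" using cutoff_outside[OF \<phi>(1)] \<phi>(2) cutoff_chart[OF \<phi>(1)] by (auto simp: charts_at_def)
  have d: "?d \<in> charts_at A ?p" using some_chart_in slit_bundle_tangent(2)[OF u] by blast
  let ?P = "jac_matrix ?p ?d c" and ?Q = "jac_matrix ?p c ?d"
  define S :: "real^'n^'n" where "S = (\<chi> i j. h_ricci A D (?E i) (?E j) u / (?s * ?s))"
  define e where "e i = pi_extension A u (coord_basis A u i)" for i
  have e: "pi_field A (e i)" "e i u = coord_basis A u i" "e i u c = ?P *v axis i 1" for i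
    using pi_extension[OF u coord_basis(1)[OF u c], of i] coord_basis(2)[OF u c, of i] by (simp_all add: e_def)
  define g0 :: "real^'n^'n" where "g0 = (\<chi> i j. g u (coord_basis A u i) (coord_basis A u j))"
  have ric: "h_ricci A D (e i) (e j) u = (transpose ?P ** S ** ?P) $ i $ j" for i j
  proof -
    have "h_ricci A D (e i) (e j) u = (e i u c) \<bullet> (S *v (e j u c))"
      unfolding h_ricci_frame_expansion[OF u \<phi> e(1) e(1)]
      by (simp add: inner_vec_def matrix_vector_mult_def S_def sum_distrib_left mult_ac)
    also have "\<dots> = (transpose ?P ** S ** ?P) $ i $ j"
      unfolding e(3) inner_transpose_mult inner_matrix_axis ..
    finally show ?thesis .
  qed
  have "g0 $ i $ j = (transpose ?P ** gram c u ** ?P) $ i $ j" for i j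
  proof -
    have "g0 $ i $ j = (e i u c) \<bullet> (gram c u *v (e j u c))"
      using metric_gram[OF u c coord_basis(1)[OF u c] coord_basis(1)[OF u c]] by (simp add: g0_def e(2))
    also have "\<dots> = (transpose ?P ** gram c u ** ?P) $ i $ j"
      unfolding e(3) inner_transpose_mult inner_matrix_axis ..
    finally show ?thesis .
  qed
  then have g0: "g0 = transpose ?P ** gram c u ** ?P" by (simp add: vec_eq_iff)
  have PQ: "?P ** ?Q = mat 1" "?Q ** ?P = mat 1" using jac_matrix_inverse c d by blast+
  have "det ?P * det ?Q = 1" using PQ(1) det_mul[of ?P ?Q] by simp
  then have "det g0 \<noteq> 0" using det_gram[OF u c] by (auto simp: g0 det_mul)
  then have i1: "matrix_inv g0 ** (transpose ?P ** gram c u ** ?P) = mat 1" using matrix_inv_mul_matrix g0 by blast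
  \<comment> \<open>Verifies that the transformed matrix is a left inverse of the Gram matrix in
    \<open>c\<close>, which identifies it with \<open>matrix_inv\<close>.\<close>
  have "(?P ** matrix_inv g0 ** transpose ?P) ** gram c u = ?P ** (matrix_inv g0 ** (transpose ?P ** gram c u ** ?P)) ** ?Q"
    by (simp add: matrix_mul_assoc[symmetric] PQ)
  also have "\<dots> = mat 1" by (simp add: i1 PQ)
  finally have "((?P ** matrix_inv g0 ** transpose ?P) ** gram c u) ** matrix_inv (gram c u) = matrix_inv (gram c u)" by simp
  then have gi: "?P ** matrix_inv g0 ** transpose ?P = matrix_inv (gram c u)"
    by (simp add: matrix_mul_assoc[symmetric] matrix_mul_matrix_inv[OF det_gram[OF u c]])
  \<comment> \<open>Written as a trace, the contraction can be permuted cyclically, which brings the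
    Jacobians next to \<open>matrix_inv g0\<close>.\<close>
  have tr: "(\<Sum>i\<in>UNIV. \<Sum>j\<in>UNIV. M $ i $ j * N $ i $ j) = trace (transpose M ** N)" for M N :: "real^'n^'n"
    by (subst sum.swap) (simp add: trace_def matrix_matrix_mult_def transpose_def)
  have "scal u = trace (transpose (matrix_inv g0) ** (transpose ?P ** S ** ?P))"
    by (simp add: h_scalar_curvature_def Let_def ric[unfolded e_def] g0_def[symmetric] tr)
  also have "\<dots> = trace (?P ** (transpose (matrix_inv g0) ** (transpose ?P ** S)))"
    by (subst trace_mul_sym) (simp add: matrix_mul_assoc)
  also have "?P ** (transpose (matrix_inv g0) ** (transpose ?P ** S)) = transpose (matrix_inv (gram c u)) ** S"
    by (simp add: gi[symmetric] matrix_transpose_mul matrix_mul_assoc)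
  also have "trace (transpose (matrix_inv (gram c u)) ** S) = (\<Sum>i\<in>UNIV. \<Sum>j\<in>UNIV. matrix_inv (gram c u) $ i $ j * S $ i $ j)"
    by (rule tr[symmetric])
  finally show ?thesis
    by (simp add: S_def h_ricci_chart[OF u \<phi> pi_field_frame[OF \<phi>(1)] pi_field_frame[OF \<phi>(1)]] power3_eq_cube mult_ac)
qed

text \<open>One bump function serves a whole neighbourhood of \<open>u0\<close>; there
  \<open>scal\<close> is given by \<open>scalar_curvature_chart\<close> in a single frame, whose
  ingredients are smooth.\<close>

lemma smooth_scalar_curvature: "smooth_fun SA scal"
proof (rule slit.smooth_fun_local)
  fix c' u0 assume "c' \<in> SA" and u0: "u0 \<in> fst c'"
  then obtain c where c: "c \<in> A" and c': "c' = sc c" by (auto simp: slit_atlas_def)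
  have u0S: "u0 \<in> SB" and "fst u0 \<in> fst c" using u0 c' by auto
  then obtain \<phi> where \<phi>: "cutoff c \<phi>" and \<phi>0: "\<phi> (fst u0) \<noteq> 0" using cutoffs[OF c] by blast
  define U where "U = {z \<in> chart_image (sc c). \<phi> (fst (chart_inv (sc c) z)) \<noteq> 0}"
  have s\<phi>: "smooth_fun SA (\<lambda>u. \<phi> (fst u))" by (rule smooth_fun_fst[OF cutoff_smooth[OF \<phi>]])
  have oU: "open U" unfolding U_def by (rule slit.open_cutoff_support[OF s\<phi> slit_chart_in[OF c]])
  have UI: "U \<subseteq> chart_image (sc c)" by (auto simp: U_def)
  let ?E = "\<lambda>i. frame_field c \<phi> (axis i (1::real))"
  have sR: "smooth_on U (\<lambda>z. R (?E i) (?E b) (?E j) (chart_inv (sc c) z) c $ b)" for i b j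
  proof -
    have "smooth_on U (\<lambda>z. R (?E i) (?E b) (?E j) (chart_inv (sc c) z) c)"
      by (rule smooth_on_subset[OF pi_fieldD(3)[OF pi_field_R[OF pi_field_frame pi_field_frame pi_field_frame, OF \<phi> \<phi> \<phi>] c] UI])
    from smooth_on_inner[OF oU this smooth_on_const[of U "axis b 1"]] show ?thesis by (simp add: inner_axis)
  qed
  have s: "smooth_on U (\<lambda>z. \<phi> (fst (chart_inv (sc c) z)))"
    using smooth_on_subset[OF slit.smooth_funD[OF s\<phi> slit_chart_in[OF c]] UI] by (simp add: o_def)
  have dg: "det (gram c (chart_inv (sc c) z)) \<noteq> 0" if "z \<in> U" for z
    using that UI slit_chart_inv_in(1,2)[OF c, of z] by (intro det_gram) auto
  have "smooth_on U (\<lambda>z. \<Sum>i\<in>UNIV. \<Sum>j\<in>UNIV. matrix_inv (gram c (chart_inv (sc c) z)) $ i $ j *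
    ((\<Sum>b\<in>UNIV. R (?E i) (?E b) (?E j) (chart_inv (sc c) z) c $ b) / \<phi> (fst (chart_inv (sc c) z)) ^ 3))"
    by (intro smooth_on_sum smooth_on_mult smooth_on_divide smooth_on_power smooth_on_matrix_inv oU sR s dg
        smooth_on_subset[OF smooth_gram[OF c] UI]) (auto simp: U_def)
  then have "smooth_on U (scal \<circ> chart_inv (sc c))"
  proof (rule smooth_on_cong[OF oU, rotated])
    fix z assume z: "z \<in> U"
    have u: "chart_inv (sc c) z \<in> SB" "\<phi> (fst (chart_inv (sc c) z)) \<noteq> 0"
      using z slit_chart_inv_in(1)[OF c] unfolding U_def by blast+
    show "(\<Sum>i\<in>UNIV. \<Sum>j\<in>UNIV. matrix_inv (gram c (chart_inv (sc c) z)) $ i $ j *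
      ((\<Sum>b\<in>UNIV. R (?E i) (?E b) (?E j) (chart_inv (sc c) z) c $ b) / \<phi> (fst (chart_inv (sc c) z)) ^ 3)) =
      (scal \<circ> chart_inv (sc c)) z"
      using scalar_curvature_chart[OF u(1) \<phi> u(2)] by simp
  qed
  moreover have "snd c' u0 \<in> U"
  proof -
    have "chart_inv (sc c) (snd (sc c) u0) = u0"
      by (rule slit.chart_inv_chart[OF slit_chart_in[OF c]]) (use u0 c' in simp)
    then show ?thesis using u0 c' \<phi>0 unfolding U_def by (auto simp: chart_image_def simp del: slit_chart_simps)
  qed
  ultimately show "\<exists>U\<subseteq>chart_image c'. open U \<and> snd c' u0 \<in> U \<and> smooth_on U (scal \<circ> chart_inv c')"
    using oU UI c' by blast
qed

section \<open>Recurrence\<close>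

abbreviation "G \<equiv> G_tensor L"
abbreviation "h_deriv W \<equiv> cov A D (beta A D W)"

lemma G_eq: "G X Y Z = fscale (\<lambda>u. g u (X u) (Z u)) Y - fscale (\<lambda>u. g u (Y u) (Z u)) X"
  by (auto simp: G_tensor_def fun_eq_iff)

lemma pi_field_G: "pi_field A X \<Longrightarrow> pi_field A Y \<Longrightarrow> pi_field A Z \<Longrightarrow> pi_field A (G X Y Z)"
  unfolding G_eq by (intro pi_field_diff pi_field_fscale smooth_metric)

lemma h_deriv_metric:
  assumes W: "pi_field A W" and Y: "pi_field A Y" and Z: "pi_field A Z" and u: "u \<in> SB"
  shows "lie_derivative (beta A D W) (\<lambda>w. g w (Y w) (Z w)) u = g u (h_deriv W Y u) (Z u) + g u (Y u) (h_deriv W Z u)"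
  using metric vf_tangent[OF vector_field_beta[OF W] u] u Y Z unfolding metric_connection_def
  by (simp add: cov_at)

text \<open>A Leibniz rule with no term for \<open>G\<close> itself, that is, \<open>G\<close> is
  parallel: the connection is metric, so differentiating the coefficients of \<open>G\<close> only
  differentiates their arguments.\<close>

lemma h_deriv_G:
  assumes W: "pi_field A W" and X: "pi_field A X" and Y: "pi_field A Y" and Z: "pi_field A Z"
  shows "h_deriv W (G X Y Z) = G (h_deriv W X) Y Z + G X (h_deriv W Y) Z + G X Y (h_deriv W Z)"
proof
  fix u
  note w = vector_field_beta[OF W]
  note d = pi_field_cov[OF w]
  have e: "h_deriv W (G X Y Z) = fscale (lie_derivative (beta A D W) (\<lambda>u. g u (X u) (Z u))) Y
      + fscale (\<lambda>u. g u (X u) (Z u)) (h_deriv W Y)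
      - (fscale (lie_derivative (beta A D W) (\<lambda>u. g u (Y u) (Z u))) X + fscale (\<lambda>u. g u (Y u) (Z u)) (h_deriv W X))"
    unfolding G_eq by (simp only: cov_diff cov_fscale w X Y Z smooth_metric pi_field_fscale)
  show "h_deriv W (G X Y Z) u = (G (h_deriv W X) Y Z + G X (h_deriv W Y) Z + G X Y (h_deriv W Z)) u"
  proof (cases "u \<in> SB")
    case True
    show ?thesis
      unfolding e
      by (simp add: h_deriv_metric[OF W X Z True] h_deriv_metric[OF W Y Z True] G_tensor_def fun_eq_iff algebra_simps)
  next
    \<comment> \<open>Off the slit bundle \<open>X\<close>, \<open>Y\<close> and all covariant
      derivatives are 0, whatever the coefficients.\<close>
    case False
    then show ?thesis
      unfolding e by (simp add: G_tensor_def pi_fieldD(2)[OF X] pi_fieldD(2)[OF Y] cov_at)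
  qed
qed

text \<open>The function \<open>f\<close> of the introduction.\<close>

definition scal' :: "('p, real^'n) tpoint \<Rightarrow> real" where
  "scal' u = scal u / (real CARD('n) * (real CARD('n) - 1))"

abbreviation "C \<equiv> concircular_curvature A L D"

lemma concircular_eq: "C X Y Z = R X Y Z - fscale scal' (G X Y Z)"
  unfolding concircular_curvature_def scal'_def ..

lemma smooth_scal': "smooth_fun SA scal'"
  using slit.smooth_fun_mult[OF slit.smooth_fun_const[of "inverse (real CARD('n) * (real CARD('n) - 1))"] smooth_scalar_curvature]
  unfolding scal'_def by (simp add: field_class.field_divide_inverse mult.commute)

lemma h_cov_concircular:
  assumes W: "pi_field A W" and X: "pi_field A X" and Y: "pi_field A Y" and Z: "pi_field A Z"
  shows "h_cov A D C W X Y Z = h_cov A D R W X Y Z - fscale (lie_derivative (beta A D W) scal') (G X Y Z)"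
proof -
  note w = vector_field_beta[OF W]
  have "h_deriv W (C X Y Z) = h_deriv W (R X Y Z) - (fscale (lie_derivative (beta A D W) scal') (G X Y Z)
      + fscale scal' (h_deriv W (G X Y Z)))"
    unfolding concircular_eq
    by (simp only: cov_diff cov_fscale w pi_field_R pi_field_G pi_field_fscale smooth_scal' X Y Z)
  then show ?thesis
    unfolding h_cov_def Let_def concircular_eq h_deriv_G[OF assms]
    by (simp add: fun_eq_iff algebra_simps)
qed

abbreviation "\<eta> \<equiv> fundamental_field A"

text \<open>Horizontal vectors are by definition those along which \<open>\<eta>\<close> has
  derivative 0.\<close>

lemma h_deriv_fundamental:
  assumes W: "pi_field A W" shows "h_deriv W \<eta> = 0"
proof
  fix u show "h_deriv W \<eta> u = 0 u"
    using beta_at(1)[of u W, OF _ pi_fieldD(1)[OF W]]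
    by (cases "u \<in> SB") (simp_all add: cov_at horizontal_space_def)
qed

lemma R_zero_3:
  assumes X: "pi_field A X" and Y: "pi_field A Y" shows "R X Y 0 = 0"
  using R_add_3[OF X Y pi_field_zero pi_field_zero] by simp

text \<open>\<open>Y\<close> extends a coordinate vector whose index \<open>j\<close> differs from
  an index \<open>i\<close> with nonzero component of \<open>\<eta>\<close>. If
  \<open>G \<eta> Y \<eta>\<close> vanished at \<open>u\<close>, component \<open>i\<close> would
  give \<open>g(Y, \<eta>) = 0\<close>, and then component \<open>j\<close> would give
  \<open>g(\<eta>, \<eta>) = 0\<close>.\<close>

lemma ex_G_fundamental_nonzero:
  assumes n: "CARD('n) \<ge> 2" and u: "u \<in> SB"
  obtains Y where "pi_field A Y" "G \<eta> Y \<eta> u \<noteq> 0"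
proof -
  obtain c where c: "c \<in> charts_at A (fst u)" using slit_ex_chart[OF u] by blast
  let ?v = "snd u"
  have v: "?v \<in> tangent_space A (fst u)" and v0: "?v \<noteq> 0" by (simp_all add: slit_bundle_tangent u)
  obtain i where i: "?v c $ i \<noteq> 0" using slit_component_nonzero[OF u c] by (auto simp: vec_eq_iff)
  have "UNIV \<noteq> {i}"
  proof
    assume "UNIV = {i}"
    from arg_cong[OF this, of card] n show False by simp
  qed
  then obtain j where j: "j \<noteq> i" by auto
  obtain Y where Y: "pi_field A Y" "Y u = coord_vec A c (fst u) (axis j 1)"
    using ex_pi_field[OF u coord_vec_tangent[OF c]] by blast
  have "G \<eta> Y \<eta> u \<noteq> 0"
  proof
    assume "G \<eta> Y \<eta> u = 0"
    then have "(g u ?v ?v \<odot> Y u - g u (Y u) ?v \<odot> ?v) c = 0"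
      using u by (simp add: G_tensor_def fundamental_field_def)
    then have e: "g u ?v ?v *\<^sub>R axis j 1 - g u (Y u) ?v *\<^sub>R ?v c = 0"
      by (simp add: Y(2) coord_vec_chart[OF c])
    from arg_cong[OF e, of "\<lambda>x. x $ i"] have "g u (Y u) ?v = 0" using i j by (simp add: axis_def)
    with arg_cong[OF e, of "\<lambda>x. x $ j"] have "g u ?v ?v = 0" by simp
    with positive[OF u v v0] show False by simp
  qed
  with Y(1) show ?thesis by (rule that)
qed

lemma concircular_recurrent_imp_recurrent:
  assumes n: "CARD('n) \<ge> 2" and int: "horizontally_integrable A D" and rec: "recurrent_tensor A D C \<alpha>"
  shows "recurrent_tensor A D R \<alpha>"
proof -
  have R0: "R X Y \<eta> = 0" if "pi_field A X" "pi_field A Y" for X Y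
    using int that unfolding horizontally_integrable_def by blast
  have rC: "h_cov A D C W X Y Z = fscale (\<lambda>u. \<alpha> u (W u)) (C X Y Z)"
    if "pi_field A W" "pi_field A X" "pi_field A Y" "pi_field A Z" for W X Y Z
    using rec that unfolding recurrent_tensor_def by blast
  have df: "lie_derivative (beta A D W) scal' u = \<alpha> u (W u) * scal' u" if W: "pi_field A W" and u: "u \<in> SB" for W u
  proof -
    obtain Y where Y: "pi_field A Y" and ne: "G \<eta> Y \<eta> u \<noteq> 0" using ex_G_fundamental_nonzero[OF n u] .
    note h = pi_field_fundamental
    note w = vector_field_beta[OF W]
    \<comment> \<open>In every term the last argument is either \<open>\<eta>\<close>, on which
      \<open>R\<close> vanishes, or its derivative, which is 0.\<close>
    have "h_cov A D R W \<eta> Y \<eta> = 0"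
      unfolding h_cov_def Let_def h_deriv_fundamental[OF W] R0[OF h Y] R0[OF h pi_field_cov[OF w Y]]
        R0[OF pi_field_zero Y] R_zero_3[OF h Y] cov_zero[OF w] by simp
    then have eq: "- fscale (lie_derivative (beta A D W) scal') (G \<eta> Y \<eta>) = - fscale (\<lambda>u. \<alpha> u (W u)) (fscale scal' (G \<eta> Y \<eta>))"
      using rC[OF W h Y h] unfolding h_cov_concircular[OF W h Y h] unfolding concircular_eq R0[OF h Y]
      by (simp add: fun_eq_iff)
    have "(lie_derivative (beta A D W) scal' u) \<odot> G \<eta> Y \<eta> u = (\<alpha> u (W u) * scal' u) \<odot> G \<eta> Y \<eta> u"
      using fun_cong[OF eq, of u] by simp
    from fun_cong[OF this] have 0: "lie_derivative (beta A D W) scal' u *\<^sub>R G \<eta> Y \<eta> u d = (\<alpha> u (W u) * scal' u) *\<^sub>R G \<eta> Y \<eta> u d" for d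
      by (simp only: tscale_apply)
    \<comment> \<open>Tangent vectors are functions of the chart, so the nonzero vector is cancelled
      in one of its nonzero components.\<close>
    from ne obtain d where "G \<eta> Y \<eta> u d \<noteq> 0" by (auto simp: fun_eq_iff)
    with 0[of d] show ?thesis by (simp only: scaleR_right_imp_eq)
  qed
  have "h_cov A D R W X Y Z = fscale (\<lambda>u. \<alpha> u (W u)) (R X Y Z)"
    if W: "pi_field A W" and X: "pi_field A X" and Y: "pi_field A Y" and Z: "pi_field A Z" for W X Y Z
  proof
    fix u
    \<comment> \<open>\<open>df\<close> speaks only of points of the slit bundle; elsewhere the
      terms with \<open>G\<close> are 0.\<close>
    have G0: "G X Y Z u = 0" if "u \<notin> SB"
      by (simp add: G_tensor_def pi_fieldD(2)[OF X that] pi_fieldD(2)[OF Y that])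
    have "h_cov A D R W X Y Z u = fscale (\<lambda>u. \<alpha> u (W u)) (C X Y Z) u + fscale (lie_derivative (beta A D W) scal') (G X Y Z) u"
      using fun_cong[OF rC[OF that], of u] unfolding h_cov_concircular[OF that] by (simp add: fun_eq_iff algebra_simps)
    then show "h_cov A D R W X Y Z u = fscale (\<lambda>u. \<alpha> u (W u)) (R X Y Z) u"
      using df[OF W, of u] G0 by (cases "u \<in> SB") (simp_all add: concircular_eq tscale_distribs)
  qed
  moreover have "\<exists>X Y Z. pi_field A X \<and> pi_field A Y \<and> pi_field A Z \<and> R X Y Z \<noteq> 0"
  proof (rule ccontr)
    assume "\<not> ?thesis"
    then have Rz: "R X Y Z = 0" if "pi_field A X" "pi_field A Y" "pi_field A Z" for X Y Z using that by blast
    \<comment> \<open>The chosen extensions are genuine sections, so the assumed vanishing of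
      \<open>R\<close> reaches every summand of the traces.\<close>
    have "scal u = 0" if u: "u \<in> SB" for u
    proof -
      obtain c where c: "c \<in> charts_at A (fst u)" using slit_ex_chart[OF u] by blast
      have "h_ricci A D (pi_extension A u (coord_basis A u i)) (pi_extension A u (coord_basis A u j)) u = 0" for i j
        unfolding h_ricci_def using pi_extension(1)[OF u coord_basis(1)[OF u c]] by (simp add: Rz)
      then show ?thesis by (simp add: h_scalar_curvature_def)
    qed
    then have "C X Y Z = 0" if "pi_field A X" "pi_field A Y" "pi_field A Z" for X Y Z
    proof -
      have "G X Y Z u = 0" if "u \<notin> SB" for u
        by (simp add: G_tensor_def pi_fieldD(2)[OF \<open>pi_field A X\<close> that] pi_fieldD(2)[OF \<open>pi_field A Y\<close> that])
      then have "C X Y Z u = 0" for u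
        using \<open>\<And>u. u \<in> SB \<Longrightarrow> scal u = 0\<close>
        by (cases "u \<in> SB") (simp_all add: concircular_eq Rz[OF that] scal'_def)
      then show ?thesis by (simp add: fun_eq_iff)
    qed
    then show False using rec unfolding recurrent_tensor_def by blast
  qed
  ultimately show ?thesis using rec unfolding recurrent_tensor_def by blast
qed

end

theorem theoremC:
  fixes M :: "'p topology"
    and A :: "('p, real^'n) chart set"
    and L :: "('p, real^'n) tpoint \<Rightarrow> real"
    and D :: "('p, real^'n) picon"
    and \<alpha> :: "('p, real^'n) piform"
  assumes "CARD('n) \<ge> 3"
    and "finsler_manifold M A L"
    and "cartan_connection A L D"
    and "horizontally_integrable A D"
    and "concircularly_recurrent A L D \<alpha>"
  shows "Rh_recurrent A D \<alpha>"
proof -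
  have M: "smooth_manifold M A" using assms(2) by (simp add: finsler_manifold_def)
  interpret smooth_atlas A by (rule smooth_manifold_atlas[OF M])
  interpret finsler_connection A D L
  proof
    show "\<exists>\<phi>. smooth_atlas.cutoff A c \<phi> \<and> \<phi> p \<noteq> 0" if "c \<in> A" "p \<in> fst c" for c p
      using cutoff_exists[OF M that] by blast
  qed (use assms(2,3) in \<open>auto simp: finsler_manifold_def cartan_connection_def\<close>)
  show ?thesis
    using concircular_recurrent_imp_recurrent[of \<alpha>] assms unfolding Rh_recurrent_def concircularly_recurrent_def by simp
qed

end
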